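(* Let $\eta$ be a Poisson point process in $\mathbb R^d$ with locally finite, non-atomic, non-zero intensity measure (not necessarily finite). Let $F$ be a U-statistic of order $k$ with kernel $f\ge0$. Assume that $F=F(\eta)$ is almost surely finite and that for some constants $\rho_F>0$, $\Theta_F\ge1$ and $M_F\ge m_F>0$: (K1) $f(x_1,\dots,x_k)>0$ whenever $\operatorname{diam}(x_1,\dots,x_k)\le\rho_F$; (K2) $f(x_1,\dots,x_k)=0$ whenever $\operatorname{diam}(x_1,\dots,x_k)>\Theta_F\rho_F$; (K3) $M_F\ge f(x_1,\dots,x_k)\ge m_F$ whenever $f(x_1,\dots,x_k)>0$. Then all moments of $F$ exist and for all $r\ge0$, $$\mathbb P(F\ge\mathbb E F+r)\le\exp\left(-\frac{\left((\mathbb E F+r)^{1/(2k)}-(\mathbb E F)^{1/(2k)}\right)^2}{2k^2c_d}\right),$$ $$\mathbb P(F\le\mathbb E F-r)\le\exp\left(-\frac{r^2}{2k\,\mathbb V F}\right),$$ $$\mathbb P(F>\mathbb M F+r)\le2\exp\left(-\frac{r^2}{4k^2c_d\,(r+\mathbb M F)^{2-1/k}}\right),$$ $$\mathbb P(F<\mathbb M F-r)\le2\exp\left(-\frac{r^2}{4k^2c_d\,(\mathbb M F)^{2-1/k}}\right),$$ where $$c_d=\left(2\left\lceil\Theta_F\sqrt d\right\rceil+1\right)^{2d(k-1)}\cdot M_F^2\left(\frac{k^k}{m_F\,k!}\right)^{\frac{2k-1}{k}} .$$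
   Context: For a locally finite set $\xi\subset\mathbb R^d$, $\xi^k_{\neq}$ is the set of $k$-tuples of pairwise distinct points of $\xi$. A U-statistic of order $k$ with kernel $f$ is the functional $F(\xi)=\sum_{\mathbf x\in\xi^k_{\neq}}f(\mathbf x)$, where $f:(\mathbb R^d)^k\to\mathbb R$ is symmetric and measurable; $F$ also denotes the random variable $F(\eta)$, the process $\eta$ being identified with the random locally finite set of its points. $\operatorname{diam}(x_1,\dots,x_k)$ is the Euclidean diameter of $\{x_1,\dots,x_k\}$. $\mathbb E F$, $\mathbb V F$ are expectation and variance, and $\mathbb M Z=\inf\{x\in\mathbb R:\mathbb P(Z\le x)\ge1/2\}$ is the smallest median of a real random variable $Z$. Conventions for degenerate quotients: $0/0=0$, $s/0=\infty$ for $s>0$, $\exp(-\infty)=0$. *)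

theory Defs
  imports "HOL-Probability.Probability" "HOL-Combinatorics.Permutations"
begin

definition locally_finite_set :: "'a::metric_space set \<Rightarrow> bool" where
  "locally_finite_set \<xi> \<longleftrightarrow> (\<forall>B. bounded B \<longrightarrow> finite (\<xi> \<inter> B))"

definition locally_finite_measure :: "'a::metric_space measure \<Rightarrow> bool" where
  "locally_finite_measure \<mu> \<longleftrightarrow> (\<forall>B\<in>sets \<mu>. bounded B \<longrightarrow> emeasure \<mu> B < \<infinity>)"

text \<open>For a locally finite Borel measure on a Euclidean space, having no atoms amounts to giving
  no mass to points; this is what non-atomicity means for an intensity measure.\<close>

definition non_atomic :: "'a measure \<Rightarrow> bool" where
  "non_atomic \<mu> \<longleftrightarrow> (\<forall>x\<in>space \<mu>. emeasure \<mu> {x} = 0)"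

definition num_points :: "'a set \<Rightarrow> 'a set \<Rightarrow> ennreal" where
  "num_points \<xi> B = emeasure (count_space UNIV) (\<xi> \<inter> B)"

text \<open>A Poisson process with intensity measure \<open>\<mu>\<close>, given as a random locally finite set \<open>\<eta>\<close>.
  The Poisson weights are written out because \<^const>\<open>poisson_pmf\<close> is only specified for
  positive rates; the Poisson distribution with infinite parameter is concentrated at infinity.\<close>

definition poisson_process ::
    "'w measure \<Rightarrow> 'a::euclidean_space measure \<Rightarrow> ('w \<Rightarrow> 'a set) \<Rightarrow> bool" where
  "poisson_process P \<mu> \<eta> \<longleftrightarrow>
     prob_space P \<and>
     (\<forall>\<omega>\<in>space P. locally_finite_set (\<eta> \<omega>)) \<and>
     (\<forall>B\<in>sets borel. (\<lambda>\<omega>. num_points (\<eta> \<omega>) B) \<in> borel_measurable P) \<and>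
     (\<forall>B\<in>sets borel. emeasure \<mu> B < \<infinity> \<longrightarrow>
        (\<forall>n::nat. measure P {\<omega>\<in>space P. num_points (\<eta> \<omega>) B = of_nat n}
            = measure \<mu> B ^ n / fact n * exp (- measure \<mu> B))) \<and>
     (\<forall>B\<in>sets borel. emeasure \<mu> B = \<infinity> \<longrightarrow> (AE \<omega> in P. num_points (\<eta> \<omega>) B = \<infinity>)) \<and>
     (\<forall>A::nat \<Rightarrow> 'a set. range A \<subseteq> sets borel \<longrightarrow> disjoint_family A \<longrightarrow>
        prob_space.indep_vars P (\<lambda>_. borel) (\<lambda>i \<omega>. num_points (\<eta> \<omega>) (A i)) UNIV)"

text \<open>A \<open>k\<close>-tuple is an extensional function on \<open>{..<k}\<close>.\<close>

definition distinct_tuples :: "nat \<Rightarrow> 'a set \<Rightarrow> (nat \<Rightarrow> 'a) set" where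
  "distinct_tuples k \<xi> = {x \<in> {..<k} \<rightarrow>\<^sub>E \<xi>. inj_on x {..<k}}"

definition tuple_diam :: "nat \<Rightarrow> (nat \<Rightarrow> 'a::metric_space) \<Rightarrow> real" where
  "tuple_diam k x = diameter (x ` {..<k})"

definition symmetric_kernel :: "nat \<Rightarrow> ((nat \<Rightarrow> 'a) \<Rightarrow> real) \<Rightarrow> bool" where
  "symmetric_kernel k f \<longleftrightarrow>
     (\<forall>x \<in> {..<k} \<rightarrow>\<^sub>E UNIV. \<forall>\<pi>. \<pi> permutes {..<k} \<longrightarrow> f (x \<circ> \<pi>) = f x)"

text \<open>The value in \<open>[0,\<infinity>]\<close> of the U-statistic of order \<open>k\<close> with kernel \<open>f\<close>, for \<open>f \<ge> 0\<close>.
  Since \<^const>\<open>ennreal\<close> truncates negative reals to zero, this is not the U-statistic of a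
  kernel that takes negative values.\<close>

definition u_statistic :: "nat \<Rightarrow> ((nat \<Rightarrow> 'a) \<Rightarrow> real) \<Rightarrow> 'a set \<Rightarrow> ennreal" where
  "u_statistic k f \<xi> = (\<Sum>\<^sub>\<infinity>x\<in>distinct_tuples k \<xi>. ennreal (f x))"

definition smallest_median :: "'w measure \<Rightarrow> ('w \<Rightarrow> real) \<Rightarrow> real" where
  "smallest_median P Z = Inf {x::real. measure P {\<omega>\<in>space P. Z \<omega> \<le> x} \<ge> 1 / 2}"

text \<open>Division of \<^typ>\<open>ereal\<close> satisfies \<open>0 / 0 = 0\<close> and \<open>s / 0 = \<infinity>\<close> for \<open>s > 0\<close>, so that
  degenerate quotients below an exponential can be written as \<^typ>\<open>ereal\<close> quotients.\<close>

definition exp_ereal :: "ereal \<Rightarrow> ereal" where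
  "exp_ereal x = (case x of ereal y \<Rightarrow> ereal (exp y) | PInfty \<Rightarrow> \<infinity> | MInfty \<Rightarrow> 0)"

definition c_const :: "nat \<Rightarrow> nat \<Rightarrow> real \<Rightarrow> real \<Rightarrow> real \<Rightarrow> real" where
  "c_const d k \<Theta> M m =
     (2 * of_int \<lceil>\<Theta> * sqrt (real d)\<rceil> + 1) ^ (2 * d * (k - 1)) * M\<^sup>2
       * (real k ^ k / (m * fact k)) powr ((2 * real k - 1) / real k)"

end

theory Submission
  imports Defs
begin

text \<open>Split a bounded window into finitely many small cells; the restrictions of \<open>\<eta>\<close> to the cells are
  independent. Let \<open>g\<close> be an increasing functional of the configuration and let \<open>h\<close> satisfy
  \<open>h S \<le> C - \<Sum>\<^sub>A a\<^sub>A\<^sup>2 / 2\<close> whenever deleting from \<open>S\<close> the points in any collection \<open>J\<close> of cells leaves a value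
  of \<open>g\<close> of at least \<open>C - \<Sum>\<^bsub>A\<in>J\<^esub> a\<^sub>A\<close>. Then \<open>E exp h \<le> exp (E g)\<close>, and \<open>E exp (- g) \<le> exp (- E h)\<close> if
  \<open>g \<ge> 0\<close>. These are dual forms of the transport inequalities of Marton and Talagrand, and follow by
  induction on the cells.

  Deleting cells from \<open>\<eta>\<close> decreases \<open>F\<close> by at most the sum of the individual decreases. Once every
  cell contains at most one point, these are \<open>F(\<eta>) - F(\<eta> - x)\<close> for points \<open>x\<close> of \<open>\<eta>\<close>. Counting points in cubes
  of diameter \<open>\<rho>\<close>, (K1)--(K3) give \<open>\<Sum>\<^sub>x (F(\<eta>) - F(\<eta> - x))\<^sup>2 \<le> k\<^sup>2 c\<^sub>d F\<^bsup>2 - 1/k\<^esup>\<close>, so that \<open>G = min F b\<close> satisfies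
  \<open>E exp (\<plusminus>\<lambda> (G - E G)) \<le> exp (\<lambda>\<^sup>2 k\<^sup>2 c\<^sub>d b\<^bsup>2 - 1/k\<^esup> / 2)\<close>. The upper tail at the mean and the two tails at the
  median follow by taking \<open>b\<close> to be \<open>E F + r\<close>, \<open>M F + r\<close> and \<open>M F\<close>.

  For the lower tail at the mean, the second exponential inequality is applied to \<open>g = \<lambda> F\<close> and
  \<open>h = \<lambda> F - \<lambda>\<^sup>2/2 \<Sum>\<^sub>A (F(\<eta>) - F(\<eta> - A))\<^sup>2\<close>. The expectation of the sum is at most \<open>k V F\<close> in the limit, by a
  reverse Efron--Stein inequality for functionals of degree \<open>k\<close>; here the intensity measure has to be
  non-atomic, so that the cells are empty with probability close to 1.\<close>

section \<open>Finite configurations and the Poisson process\<close>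

text \<open>The obstacle to an induction on cells with a true infimum over random deletions is
  measurability: the best competitor depends on the configuration. In the upper inequality this is
  avoided because, for a fixed deletion probability \<open>\<theta>\<close>, the function
  \<open>h - \<theta>\<^sup>2 / 2\<close> is certified for the mixture
  \<open>(1 - \<theta>) * g S + \<theta> * g (S - A)\<close>, so that one measurable
  \<open>h\<close> serves throughout. In the lower inequality the certified constants would have to
  be selected measurably; a recursively defined functional that dominates all of them takes their
  place. Truncation serves two ends. The bound on the sum of squares grows with F and becomes a
  constant, a sub-Gaussian variance proxy, only below a level b. Moreover, nothing is known at first
  about the moments of F, and min F b is bounded. The median bounds come from truncated variables
  alone; they yield all moments, and only then do the bounds at the mean, which involve E F and V F,
  become available.\<close>

definition fin_config :: "'a::topological_space set measure" where
  "fin_config = sigma {S. finite S} {{S. finite S \<and> card (S \<inter> B) = n} | B n. B \<in> sets borel}"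

lemma space_fin_config [simp]: "space fin_config = {S. finite S}"
  unfolding fin_config_def by (subst space_measure_of) auto

lemma sets_fin_config:
  "sets fin_config = sigma_sets {S. finite S} {{S. finite S \<and> card (S \<inter> B) = n} | B n. B \<in> sets borel}"
  unfolding fin_config_def by (subst sets_measure_of) auto

lemma measurable_card_Int [measurable]:
  assumes "B \<in> sets borel"
  shows "(\<lambda>S. card (S \<inter> B)) \<in> measurable fin_config (count_space UNIV)"
proof (subst measurable_count_space_eq2_countable, safe)
  fix n
  have "(\<lambda>S. card (S \<inter> B)) -` {n} \<inter> space fin_config = {S. finite S \<and> card (S \<inter> B) = n}"
    by auto
  also have "\<dots> \<in> sets fin_config"
    unfolding sets_fin_config using assms by (intro sigma_sets.Basic) auto
  finally show "(\<lambda>S. card (S \<inter> B)) -` {n} \<inter> space fin_config \<in> sets fin_config" .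
qed auto

lemma measurable_fin_configI:
  assumes "\<And>x. x \<in> space M \<Longrightarrow> finite (X x)"
    and "\<And>B. B \<in> sets borel \<Longrightarrow> (\<lambda>x. card (X x \<inter> B)) \<in> measurable M (count_space UNIV)"
  shows "X \<in> measurable M fin_config"
  unfolding fin_config_def
proof (rule measurable_measure_of)
  show "X \<in> space M \<rightarrow> {S. finite S}" using assms(1) by auto
next
  fix y assume "y \<in> {{S. finite S \<and> card (S \<inter> B) = n} | B n. B \<in> sets (borel :: 'b measure)}"
  then obtain B n where y: "y = {S. finite S \<and> card (S \<inter> B) = n}" "B \<in> sets borel" by auto
  have "X -` y \<inter> space M = (\<lambda>x. card (X x \<inter> B)) -` {n} \<inter> space M"
    using assms(1) y by auto
  also have "\<dots> \<in> sets M" by (rule measurable_sets[OF assms(2)[OF y(2)]]) auto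
  finally show "X -` y \<inter> space M \<in> sets M" .
qed auto

text \<open>Disjointness makes the counts of the two parts add up.\<close>

lemma measurable_fin_config_Un:
  assumes X: "X \<in> measurable M fin_config" and Y: "Y \<in> measurable M fin_config"
    and disj: "\<And>x. x \<in> space M \<Longrightarrow> X x \<inter> Y x = {}"
  shows "(\<lambda>x. X x \<union> Y x) \<in> measurable M fin_config"
proof (rule measurable_fin_configI)
  have fin: "finite (X x)" "finite (Y x)" if "x \<in> space M" for x
    using measurable_space[OF X that] measurable_space[OF Y that] by auto
  then show "finite (X x \<union> Y x)" if "x \<in> space M" for x using that by simp
  fix B :: "'b set" assume B: "B \<in> sets borel"
  have "(\<lambda>x. card (X x \<inter> B) + card (Y x \<inter> B)) \<in> measurable M (count_space UNIV)"
    using measurable_compose[OF X measurable_card_Int[OF B]] measurable_compose[OF Y measurable_card_Int[OF B]]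
    by measurable
  also have "?this \<longleftrightarrow> (\<lambda>x. card ((X x \<union> Y x) \<inter> B)) \<in> measurable M (count_space UNIV)"
    using fin disj by (intro measurable_cong) (subst Int_Un_distrib2, subst card_Un_disjoint, auto)
  finally show "(\<lambda>x. card ((X x \<union> Y x) \<inter> B)) \<in> measurable M (count_space UNIV)" .
qed

text \<open>Joint count events: unlike the one-set events, these form a \<open>\<pi>\<close>-system.\<close>

definition count_event :: "('a set \<times> nat) set \<Rightarrow> 'a set set" where
  "count_event Q = {S. finite S \<and> (\<forall>(B, n)\<in>Q. card (S \<inter> B) = n)}"

lemma count_event_sets:
  assumes "finite Q" "fst ` Q \<subseteq> sets borel"
  shows "count_event Q \<in> sets fin_config"
proof -
  have "count_event Q = {S\<in>space fin_config. \<forall>q\<in>Q. card (S \<inter> fst q) = snd q}"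
    by (auto simp: count_event_def)
  also have "\<dots> \<in> sets fin_config"
  proof (rule sets.sets_Collect_finite_All[OF _ assms(1)])
    fix q assume "q \<in> Q"
    then have [measurable]: "fst q \<in> sets borel" using assms(2) by auto
    show "{S \<in> space fin_config. card (S \<inter> fst q) = snd q} \<in> sets fin_config" by measurable
  qed
  finally show ?thesis .
qed

lemma sets_fin_config_count_event:
  "sets fin_config = sigma_sets {S::'a::topological_space set. finite S}
     {count_event Q | Q. finite Q \<and> fst ` Q \<subseteq> sets borel}"
proof
  show "sets fin_config \<subseteq> sigma_sets {S::'a set. finite S}
     {count_event Q | Q. finite Q \<and> fst ` Q \<subseteq> sets borel}"
    unfolding sets_fin_config
  proof (rule sigma_sets_mono, safe)
    fix B :: "'a set" and n assume "B \<in> sets borel"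
    then show "{S. finite S \<and> card (S \<inter> B) = n} \<in> sigma_sets {S. finite S}
        {count_event Q | Q. finite Q \<and> fst ` Q \<subseteq> sets borel}"
      by (intro sigma_sets.Basic) (auto simp: count_event_def intro!: exI[of _ "{(B, n)}"])
  qed
  have "sigma_sets (space fin_config)
     {count_event Q | Q. finite Q \<and> fst ` Q \<subseteq> sets (borel :: 'a measure)} \<subseteq> sets fin_config"
    by (rule sets.sigma_sets_subset) (auto intro: count_event_sets)
  then show "sigma_sets {S::'a set. finite S}
     {count_event Q | Q. finite Q \<and> fst ` Q \<subseteq> sets borel} \<subseteq> sets fin_config" by simp
qed

lemma Int_stable_count_event:
  "Int_stable {count_event Q | Q. finite Q \<and> fst ` Q \<subseteq> sets (borel :: 'a::topological_space measure)}"
proof (rule Int_stableI, clarify)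
  fix Q R :: "('a set \<times> nat) set"
  assume "finite Q" "fst ` Q \<subseteq> sets borel" "finite R" "fst ` R \<subseteq> sets borel"
  then show "\<exists>Qa. count_event Q \<inter> count_event R = count_event Qa \<and> finite Qa \<and> fst ` Qa \<subseteq> sets borel"
    by (intro exI[of _ "Q \<union> R"]) (auto simp: count_event_def ball_Un)
qed

section \<open>Bounded Borel sets and the Poisson process restricted to them\<close>

definition bborel :: "'a::euclidean_space set \<Rightarrow> bool" where
  "bborel A \<longleftrightarrow> A \<in> sets borel \<and> bounded A"

lemma bborelD [dest]: "bborel A \<Longrightarrow> A \<in> sets borel" "bborel A \<Longrightarrow> bounded A"
  by (auto simp: bborel_def)

lemma bborel_Un [intro]: "bborel A \<Longrightarrow> bborel B \<Longrightarrow> bborel (A \<union> B)"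
  by (auto simp: bborel_def)

lemma bborel_empty [simp]: "bborel {}"
  by (auto simp: bborel_def)

lemma bborel_Int [intro]: "bborel A \<Longrightarrow> B \<in> sets borel \<Longrightarrow> bborel (A \<inter> B)"
  by (auto simp: bborel_def intro: bounded_subset)

lemma bborel_Union: "finite \<A> \<Longrightarrow> (\<And>A. A \<in> \<A> \<Longrightarrow> bborel A) \<Longrightarrow> bborel (\<Union>\<A>)"
  by (induction \<A> rule: finite_induct) auto

locale poisson_points = prob_space P for P :: "'w measure" +
  fixes \<mu> :: "'a::euclidean_space measure" and \<eta> :: "'w \<Rightarrow> 'a set"
  assumes pp: "poisson_process P \<mu> \<eta>"
    and sets_mu: "sets \<mu> = sets borel"
    and locally_finite_mu: "locally_finite_measure \<mu>"
begin

lemma finite_points: "\<omega> \<in> space P \<Longrightarrow> bounded A \<Longrightarrow> finite (\<eta> \<omega> \<inter> A)"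
  using pp unfolding poisson_process_def locally_finite_set_def by blast

lemma finite_points': "\<omega> \<in> space P \<Longrightarrow> bborel A \<Longrightarrow> finite (\<eta> \<omega> \<inter> A)"
  by (auto intro: finite_points)

lemma num_points_eq_card:
  "\<omega> \<in> space P \<Longrightarrow> bborel A \<Longrightarrow> num_points (\<eta> \<omega>) A = of_nat (card (\<eta> \<omega> \<inter> A))"
  using finite_points'[of \<omega> A] unfolding num_points_def by (simp add: emeasure_count_space_finite)

lemma card_points_measurable:
  assumes "bborel A" shows "(\<lambda>\<omega>. card (\<eta> \<omega> \<inter> A)) \<in> measurable P (count_space UNIV)"
proof -
  have [measurable]: "(\<lambda>\<omega>. num_points (\<eta> \<omega>) A) \<in> borel_measurable P"
    using pp assms unfolding poisson_process_def by auto
  have "(\<lambda>\<omega>. nat \<lfloor>enn2real (num_points (\<eta> \<omega>) A)\<rfloor>) \<in> measurable P (count_space UNIV)"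
    by measurable
  also have "?this \<longleftrightarrow> ?thesis"
    by (intro measurable_cong) (simp add: num_points_eq_card assms ennreal_of_nat_eq_real_of_nat)
  finally show ?thesis .
qed

lemma points_measurable [measurable (raw)]:
  assumes "bborel A" shows "(\<lambda>\<omega>. \<eta> \<omega> \<inter> A) \<in> measurable P fin_config"
proof (rule measurable_fin_configI)
  show "finite (\<eta> \<omega> \<inter> A)" if "\<omega> \<in> space P" for \<omega> using that assms by (rule finite_points')
  fix B :: "'a set" assume "B \<in> sets borel"
  then have "bborel (A \<inter> B)" using assms by auto
  from card_points_measurable[OF this]
  show "(\<lambda>\<omega>. card (\<eta> \<omega> \<inter> A \<inter> B)) \<in> measurable P (count_space UNIV)"
    by (simp add: Int_assoc)
qed

lemma indep_card_points:
  assumes A: "\<And>i::nat. bborel (A i)" and disj: "disjoint_family A"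
  shows "indep_vars (\<lambda>_. count_space UNIV) (\<lambda>i \<omega>. card (\<eta> \<omega> \<inter> A i)) UNIV"
proof -
  have "indep_vars (\<lambda>_. borel) (\<lambda>i \<omega>. num_points (\<eta> \<omega>) (A i)) UNIV"
  proof -
    have "range A \<subseteq> sets borel" using A by auto
    then show ?thesis using pp disj unfolding poisson_process_def by blast
  qed
  then have "indep_vars (\<lambda>_. count_space UNIV) (\<lambda>i \<omega>. nat \<lfloor>enn2real (num_points (\<eta> \<omega>) (A i))\<rfloor>) UNIV"
    by (rule indep_vars_compose2) measurable
  moreover have "nat \<lfloor>enn2real (num_points (\<eta> \<omega>) (A i))\<rfloor> = card (\<eta> \<omega> \<inter> A i)" if "\<omega> \<in> space P" for i \<omega>
    using that by (simp add: num_points_eq_card A ennreal_of_nat_eq_real_of_nat)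
  then have "(\<lambda>\<omega>. nat \<lfloor>enn2real (num_points (\<eta> \<omega>) (A i))\<rfloor>) -` X \<inter> space P = (\<lambda>\<omega>. card (\<eta> \<omega> \<inter> A i)) -` X \<inter> space P"
    for i X by auto
  ultimately show ?thesis
    using card_points_measurable[OF A] unfolding indep_vars_def2 by simp
qed

lemma prob_card_points:
  assumes "bborel A"
  shows "measure P {\<omega>\<in>space P. card (\<eta> \<omega> \<inter> A) = n} = measure \<mu> A ^ n / fact n * exp (- measure \<mu> A)"
proof -
  have "emeasure \<mu> A < \<infinity>"
    using locally_finite_mu assms sets_mu unfolding locally_finite_measure_def by auto
  then have "measure P {\<omega>\<in>space P. num_points (\<eta> \<omega>) A = of_nat n}
            = measure \<mu> A ^ n / fact n * exp (- measure \<mu> A)"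
    using pp assms unfolding poisson_process_def by auto
  also have "{\<omega>\<in>space P. num_points (\<eta> \<omega>) A = of_nat n} = {\<omega>\<in>space P. card (\<eta> \<omega> \<inter> A) = n}"
    using num_points_eq_card[OF _ assms] by auto
  finally show ?thesis .
qed

text \<open>The generating function of a Poisson count is finite everywhere: the Poisson weights
  turn the series into that of \<open>exp (C * measure \<mu> A)\<close>. All integrability of
  \<open>tame\<close> functionals rests on this.\<close>

lemma integrable_power_card:
  assumes "bborel A" and C: "C \<ge> (1::real)"
  shows "integrable P (\<lambda>\<omega>. C ^ card (\<eta> \<omega> \<inter> A))"
proof (rule integrableI_nonneg)
  have [measurable]: "(\<lambda>\<omega>. card (\<eta> \<omega> \<inter> A)) \<in> measurable P (count_space UNIV)"
    by (rule card_points_measurable) fact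
  show "(\<lambda>\<omega>. C ^ card (\<eta> \<omega> \<inter> A)) \<in> borel_measurable P" by measurable
  show "AE \<omega> in P. 0 \<le> C ^ card (\<eta> \<omega> \<inter> A)" using C by simp
  define l where "l = measure \<mu> A"
  have "(\<integral>\<^sup>+\<omega>. ennreal (C ^ card (\<eta> \<omega> \<inter> A)) \<partial>P)
      = (\<integral>\<^sup>+\<omega>. (\<Sum>n. ennreal (C ^ n) * indicator {\<omega>\<in>space P. card (\<eta> \<omega> \<inter> A) = n} \<omega>) \<partial>P)"
  proof (rule nn_integral_cong)
    fix \<omega> assume "\<omega> \<in> space P"
    then have "(\<Sum>n. ennreal (C ^ n) * indicator {\<omega>\<in>space P. card (\<eta> \<omega> \<inter> A) = n} \<omega>)
       = (\<Sum>n\<in>{card (\<eta> \<omega> \<inter> A)}. ennreal (C ^ n) * indicator {\<omega>\<in>space P. card (\<eta> \<omega> \<inter> A) = n} \<omega>)"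
      by (intro suminf_finite) auto
    also have "\<dots> = ennreal (C ^ card (\<eta> \<omega> \<inter> A))" using \<open>\<omega> \<in> space P\<close> by simp
    finally show "ennreal (C ^ card (\<eta> \<omega> \<inter> A)) =
      (\<Sum>n. ennreal (C ^ n) * indicator {\<omega>\<in>space P. card (\<eta> \<omega> \<inter> A) = n} \<omega>)" by simp
  qed
  also have "\<dots> = (\<Sum>n. ennreal (C ^ n) * emeasure P {\<omega>\<in>space P. card (\<eta> \<omega> \<inter> A) = n})"
    by (subst nn_integral_suminf) (auto simp: nn_integral_cmult)
  also have "\<dots> = (\<Sum>n. ennreal (exp (- l) * ((C * l) ^ n / fact n)))"
    using C by (intro suminf_cong)
      (auto simp: emeasure_eq_measure prob_card_points[OF assms(1)] l_def ennreal_mult[symmetric]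
         power_mult_distrib mult_ac intro!: arg_cong[where f=ennreal])
  also have "\<dots> < \<infinity>"
  proof -
    have "summable (\<lambda>n. exp (- l) * ((C * l) ^ n / fact n))"
      by (intro summable_mult) (use summable_exp[of "C*l"] in \<open>simp add: field_simps\<close>)
    then show ?thesis using C
      by (subst suminf_ennreal2) (auto simp: l_def)
  qed
  finally show "(\<integral>\<^sup>+\<omega>. ennreal (C ^ card (\<eta> \<omega> \<inter> A)) \<partial>P) < \<infinity>" .
qed


lemma points_pair_measurable:
  assumes "bborel A" "bborel B" "A \<inter> B = {}"
  shows "(\<lambda>(\<omega>, \<omega>'). (\<eta> \<omega> \<inter> A) \<union> (\<eta> \<omega>' \<inter> B)) \<in> measurable (P \<Otimes>\<^sub>M P) fin_config"
  unfolding split_beta using assms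
  by (intro measurable_fin_config_Un measurable_compose[OF measurable_fst points_measurable]
      measurable_compose[OF measurable_snd points_measurable]) auto

text \<open>A finite family of Borel sets generates finitely many atoms, whose counts are independent and
  determine all counts in question.\<close>

lemma points_Un_distr:
  assumes A: "bborel A" and B: "bborel B" and AB: "A \<inter> B = {}"
  shows "distr P fin_config (\<lambda>\<omega>. \<eta> \<omega> \<inter> (A \<union> B))
    = distr (P \<Otimes>\<^sub>M P) fin_config (\<lambda>(\<omega>, \<omega>'). (\<eta> \<omega> \<inter> A) \<union> (\<eta> \<omega>' \<inter> B))" (is "?L = ?R")
proof -
  note [measurable] = points_pair_measurable[OF A B AB]
  interpret PP: pair_prob_space P P ..
  have AB_meas [measurable]: "(\<lambda>\<omega>. \<eta> \<omega> \<inter> (A \<union> B)) \<in> measurable P fin_config"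
    using A B by (intro points_measurable) auto
  interpret L: prob_space ?L by (rule prob_space_distr) fact
  show ?thesis
  proof (rule measure_eqI_generator_eq[OF Int_stable_count_event])
    show "{count_event Q |Q. finite Q \<and> fst ` Q \<subseteq> sets (borel::'a measure)} \<subseteq> Pow {S. finite S}"
      by (auto simp: count_event_def)
    show "sets ?L = sigma_sets {S. finite S} {count_event Q |Q. finite Q \<and> fst ` Q \<subseteq> sets borel}"
      "sets ?R = sigma_sets {S. finite S} {count_event Q |Q. finite Q \<and> fst ` Q \<subseteq> sets borel}"
      by (simp_all add: sets_fin_config_count_event)
    show "range (\<lambda>_::nat. {S. finite S}) \<subseteq> {count_event Q |Q. finite Q \<and> fst ` Q \<subseteq> sets borel}"
      by (auto simp: count_event_def intro!: exI[of _ "{}"])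
    show "(\<Union>_::nat. {S. finite S}) = {S. finite S}" by simp
    show "emeasure ?L {S. finite S} \<noteq> \<infinity>" by simp
  next
    fix X assume "X \<in> {count_event Q |Q. finite Q \<and> fst ` Q \<subseteq> sets (borel::'a measure)}"
    then obtain Q where X: "X = count_event Q" and Q: "finite Q" "fst ` Q \<subseteq> sets (borel::'a measure)" by auto
    define \<B> where "\<B> = fst ` Q"
    have fB: "finite \<B>" using Q by (simp add: \<B>_def)
    define e where "e = to_nat_on (Pow \<B>)"
    have e: "inj_on e (Pow \<B>)" unfolding e_def using fB by (intro inj_on_to_nat_on countable_finite) simp
    define \<tau> where "\<tau> = (\<lambda>x. {C\<in>\<B>. x \<in> C})"
    have \<tau>: "\<tau> x \<in> Pow \<B>" for x by (auto simp: \<tau>_def)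
    define part where "part = (\<lambda>b. if b then B else A)"
    \<comment> \<open>Atoms are indexed by naturals, as \<open>indep_card_points\<close> requires:
      even numbers for the part of an atom in \<open>A\<close>, odd ones for the part in
      \<open>B\<close>; a number that codes no atom gives the empty set.\<close>
    define At where "At = (\<lambda>i. {x\<in>A \<union> B. 2 * e (\<tau> x) + of_bool (x \<notin> A) = i})"
    have \<tau>_borel: "{x. \<tau> x = J} \<in> sets borel" if "J \<in> Pow \<B>" for J
    proof -
      have "{x. \<tau> x = J} = {x\<in>space borel. \<forall>C\<in>\<B>. x \<in> C \<longleftrightarrow> C \<in> J}"
        using that by (auto simp: \<tau>_def)
      also have "\<dots> \<in> sets borel"
      proof (rule sets.sets_Collect_finite_All[OF _ fB])
        fix C assume "C \<in> \<B>"
        then have [measurable]: "C \<in> sets borel" using Q by (auto simp: \<B>_def)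
        show "{x \<in> space borel. (x \<in> C) = (C \<in> J)} \<in> sets borel" by measurable
      qed
      finally show ?thesis .
    qed
    have At_borel: "At i \<in> sets borel" for i
    proof -
      have "At i = (\<Union>b. \<Union>J\<in>{J\<in>Pow \<B>. 2 * e J + of_bool b = i}. {x. \<tau> x = J} \<inter> part b)"
        using AB \<tau> by (auto simp: At_def part_def UNIV_bool split: if_splits)
      also have "\<dots> \<in> sets borel" using fB A B \<tau>_borel
        by (intro sets.finite_UN sets.Int) (auto simp: part_def)
      finally show ?thesis .
    qed
    have At_bborel: "bborel (At i)" for i
      using At_borel A B by (auto simp: bborel_def At_def intro: bounded_subset[of "A \<union> B"])
    have disj: "disjoint_family At" by (auto simp: disjoint_family_on_def At_def)
    define I where "I = (\<lambda>b. {2 * e J + of_bool b | J. J \<in> Pow \<B>})"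
    define IC where "IC = (\<lambda>b C. {2 * e J + of_bool b | J. J \<in> Pow \<B> \<and> C \<in> J})"
    have sub: "IC b C \<subseteq> I b" for b C by (auto simp: IC_def I_def)
    have finC: "finite (IC b C)" for b C
      by (rule finite_subset[OF sub]) (use fB in \<open>simp add: I_def\<close>)
    have I01: "I False \<inter> I True = {}" unfolding I_def by (auto, presburger)
    have U_part: "part b \<inter> C = (\<Union>i\<in>IC b C. At i)" if C: "C \<in> \<B>" for C b
    proof safe
      fix x assume "x \<in> part b" "x \<in> C"
      then show "x \<in> (\<Union>i\<in>IC b C. At i)" using C AB
        by (auto simp: IC_def At_def \<tau>_def part_def intro!: exI[of _ "\<tau> x"])
    next
      fix x i assume x: "i \<in> IC b C" "x \<in> At i"
      then obtain J where J: "2 * e (\<tau> x) + of_bool (x \<notin> A) = 2 * e J + of_bool b" "J \<in> Pow \<B>" "C \<in> J"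
        by (auto simp: IC_def At_def)
      have "(x \<notin> A) = b \<and> e (\<tau> x) = e J"
        using J(1) by (cases b; cases "x \<in> A"; simp; presburger)
      moreover from this have "\<tau> x = J" using e J \<tau> by (meson inj_onD)
      ultimately show "x \<in> part b" "x \<in> C"
        using x(2) J(3) by (auto simp: \<tau>_def At_def part_def split: if_splits)
    qed
    define N where "N = (\<lambda>i \<omega>. card (\<eta> \<omega> \<inter> At i))"
    have card_UN: "card (\<eta> \<omega> \<inter> (\<Union>i\<in>I. At i)) = (\<Sum>i\<in>I. N i \<omega>)"
      if "\<omega> \<in> space P" "finite I" for \<omega> I
    proof -
      have "\<eta> \<omega> \<inter> (\<Union>i\<in>I. At i) = (\<Union>i\<in>I. \<eta> \<omega> \<inter> At i)" by auto
      also have "card \<dots> = (\<Sum>i\<in>I. N i \<omega>)" unfolding N_def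
        using that disj At_bborel
        by (intro card_UN_disjoint) (auto simp: disjoint_family_on_def intro!: finite_points')
      finally show ?thesis .
    qed
    define U where "U = (\<lambda>b \<omega>. \<lambda>i\<in>I b. N i \<omega>)"
    let ?M0 = "PiM (I False) (\<lambda>_. count_space (UNIV::nat set))" and ?M1 = "PiM (I True) (\<lambda>_. count_space (UNIV::nat set))"
    have ind: "indep_vars (\<lambda>_. count_space UNIV) N UNIV"
      unfolding N_def by (rule indep_card_points[OF At_bborel disj])
    \<comment> \<open>The count vectors of the even and of the odd atoms are independent, so their
      joint law does not change when the second one is read off from an independent copy
      \<open>\<omega>'\<close>; membership in \<open>X\<close> depends on these vectors
      only.\<close>
    have "indep_var ?M0 (U False) ?M1 (U True)"
      unfolding U_def by (rule indep_var_restrict[OF ind I01]) auto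
    then have UV: "U False \<in> measurable P ?M0" "U True \<in> measurable P ?M1"
      "distr P ?M0 (U False) \<Otimes>\<^sub>M distr P ?M1 (U True) = distr P (?M0 \<Otimes>\<^sub>M ?M1) (\<lambda>x. (U False x, U True x))"
      by (auto simp: indep_var_distribution_eq)
    note [measurable] = UV(1,2)
    interpret dV: prob_space "distr P ?M1 (U True)" by (rule prob_space_distr) fact
    have "distr P ?M0 (U False) \<Otimes>\<^sub>M distr P ?M1 (U True) = distr (P \<Otimes>\<^sub>M P) (?M0 \<Otimes>\<^sub>M ?M1) (\<lambda>(x, y). (U False x, U True y))"
      by (rule pair_measure_distr[OF UV(1,2) dV.sigma_finite_measure_axioms])
    with UV(3) have eq: "distr P (?M0 \<Otimes>\<^sub>M ?M1) (\<lambda>x. (U False x, U True x)) = distr (P \<Otimes>\<^sub>M P) (?M0 \<Otimes>\<^sub>M ?M1) (\<lambda>(x, y). (U False x, U True y))"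
      by simp
    define E where "E = {p\<in>space (?M0 \<Otimes>\<^sub>M ?M1). \<forall>q\<in>Q. (\<Sum>i\<in>IC False (fst q). fst p i) + (\<Sum>i\<in>IC True (fst q). snd p i) = snd q}"
    have E: "E \<in> sets (?M0 \<Otimes>\<^sub>M ?M1)"
      unfolding E_def
    proof (rule sets.sets_Collect_finite_All[OF _ Q(1)])
      fix q assume "q \<in> Q"
      have [measurable]: "(\<lambda>p. fst p i) \<in> measurable (?M0 \<Otimes>\<^sub>M ?M1) (count_space UNIV)" if "i \<in> IC False (fst q)" for i
        using that sub[of _ "fst q"] by (intro measurable_compose[OF measurable_fst measurable_component_singleton]) auto
      have [measurable]: "(\<lambda>p. snd p i) \<in> measurable (?M0 \<Otimes>\<^sub>M ?M1) (count_space UNIV)" if "i \<in> IC True (fst q)" for i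
        using that sub[of _ "fst q"] by (intro measurable_compose[OF measurable_snd measurable_component_singleton]) auto
      show "{p\<in>space (?M0 \<Otimes>\<^sub>M ?M1). (\<Sum>i\<in>IC False (fst q). fst p i) + (\<Sum>i\<in>IC True (fst q). snd p i) = snd q} \<in> sets (?M0 \<Otimes>\<^sub>M ?M1)"
        by measurable
    qed
    have sumU: "(\<Sum>i\<in>IC b C. U b \<omega> i) = card (\<eta> \<omega> \<inter> part b \<inter> C)"
      if "C \<in> \<B>" "\<omega> \<in> space P" for \<omega> C b
    proof -
      have "(\<Sum>i\<in>IC b C. U b \<omega> i) = (\<Sum>i\<in>IC b C. N i \<omega>)"
        using sub by (intro sum.cong) (auto simp: U_def)
      then show ?thesis using card_UN[OF that(2) finC[of b C]] U_part[OF that(1)] by (simp add: Int_assoc)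
    qed
    have split: "card ((\<eta> \<omega> \<inter> A \<union> \<eta> \<omega>' \<inter> B) \<inter> C) = (\<Sum>i\<in>IC False C. U False \<omega> i) + (\<Sum>i\<in>IC True C. U True \<omega>' i)"
      if C: "C \<in> \<B>" and w: "\<omega> \<in> space P" "\<omega>' \<in> space P" for \<omega> \<omega>' C
    proof -
      have "(\<eta> \<omega> \<inter> A \<union> \<eta> \<omega>' \<inter> B) \<inter> C = (\<eta> \<omega> \<inter> A \<inter> C) \<union> (\<eta> \<omega>' \<inter> B \<inter> C)" by auto
      moreover have "finite (\<eta> \<omega> \<inter> A)" "finite (\<eta> \<omega>' \<inter> B)" using w A B finite_points' by auto
      ultimately show ?thesis
        using AB sumU[OF C w(1), of False] sumU[OF C w(2), of True]
        by (simp add: part_def, intro card_Un_disjoint) auto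
    qed
    have mem: "(\<eta> \<omega> \<inter> A \<union> \<eta> \<omega>' \<inter> B) \<in> X \<longleftrightarrow> (U False \<omega>, U True \<omega>') \<in> E"
      if w: "\<omega> \<in> space P" "\<omega>' \<in> space P" for \<omega> \<omega>'
    proof -
      have "finite (\<eta> \<omega> \<inter> A)" "finite (\<eta> \<omega>' \<inter> B)" using w A B finite_points' by auto
      moreover have "U False \<omega> \<in> space ?M0" "U True \<omega>' \<in> space ?M1" 
        using measurable_space[OF UV(1) w(1)] measurable_space[OF UV(2) w(2)] .
      moreover have "fst q \<in> \<B>" if "q \<in> Q" for q using that by (auto simp: \<B>_def)
      ultimately show ?thesis
        using split[OF _ w] by (auto simp: X count_event_def E_def space_pair_measure split_beta)
    qed
    have Xs: "X \<in> sets fin_config" unfolding X by (rule count_event_sets[OF Q])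
    have "emeasure ?L X = emeasure P ((\<lambda>\<omega>. \<eta> \<omega> \<inter> (A \<union> B)) -` X \<inter> space P)"
      using Xs by (intro emeasure_distr) auto
    also have "(\<lambda>\<omega>. \<eta> \<omega> \<inter> (A \<union> B)) -` X \<inter> space P = (\<lambda>x. (U False x, U True x)) -` E \<inter> space P"
      using mem by (auto simp: Int_Un_distrib)
    also have "emeasure P \<dots> = emeasure (distr P (?M0 \<Otimes>\<^sub>M ?M1) (\<lambda>x. (U False x, U True x))) E"
      using E by (intro emeasure_distr[symmetric]) auto
    also have "\<dots> = emeasure (P \<Otimes>\<^sub>M P) ((\<lambda>(x, y). (U False x, U True y)) -` E \<inter> space (P \<Otimes>\<^sub>M P))"
      unfolding eq using E by (intro emeasure_distr) auto
    also have "(\<lambda>(x, y). (U False x, U True y)) -` E \<inter> space (P \<Otimes>\<^sub>M P) =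
        (\<lambda>(\<omega>, \<omega>'). (\<eta> \<omega> \<inter> A) \<union> (\<eta> \<omega>' \<inter> B)) -` X \<inter> space (P \<Otimes>\<^sub>M P)"
    proof (rule set_eqI)
      fix x show "x \<in> (\<lambda>(x, y). (U False x, U True y)) -` E \<inter> space (P \<Otimes>\<^sub>M P) \<longleftrightarrow>
        x \<in> (\<lambda>(\<omega>, \<omega>'). (\<eta> \<omega> \<inter> A) \<union> (\<eta> \<omega>' \<inter> B)) -` X \<inter> space (P \<Otimes>\<^sub>M P)"
        using mem[of "fst x" "snd x"] by (cases x) (auto simp: space_pair_measure)
    qed
    also have "emeasure (P \<Otimes>\<^sub>M P) \<dots> = emeasure ?R X"
      using Xs by (intro emeasure_distr[symmetric]) auto
    finally show "emeasure ?L X = emeasure ?R X" .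
  qed
qed

end

section \<open>Resampling the points in a region\<close>

definition patch :: "'a set \<Rightarrow> 'a set \<Rightarrow> 'a set \<Rightarrow> 'a set" where
  "patch A y S = (y \<inter> A) \<union> (S - A)"

lemma patch_Int: "patch A (y \<inter> A) S = patch A y S"
  by (auto simp: patch_def)

lemma patch_Un: "patch (A \<union> B) (y \<inter> A \<union> z \<inter> B) S = patch A y (patch B z S)" if "A \<inter> B = {}"
  using that by (auto simp: patch_def)

lemma patch_commute: "A \<inter> B = {} \<Longrightarrow> patch A y (patch B z S) = patch B z (patch A y S)"
  by (auto simp: patch_def)

lemma patch_Diff: "patch A y S - A = S - A" "A \<inter> B = {} \<Longrightarrow> patch A y S - B = patch A y (S - B)"
  "patch A y (S - A) = patch A y S"
  by (auto simp: patch_def)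

lemma patch_mono: "S \<subseteq> T \<Longrightarrow> patch A y S \<subseteq> patch A y T"
  by (auto simp: patch_def)

lemma finite_patch [simp]: "finite (y \<inter> A) \<Longrightarrow> finite S \<Longrightarrow> finite (patch A y S)"
  by (auto simp: patch_def)

text \<open>Exponential growth in the number of points. The class is closed under sums, products,
  deletion and resampling, and its members are integrable over a Poisson sample, so one predicate
  replaces separate integrability conditions. The \<open>+ 1\<close> leaves room for arbitrary
  values at the empty configuration, where \<open>C ^ card S\<close> would be 1.\<close>

definition tame :: "('a::topological_space set \<Rightarrow> real) \<Rightarrow> bool" where
  "tame g \<longleftrightarrow> g \<in> borel_measurable fin_config \<and>
     (\<exists>C\<ge>1. \<forall>S. finite S \<longrightarrow> \<bar>g S\<bar> \<le> C ^ (card S + 1))"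

lemma tame_measurable [measurable_dest]: "tame g \<Longrightarrow> g \<in> borel_measurable fin_config"
  by (auto simp: tame_def)

lemma tameI:
  "g \<in> borel_measurable fin_config \<Longrightarrow> C \<ge> 1 \<Longrightarrow> (\<And>S. finite S \<Longrightarrow> \<bar>g S\<bar> \<le> C ^ (card S + 1)) \<Longrightarrow> tame g"
  by (auto simp: tame_def)

lemma tame_bounded:
  assumes "g \<in> borel_measurable fin_config" "\<And>S. finite S \<Longrightarrow> \<bar>g S\<bar> \<le> C"
  shows "tame g"
proof (rule tameI[of g "max 1 C"])
  fix S assume "finite (S :: 'a set)"
  have "max 1 C ^ 1 \<le> max 1 C ^ (card S + 1)" by (intro power_increasing) auto
  then show "\<bar>g S\<bar> \<le> max 1 C ^ (card S + 1)" using assms(2)[OF \<open>finite S\<close>] by auto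
qed (use assms in auto)

lemma tame_const [simp, intro!]: "tame (\<lambda>_. c)"
  by (rule tame_bounded[of _ "\<bar>c\<bar>"]) auto

lemma tame_mono:
  assumes "tame g" "h \<in> borel_measurable fin_config" "\<And>S. finite S \<Longrightarrow> \<bar>h S\<bar> \<le> \<bar>g S\<bar>"
  shows "tame h"
  using assms unfolding tame_def by (meson order_trans)

lemma tame_add [intro!]:
  assumes f: "tame f" and g: "tame g" shows "tame (\<lambda>S. f S + g S)"
proof -
  from f obtain C where C: "C \<ge> 1" "\<And>S. finite S \<Longrightarrow> \<bar>f S\<bar> \<le> C ^ (card S + 1)" by (auto simp: tame_def)
  from g obtain D where D: "D \<ge> 1" "\<And>S. finite S \<Longrightarrow> \<bar>g S\<bar> \<le> D ^ (card S + 1)" by (auto simp: tame_def)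
  show ?thesis
  proof (rule tameI[of _ "C + D"])
    show "(\<lambda>S. f S + g S) \<in> borel_measurable fin_config" using f g by (auto dest: tame_measurable)
    fix S assume S: "finite (S :: 'a set)"
    have "C ^ (card S + 1) + D ^ (card S + 1) = C ^ card S * C + D ^ card S * D" by simp
    also have "\<dots> \<le> (C + D) ^ card S * C + (C + D) ^ card S * D"
      using C D by (intro add_mono mult_right_mono power_mono) auto
    also have "\<dots> = (C + D) ^ (card S + 1)" by (simp add: algebra_simps)
    finally show "\<bar>f S + g S\<bar> \<le> (C + D) ^ (card S + 1)" using C(2)[OF S] D(2)[OF S] by linarith
  qed (use C D in auto)
qed

lemma tame_mult [intro!]:
  assumes f: "tame f" and g: "tame g" shows "tame (\<lambda>S. f S * g S)"
proof -
  from f obtain C where C: "C \<ge> 1" "\<And>S. finite S \<Longrightarrow> \<bar>f S\<bar> \<le> C ^ (card S + 1)" by (auto simp: tame_def)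
  from g obtain D where D: "D \<ge> 1" "\<And>S. finite S \<Longrightarrow> \<bar>g S\<bar> \<le> D ^ (card S + 1)" by (auto simp: tame_def)
  show ?thesis
  proof (rule tameI[of _ "C * D"])
    show "(\<lambda>S. f S * g S) \<in> borel_measurable fin_config" using f g by (auto dest: tame_measurable)
    fix S assume S: "finite (S :: 'a set)"
    show "\<bar>f S * g S\<bar> \<le> (C * D) ^ (card S + 1)"
      using C D S unfolding abs_mult power_mult_distrib by (intro mult_mono) auto
  next
    show "1 \<le> C * D" using C(1) D(1) mult_mono[of 1 C 1 D] by simp
  qed
qed

lemma tame_cmult: "tame f \<Longrightarrow> tame (\<lambda>S. c * f S)"
  by (rule tame_mult[OF tame_const])

lemma tame_diff [intro!]: "tame f \<Longrightarrow> tame g \<Longrightarrow> tame (\<lambda>S. f S - g S)"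
  using tame_add[OF _ tame_cmult[of g "-1"]] by simp

lemma tame_power2 [intro!]: "tame f \<Longrightarrow> tame (\<lambda>S. (f S)\<^sup>2)"
  unfolding power2_eq_square by auto

lemma tame_sum [intro!]: "(\<And>i. i \<in> I \<Longrightarrow> tame (f i)) \<Longrightarrow> tame (\<lambda>S. \<Sum>i\<in>I. f i S)"
  by (induction I rule: infinite_finite_induct) auto

lemma measurable_Diff_fin_config [measurable]:
  assumes "A \<in> sets borel" shows "(\<lambda>S. S - A) \<in> measurable fin_config fin_config"
proof (rule measurable_fin_configI)
  fix B :: "'a set" assume "B \<in> sets borel"
  then have "(\<lambda>S. card (S \<inter> (B - A))) \<in> measurable fin_config (count_space UNIV)"
    using assms by (intro measurable_card_Int) auto
  moreover have "(S - A) \<inter> B = S \<inter> (B - A)" for S by auto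
  ultimately show "(\<lambda>S. card ((S - A) \<inter> B)) \<in> measurable fin_config (count_space UNIV)"
    by simp
qed auto

lemma tame_Diff:
  assumes "tame g" "A \<in> sets borel" shows "tame (\<lambda>S. g (S - A))"
proof -
  from assms obtain C where C: "C \<ge> 1" "\<And>S. finite S \<Longrightarrow> \<bar>g S\<bar> \<le> C ^ (card S + 1)" by (auto simp: tame_def)
  show ?thesis
  proof (rule tameI[OF _ C(1)])
    show "(\<lambda>S. g (S - A)) \<in> borel_measurable fin_config"
      using measurable_compose[OF measurable_Diff_fin_config[OF assms(2)] tame_measurable[OF assms(1)]] .
    fix S :: "'a set" assume "finite S"
    then have "\<bar>g (S - A)\<bar> \<le> C ^ (card (S - A) + 1)" by (intro C) auto
    also have "\<dots> \<le> C ^ (card S + 1)" using C \<open>finite S\<close> by (intro power_increasing) (auto intro: card_mono)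
    finally show "\<bar>g (S - A)\<bar> \<le> C ^ (card S + 1)" .
  qed
qed

context poisson_points
begin

text \<open>Conditional expectation given the configuration outside \<open>A\<close>, realised as a
  function defined at every finite configuration. The inductions on cells evaluate it at individual
  configurations such as \<open>S - A\<close>, which an almost-everywhere class would not
  allow.\<close>

definition resample :: "'a set \<Rightarrow> ('a set \<Rightarrow> real) \<Rightarrow> 'a set \<Rightarrow> real" where
  "resample A g S = (\<integral>\<omega>. g (patch A (\<eta> \<omega>) S) \<partial>P)"

lemma measurable_patch [measurable]:
  assumes "bborel A"
  shows "(\<lambda>(\<omega>, S). patch A (\<eta> \<omega>) S) \<in> measurable (P \<Otimes>\<^sub>M fin_config) fin_config"
  unfolding split_beta patch_def using assms
  by (intro measurable_fin_config_Un measurable_compose[OF measurable_fst points_measurable]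
      measurable_compose[OF measurable_snd measurable_Diff_fin_config]) auto

lemma measurable_patch1:
  assumes "bborel A" "finite S"
  shows "(\<lambda>\<omega>. patch A (\<eta> \<omega>) S) \<in> measurable P fin_config"
proof -
  have "(\<lambda>\<omega>. (\<omega>, S)) \<in> measurable P (P \<Otimes>\<^sub>M fin_config)"
    using assms(2) by (intro measurable_Pair2') auto
  from measurable_compose[OF this measurable_patch[OF assms(1)]] show ?thesis by simp
qed

lemma measurable_patch2:
  assumes "bborel A" "\<omega> \<in> space P"
  shows "(\<lambda>S. patch A (\<eta> \<omega>) S) \<in> measurable fin_config fin_config"
  using measurable_compose[OF measurable_Pair1'[OF assms(2), of fin_config] measurable_patch[OF assms(1)]]
  by simp

lemma finite_patch_points:
  "bborel A \<Longrightarrow> \<omega> \<in> space P \<Longrightarrow> finite S \<Longrightarrow> finite (patch A (\<eta> \<omega>) S)"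
  by (intro finite_patch finite_points')

lemma tame_patch_bound:
  fixes g :: "'a set \<Rightarrow> real"
  assumes C: "C \<ge> 1" "\<And>S. finite S \<Longrightarrow> \<bar>g S\<bar> \<le> C ^ (card S + 1)"
    and "bborel A" "finite S" "\<omega> \<in> space P"
  shows "\<bar>g (patch A (\<eta> \<omega>) S)\<bar> \<le> C ^ (card S + 1) * C ^ card (\<eta> \<omega> \<inter> A)"
proof -
  have "\<bar>g (patch A (\<eta> \<omega>) S)\<bar> \<le> C ^ (card (patch A (\<eta> \<omega>) S) + 1)"
    using assms by (intro C finite_patch_points)
  also have "\<dots> \<le> C ^ (card S + 1 + card (\<eta> \<omega> \<inter> A))"
  proof (rule power_increasing)
    show "1 \<le> C" by fact
    have "card (patch A (\<eta> \<omega>) S) \<le> card (\<eta> \<omega> \<inter> A) + card (S - A)"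
      unfolding patch_def by (rule card_Un_le)
    also have "card (S - A) \<le> card S" using assms by (intro card_mono) auto
    finally show "card (patch A (\<eta> \<omega>) S) + 1 \<le> card S + 1 + card (\<eta> \<omega> \<inter> A)" by simp
  qed
  finally show ?thesis by (simp add: power_add)
qed

lemma tame_patch:
  assumes "tame g" "bborel A" "\<omega> \<in> space P"
  shows "tame (\<lambda>S. g (patch A (\<eta> \<omega>) S))"
proof -
  from assms obtain C where C: "C \<ge> 1" "\<And>S. finite S \<Longrightarrow> \<bar>g S\<bar> \<le> C ^ (card S + 1)" by (auto simp: tame_def)
  show ?thesis
  proof (rule tameI[of _ "C * C ^ card (\<eta> \<omega> \<inter> A)"])
    show "(\<lambda>S. g (patch A (\<eta> \<omega>) S)) \<in> borel_measurable fin_config"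
      by (rule measurable_compose[OF measurable_patch2[OF assms(2,3)] tame_measurable[OF assms(1)]])
    have 1: "1 \<le> C ^ card (\<eta> \<omega> \<inter> A)" using C(1) by (rule one_le_power)
    then show "1 \<le> C * C ^ card (\<eta> \<omega> \<inter> A)" using C(1) mult_mono[of 1 C 1 "C ^ card (\<eta> \<omega> \<inter> A)"] by simp
    fix S :: "'a set" assume S: "finite S"
    have "\<bar>g (patch A (\<eta> \<omega>) S)\<bar> \<le> C ^ (card S + 1) * (C ^ card (\<eta> \<omega> \<inter> A)) ^ 1"
      using tame_patch_bound[where g=g, OF C assms(2) S assms(3)] by simp
    also have "\<dots> \<le> C ^ (card S + 1) * (C ^ card (\<eta> \<omega> \<inter> A)) ^ (card S + 1)"
      using C 1 by (intro mult_left_mono power_increasing) auto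
    finally show "\<bar>g (patch A (\<eta> \<omega>) S)\<bar> \<le> (C * C ^ card (\<eta> \<omega> \<inter> A)) ^ (card S + 1)"
      by (simp add: power_mult_distrib mult_ac)
  qed
qed

lemma integrable_patch:
  assumes "tame g" "bborel A" "finite S"
  shows "integrable P (\<lambda>\<omega>. g (patch A (\<eta> \<omega>) S))"
proof -
  from assms obtain C where C: "C \<ge> 1" "\<And>S. finite S \<Longrightarrow> \<bar>g S\<bar> \<le> C ^ (card S + 1)" by (auto simp: tame_def)
  show ?thesis
  proof (rule Bochner_Integration.integrable_bound)
    show "integrable P (\<lambda>\<omega>. C ^ (card S + 1) * C ^ card (\<eta> \<omega> \<inter> A))"
      by (intro integrable_mult_right integrable_power_card assms C)
    show "(\<lambda>\<omega>. g (patch A (\<eta> \<omega>) S)) \<in> borel_measurable P"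
      by (rule measurable_compose[OF measurable_patch1[OF assms(2,3)] tame_measurable[OF assms(1)]])
    show "AE \<omega> in P. norm (g (patch A (\<eta> \<omega>) S)) \<le> norm (C ^ (card S + 1) * C ^ card (\<eta> \<omega> \<inter> A))"
      using tame_patch_bound[where g=g, OF C assms(2,3)] by (intro AE_I2) (auto intro: order_trans[OF _ abs_ge_self])
  qed
qed

lemma tame_resample [intro!]:
  assumes "tame g" "bborel A"
  shows "tame (resample A g)"
proof -
  from assms obtain C where C: "C \<ge> 1" "\<And>S. finite S \<Longrightarrow> \<bar>g S\<bar> \<le> C ^ (card S + 1)" by (auto simp: tame_def)
  \<comment> \<open>\<open>E\<close> is at least 1, hence \<open>E \<le> E ^ (card S + 1)\<close>,
    and the growth constant \<open>C * E\<close> absorbs the mean of the random factor.\<close>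
  define E where "E = (\<integral>\<omega>. C ^ card (\<eta> \<omega> \<inter> A) \<partial>P)"
  have int: "integrable P (\<lambda>\<omega>. C ^ card (\<eta> \<omega> \<inter> A))" by (intro integrable_power_card assms C)
  have E1: "E \<ge> 1"
  proof -
    have "(\<integral>\<omega>. 1 \<partial>P) \<le> E" unfolding E_def using C
      by (intro integral_mono int) (auto intro: one_le_power)
    then show ?thesis by (simp add: prob_space)
  qed
  show ?thesis
  proof (rule tameI[of _ "C * E"])
    have "(\<lambda>(\<omega>, S). g (patch A (\<eta> \<omega>) S)) \<in> borel_measurable (P \<Otimes>\<^sub>M fin_config)"
      using measurable_compose[OF measurable_patch[OF assms(2)] tame_measurable[OF assms(1)]]
      by (simp add: split_beta)
    then have "(\<lambda>(S, \<omega>). g (patch A (\<eta> \<omega>) S)) \<in> borel_measurable (fin_config \<Otimes>\<^sub>M P)"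
      by (subst measurable_pair_swap_iff) (simp add: split_beta)
    then show "resample A g \<in> borel_measurable fin_config"
      unfolding resample_def[abs_def] by (rule borel_measurable_lebesgue_integral)
    show "1 \<le> C * E" using C(1) E1 mult_mono[of 1 C 1 E] by simp
    fix S :: "'a set" assume S: "finite S"
    have "\<bar>resample A g S\<bar> \<le> (\<integral>\<omega>. \<bar>g (patch A (\<eta> \<omega>) S)\<bar> \<partial>P)"
      unfolding resample_def by (rule integral_abs_bound)
    also have "\<dots> \<le> (\<integral>\<omega>. C ^ (card S + 1) * C ^ card (\<eta> \<omega> \<inter> A) \<partial>P)"
      using tame_patch_bound[where g=g, OF C assms(2) S]
      by (intro integral_mono integrable_abs integrable_patch assms S integrable_mult_right int) auto
    also have "\<dots> = C ^ (card S + 1) * E ^ 1" by (simp add: E_def)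
    also have "\<dots> \<le> C ^ (card S + 1) * E ^ (card S + 1)"
      using C E1 by (intro mult_left_mono power_increasing) auto
    finally show "\<bar>resample A g S\<bar> \<le> (C * E) ^ (card S + 1)" by (simp add: power_mult_distrib mult_ac)
  qed
qed

text \<open>Complete independence of the process (\<open>points_Un_distr\<close>) together with
  Fubini: the sample over both regions may be drawn as two independent samples.\<close>

lemma resample_Un:
  assumes "tame g" "bborel A" "bborel B" "A \<inter> B = {}" "finite S"
  shows "resample (A \<union> B) g S = resample A (resample B g) S"
proof -
  interpret PP: pair_prob_space P P ..
  have AB: "bborel (A \<union> B)" using assms by auto
  define G where "G = (\<lambda>y. g (patch (A \<union> B) y S))"
  \<comment> \<open>Intersection with a Borel set is treated as deletion of its complement.\<close>
  have "(\<lambda>y. y - (- (A \<union> B)) \<union> (S - (A \<union> B))) \<in> measurable fin_config fin_config"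
    using borel_comp[OF bborelD(1)[OF AB]] assms(5) by (intro measurable_fin_config_Un measurable_Diff_fin_config measurable_const) auto
  then have [measurable]: "(\<lambda>y. patch (A \<union> B) y S) \<in> measurable fin_config fin_config"
    unfolding patch_def Diff_eq by simp
  have G [measurable]: "G \<in> borel_measurable fin_config"
    unfolding G_def using tame_measurable[OF assms(1)] by measurable
  have Gw: "G (\<eta> \<omega> \<inter> (A \<union> B)) = g (patch (A \<union> B) (\<eta> \<omega>) S)" for \<omega>
    by (simp add: G_def patch_Int)
  have Gww: "G (\<eta> \<omega> \<inter> A \<union> \<eta> \<omega>' \<inter> B) = g (patch B (\<eta> \<omega>') (patch A (\<eta> \<omega>) S))" for \<omega> \<omega>'
    by (simp add: G_def patch_Un[OF assms(4)] patch_commute[OF assms(4)])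
  note mP = points_measurable[OF AB] and mPP = points_pair_measurable[OF assms(2,3,4)]
  have "integrable P (\<lambda>\<omega>. G (\<eta> \<omega> \<inter> (A \<union> B)))"
    unfolding Gw by (rule integrable_patch[OF assms(1) AB assms(5)])
  then have "integrable (distr P fin_config (\<lambda>\<omega>. \<eta> \<omega> \<inter> (A \<union> B))) G"
    by (subst integrable_distr_eq[OF mP]) auto
  then have intPP: "integrable (P \<Otimes>\<^sub>M P) (\<lambda>x. G (\<eta> (fst x) \<inter> A \<union> \<eta> (snd x) \<inter> B))"
    unfolding points_Un_distr[OF assms(2,3,4)]
    by (subst (asm) integrable_distr_eq[OF mPP]) (auto simp: split_beta)
  have "resample (A \<union> B) g S = integral\<^sup>L (distr P fin_config (\<lambda>\<omega>. \<eta> \<omega> \<inter> (A \<union> B))) G"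
    unfolding resample_def by (subst integral_distr[OF mP]) (auto simp: Gw)
  also have "\<dots> = (\<integral>x. G (\<eta> (fst x) \<inter> A \<union> \<eta> (snd x) \<inter> B) \<partial>(P \<Otimes>\<^sub>M P))"
    unfolding points_Un_distr[OF assms(2,3,4)] by (subst integral_distr[OF mPP]) (auto simp: split_beta)
  also have "\<dots> = (\<integral>\<omega>. \<integral>\<omega>'. G (\<eta> \<omega> \<inter> A \<union> \<eta> \<omega>' \<inter> B) \<partial>P \<partial>P)"
    using PP.integral_fst'[OF intPP] by simp
  also have "\<dots> = resample A (resample B g) S"
    unfolding resample_def Gww ..
  finally show ?thesis .
qed

lemma resample_commute:
  assumes "tame g" "bborel A" "bborel B" "A \<inter> B = {}" "finite S"
  shows "resample A (resample B g) S = resample B (resample A g) S"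
  using resample_Un[OF assms] resample_Un[OF assms(1,3,2) _ assms(5)] assms(4)
  by (simp add: Un_commute Int_commute)

lemma resample_empty [simp]: "resample {} g S = g S"
  by (simp add: resample_def patch_def prob_space)

lemma resample_const [simp]: "resample A (\<lambda>_. c) S = c"
  by (simp add: resample_def prob_space)

lemma resample_add:
  assumes "tame f" "tame g" "bborel A" "finite S"
  shows "resample A (\<lambda>S. f S + g S) S = resample A f S + resample A g S"
  unfolding resample_def using assms by (intro Bochner_Integration.integral_add integrable_patch) auto

lemma resample_diff:
  assumes "tame f" "tame g" "bborel A" "finite S"
  shows "resample A (\<lambda>S. f S - g S) S = resample A f S - resample A g S"
  unfolding resample_def using assms by (intro Bochner_Integration.integral_diff integrable_patch) auto

lemma resample_cmult: "resample A (\<lambda>S. c * f S) S = c * resample A f S"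
  unfolding resample_def by simp

lemma resample_sum:
  assumes "\<And>i. i \<in> I \<Longrightarrow> tame (f i)" "bborel A" "finite S"
  shows "resample A (\<lambda>S. \<Sum>i\<in>I. f i S) S = (\<Sum>i\<in>I. resample A (f i) S)"
  unfolding resample_def using assms by (intro Bochner_Integration.integral_sum integrable_patch) auto

lemma resample_mono:
  assumes "tame f" "tame g" "bborel A" "finite S" "\<And>S. finite S \<Longrightarrow> f S \<le> g S"
  shows "resample A f S \<le> resample A g S"
  unfolding resample_def using assms
  by (intro integral_mono integrable_patch) (auto intro!: finite_patch_points)

lemma resample_mono_patch:
  assumes "tame f" "tame g" "bborel A" "finite S"
    "\<And>\<omega>. \<omega> \<in> space P \<Longrightarrow> f (patch A (\<eta> \<omega>) S) \<le> g (patch A (\<eta> \<omega>) S)"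
  shows "resample A f S \<le> resample A g S"
  unfolding resample_def using assms by (intro integral_mono integrable_patch) auto

lemma resample_cong:
  assumes "bborel A" "finite S" "\<And>S. finite S \<Longrightarrow> f S = g S"
  shows "resample A f S = resample A g S"
  unfolding resample_def using assms
  by (intro Bochner_Integration.integral_cong) (auto intro!: finite_patch_points)

lemma resample_patch_same: "resample A g (patch A y S) = resample A g S"
  unfolding resample_def by (intro Bochner_Integration.integral_cong arg_cong[where f=g]) (auto simp: patch_def)

lemma resample_patch:
  "A \<inter> B = {} \<Longrightarrow> resample A (\<lambda>S. g (patch B y S)) S = resample A g (patch B y S)"
  unfolding resample_def by (simp add: patch_commute[of A B])

lemma resample_Diff_disjoint:
  "A \<inter> B = {} \<Longrightarrow> resample A (\<lambda>S. g (S - B)) S = resample A g (S - B)"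
  unfolding resample_def by (simp add: patch_Diff)

text \<open>With the constant 1 for \<open>g\<close>, this also evaluates
  \<open>resample A h\<close> itself, which explains the factors \<open>* 1\<close> in later
  computations.\<close>

lemma resample_pull_out:
  assumes "\<And>y. h (patch A y S) = h S"
  shows "resample A (\<lambda>S. h S * g S) S = h S * resample A g S"
  unfolding resample_def by (simp add: assms)

end

section \<open>Exponential inequalities\<close>

definition incr :: "('a set \<Rightarrow> real) \<Rightarrow> bool" where
  "incr g \<longleftrightarrow> (\<forall>S T. finite T \<longrightarrow> S \<subseteq> T \<longrightarrow> g S \<le> g T)"

text \<open>\<open>quad_inf d\<close> is the minimum of \<open>(1 - \<theta>) d + \<theta>\<^sup>2 / 2\<close> over \<open>\<theta> \<in> [0,1]\<close>.\<close>

definition quad_inf :: "real \<Rightarrow> real" where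
  "quad_inf d = (if d < 0 then d else if d \<le> 1 then d - d\<^sup>2 / 2 else 1 / 2)"

lemma quad_inf_le:
  assumes "0 \<le> \<theta>" "\<theta> \<le> 1" shows "quad_inf d \<le> (1 - \<theta>) * d + \<theta>\<^sup>2 / 2"
proof -
  consider "d < 0" | "0 \<le> d" "d \<le> 1" | "d > 1" by linarith
  then show ?thesis
  proof cases
    case 1
    then have "\<theta> * d \<le> 0" using assms by (simp add: mult_nonneg_nonpos)
    moreover have "quad_inf d = (1 - \<theta>) * d + \<theta> * d" using 1 by (simp add: quad_inf_def algebra_simps)
    ultimately show ?thesis using zero_le_power2[of \<theta>] by linarith
  next
    case 2
    have "0 \<le> (d - \<theta>)\<^sup>2" by simp
    then show ?thesis using 2 by (simp add: quad_inf_def algebra_simps power2_eq_square)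
  next
    case 3
    have "0 \<le> (1 - \<theta>)\<^sup>2" by simp
    moreover have "(1 - \<theta>) * 1 \<le> (1 - \<theta>) * d" using 3 assms by (intro mult_left_mono) auto
    ultimately show ?thesis using 3 by (simp add: quad_inf_def algebra_simps power2_eq_square)
  qed
qed

lemma quad_inf_attained:
  obtains \<theta> where "0 \<le> \<theta>" "\<theta> \<le> 1" "quad_inf d = (1 - \<theta>) * d + \<theta>\<^sup>2 / 2"
\<comment> \<open>The quadratic in \<open>\<theta>\<close> has its minimum at \<open>d\<close>,
  clamped here to the unit interval.\<close>
proof (rule that[of "max 0 (min 1 d)"])
  show "quad_inf d = (1 - max 0 (min 1 d)) * d + (max 0 (min 1 d))\<^sup>2 / 2"
    by (auto simp: quad_inf_def max_def min_def power2_eq_square algebra_simps)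
qed auto

lemma abs_quad_inf_le: "\<bar>quad_inf d\<bar> \<le> \<bar>d\<bar>"
proof -
  have "d\<^sup>2 \<le> d" if "0 \<le> d" "d \<le> 1" using that by (simp add: power2_eq_square mult_left_le)
  then show ?thesis by (auto simp: quad_inf_def abs_if)
qed

lemma quad_inf_measurable [measurable]: "quad_inf \<in> borel_measurable borel"
  unfolding quad_inf_def[abs_def] by measurable

text \<open>One-cell inequality for the upper bound; up to \<open>d = 1\<close> it is
  \<open>ln (1 + d) \<ge> d - d\<^sup>2 / 2\<close>. That the right-hand side is affine in
  \<open>d\<close> lets it be averaged over the points of the cell.\<close>

lemma exp_quad_inf_le:
  assumes "d \<ge> 0" shows "exp (quad_inf d) \<le> 1 + d"
proof (cases "d \<le> 1")
  case True
  have "ln (1 + 0) - 0 + 0\<^sup>2 / 2 \<le> ln (1 + d) - d + d\<^sup>2 / 2"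
  proof (rule DERIV_nonneg_imp_nondecreasing[OF assms])
    fix x :: real assume x: "0 \<le> x" "x \<le> d"
    have "((\<lambda>x. ln (1 + x) - x + x\<^sup>2 / 2) has_real_derivative (1 / (1 + x) - 1 + x)) (at x)"
      using x by (auto intro!: derivative_eq_intros)
    moreover have "1 / (1 + x) - 1 + x = x\<^sup>2 / (1 + x)"
      using x by (simp add: field_simps power2_eq_square)
    ultimately show "\<exists>y. ((\<lambda>x. ln (1 + x) - x + x\<^sup>2 / 2) has_real_derivative y) (at x) \<and> 0 \<le> y"
      using x by auto
  qed
  then have "quad_inf d \<le> ln (1 + d)" using True assms by (simp add: quad_inf_def)
  then have "exp (quad_inf d) \<le> exp (ln (1 + d))" by simp
  then show ?thesis using assms by simp
next
  case False
  have "exp (1 / 2 :: real) \<le> 2" using exp_bound_half[of "1/2 :: real"] by simp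
  then show ?thesis using False by (simp add: quad_inf_def)
qed

text \<open>Dual one-cell inequality, for the lower bound. Here the right-hand side is affine in
  \<open>quad_inf d\<close>, which is then bounded below by an expected convolution, a quantity that
  can be averaged.\<close>

lemma exp_minus_le_quad_inf:
  assumes "d \<ge> 0" shows "exp (- d) \<le> 1 - quad_inf d"
proof (cases "d \<le> 1")
  case True
  have "1 - 0 + 0\<^sup>2 / 2 - exp (- 0) \<le> 1 - d + d\<^sup>2 / 2 - exp (- d)"
  proof (rule DERIV_nonneg_imp_nondecreasing[OF assms])
    fix x :: real assume x: "0 \<le> x" "x \<le> d"
    have "((\<lambda>x. 1 - x + x\<^sup>2 / 2 - exp (- x)) has_real_derivative (- 1 + x + exp (- x))) (at x)"
      by (auto intro!: derivative_eq_intros)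
    moreover have "- 1 + x + exp (- x) \<ge> 0" using exp_ge_add_one_self[of "- x"] by simp
    ultimately show "\<exists>y. ((\<lambda>x. 1 - x + x\<^sup>2 / 2 - exp (- x)) has_real_derivative y) (at x) \<and> 0 \<le> y"
      by blast
  qed
  then show ?thesis using True assms by (simp add: quad_inf_def)
next
  case False
  have "2 * exp (- d) \<le> exp 1 * exp (- d)" using exp_ge_add_one_self[of 1] by (intro mult_right_mono) auto
  also have "\<dots> \<le> 1" using False by (simp flip: exp_add)
  finally show ?thesis using False by (simp add: quad_inf_def)
qed

text \<open>Lower bounds for the infimum convolution of \<open>g\<close> at \<open>S\<close>, where a competitor may delete the
  points of \<open>S\<close> in an arbitrary random collection of cells.\<close>

definition certified :: "'a set set \<Rightarrow> ('a set \<Rightarrow> real) \<Rightarrow> 'a set \<Rightarrow> real \<Rightarrow> bool" where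
  "certified \<A> g S c \<longleftrightarrow> (\<exists>C a. (\<forall>J\<subseteq>\<A>. C - (\<Sum>A\<in>J. a A) \<le> g (S - \<Union>J)) \<and>
     c \<le> C - (\<Sum>A\<in>\<A>. (a A)\<^sup>2) / 2)"

lemma certified_empty: "certified {} g S c \<longleftrightarrow> c \<le> g S"
  by (auto simp: certified_def intro: order_trans exI[of _ "g S"])

text \<open>Separates the decision about \<open>A\<close> from those about the other cells. The
  number \<open>t\<close> is the coefficient of \<open>A\<close>. A competitor who deletes
  \<open>A\<close> with probability \<open>\<theta>\<close> loses \<open>\<theta> * t\<close>, while
  the certificate for all cells pays \<open>t\<^sup>2 / 2\<close>; the two are compared through
  \<open>\<theta> * t \<le> t\<^sup>2 / 2 + \<theta>\<^sup>2 / 2\<close>.\<close>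

lemma certified_insertE:
  assumes "certified (insert A \<A>) g S c" "finite \<A>" "A \<notin> \<A>"
  obtains b t where "certified \<A> g S b" "certified \<A> g (S - A) (b - t)" "c \<le> b - t\<^sup>2 / 2"
    "\<forall>\<theta>\<in>{0..1}. certified \<A> (\<lambda>S. (1 - \<theta>) * g S + \<theta> * g (S - A)) S (b - \<theta> * t)"
proof -
  obtain C a where *: "\<And>J. J \<subseteq> insert A \<A> \<Longrightarrow> C - (\<Sum>A\<in>J. a A) \<le> g (S - \<Union>J)"
    and c: "c \<le> C - (\<Sum>A\<in>insert A \<A>. (a A)\<^sup>2) / 2"
    using assms(1) unfolding certified_def by blast
  have del: "C - (\<Sum>A\<in>J. a A) \<le> g (S - \<Union>J)" if "J \<subseteq> \<A>" for J
    using that by (intro *) auto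
  have del_A: "C - a A - (\<Sum>A\<in>J. a A) \<le> g (S - A - \<Union>J)" if "J \<subseteq> \<A>" for J
  proof -
    have "A \<notin> J" "finite J" using that assms finite_subset by auto
    moreover have "S - \<Union>(insert A J) = S - A - \<Union>J" by auto
    moreover have "insert A J \<subseteq> insert A \<A>" using that by auto
    ultimately show ?thesis using *[of "insert A J"] by (simp add: algebra_simps)
  qed
  show ?thesis
  proof (rule that[of "C - (\<Sum>A\<in>\<A>. (a A)\<^sup>2) / 2" "a A"])
    show "certified \<A> g S (C - (\<Sum>A\<in>\<A>. (a A)\<^sup>2) / 2)"
      unfolding certified_def using del by blast
    show "certified \<A> g (S - A) (C - (\<Sum>A\<in>\<A>. (a A)\<^sup>2) / 2 - a A)"
      unfolding certified_def using del_A by (intro exI[of _ "C - a A"] exI[of _ a]) auto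
    show "c \<le> C - (\<Sum>A\<in>\<A>. (a A)\<^sup>2) / 2 - (a A)\<^sup>2 / 2"
      using c assms(2,3) by (simp add: add_divide_distrib)
    show "\<forall>\<theta>\<in>{0..1}. certified \<A> (\<lambda>S. (1 - \<theta>) * g S + \<theta> * g (S - A)) S (C - (\<Sum>A\<in>\<A>. (a A)\<^sup>2) / 2 - \<theta> * a A)"
      unfolding certified_def
    proof (intro ballI exI[of _ "C - _ * a A"] exI[of _ a] conjI allI impI)
      fix \<theta> :: real and J assume "\<theta> \<in> {0..1}"
      then have \<theta>: "0 \<le> \<theta>" "\<theta> \<le> 1" by auto
      assume J: "J \<subseteq> \<A>"
      have "C - \<theta> * a A - sum a J = (1 - \<theta>) * (C - sum a J) + \<theta> * (C - a A - sum a J)"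
        by (simp add: algebra_simps)
      also have "\<dots> \<le> (1 - \<theta>) * g (S - \<Union>J) + \<theta> * g (S - A - \<Union>J)"
        using del[OF J] del_A[OF J] \<theta> by (intro add_mono mult_left_mono) auto
      also have "S - A - \<Union>J = S - \<Union>J - A" by auto
      finally show "C - \<theta> * a A - sum a J \<le> (1 - \<theta>) * g (S - \<Union>J) + \<theta> * g (S - \<Union>J - A)" .
    qed simp
  qed
qed

lemma certified_mono: "certified \<A> g S c \<Longrightarrow> c' \<le> c \<Longrightarrow> certified \<A> g S c'"
  unfolding certified_def by (meson order_trans)

lemma two_mult_le_squares: "\<theta> * t \<le> t\<^sup>2 / 2 + \<theta>\<^sup>2 / (2::real)"
proof -
  have "0 \<le> (\<theta> - t)\<^sup>2" by simp
  then show ?thesis by (simp add: power2_eq_square algebra_simps)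
qed

lemma tame_exp_bounded:
  assumes "h \<in> borel_measurable fin_config" "\<And>S. finite S \<Longrightarrow> h S \<le> L"
  shows "tame (\<lambda>S. exp (h S))"
  using assms by (intro tame_bounded[where C="exp L"]) auto

context poisson_points
begin

text \<open>Permits logarithms of conditional expectations of \<open>exp (- g S)\<close>.\<close>

lemma resample_pos:
  assumes "tame f" "bborel A" "finite S" "\<And>S. finite S \<Longrightarrow> 0 < f S"
  shows "0 < resample A f S"
proof -
  have int: "integrable P (\<lambda>\<omega>. f (patch A (\<eta> \<omega>) S))" by (intro integrable_patch assms)
  have pos: "0 < f (patch A (\<eta> \<omega>) S)" if "\<omega> \<in> space P" for \<omega>
    using assms that by (auto intro!: finite_patch_points)
  have "0 \<le> resample A f S"
    unfolding resample_def using pos by (intro Bochner_Integration.integral_nonneg_AE) (auto intro: less_imp_le)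
  moreover have "resample A f S \<noteq> 0"
  proof
    assume "resample A f S = 0"
    then have "AE \<omega> in P. f (patch A (\<eta> \<omega>) S) = 0"
      unfolding resample_def using pos
      by (subst (asm) integral_nonneg_eq_0_iff_AE[OF int]) (auto intro: less_imp_le)
    moreover have "AE \<omega> in P. 0 < f (patch A (\<eta> \<omega>) S)" using pos by (rule AE_I2)
    ultimately have "AE \<omega> in P. False" by eventually_elim simp
    then show False by simp
  qed
  ultimately show ?thesis by simp
qed

lemma exp_certified_le:
  assumes "finite \<A>" "\<And>A. A \<in> \<A> \<Longrightarrow> bborel A" "disjoint \<A>"
    and "tame g" "incr g" "h \<in> borel_measurable fin_config" "\<And>S. finite S \<Longrightarrow> h S \<le> L"
    and "\<And>S. finite S \<Longrightarrow> certified \<A> g S (h S)" "finite S"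
  shows "resample (\<Union>\<A>) (\<lambda>S. exp (h S)) S \<le> exp (resample (\<Union>\<A>) g S)"
  using assms
proof (induction \<A> arbitrary: g h L S rule: finite_induct)
  case empty
  then show ?case by (simp add: certified_empty)
next
  case (insert A \<A>)
  let ?W = "\<Union>\<A>"
  have A: "bborel A" and W: "bborel ?W"
    using insert.hyps insert.prems(1) by (auto intro: bborel_Union)
  have AW: "A \<inter> ?W = {}" using insert.prems(2) insert.hyps(2) by (auto simp: disjoint_def)
  note tame_g = insert.prems(3) and S = \<open>finite S\<close>
  have tame_h: "tame (\<lambda>S. exp (h S))" by (rule tame_exp_bounded[OF insert.prems(5,6)])
  define v where "v = resample ?W g"
  have tame_v: "tame v" unfolding v_def by (intro tame_resample tame_g W)
  \<comment> \<open>Emptying \<open>A\<close> leaves the same configuration for every sample in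
    \<open>A\<close>, so \<open>v0\<close> is a constant of the step.\<close>
  define v0 where "v0 = v (S - A)"
  have step: "resample ?W (\<lambda>S. exp (h S)) T \<le> exp v0 * (1 + (v T - v0))"
    if T: "T = patch A (\<eta> \<omega>) S" "\<omega> \<in> space P" for T \<omega>
  proof -
    have finT: "finite T" using T A S finite_patch_points by auto
    have TA: "T - A = S - A" using T by (simp add: patch_Diff)
    obtain \<theta> where \<theta>: "0 \<le> \<theta>" "\<theta> \<le> 1" "quad_inf (v T - v0) = (1 - \<theta>) * (v T - v0) + \<theta>\<^sup>2 / 2"
      by (rule quad_inf_attained)
    \<comment> \<open>The \<open>\<theta>\<^sup>2 / 2\<close> taken off \<open>h\<close> is what the
      certificate of the mixture costs; it reappears in \<open>quad_inf (v T - v0)\<close>.\<close>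
    let ?g = "\<lambda>S. (1 - \<theta>) * g S + \<theta> * g (S - A)" and ?h = "\<lambda>S. h S - \<theta>\<^sup>2 / 2"
    have tg: "tame ?g" using tame_g A by (intro tame_add tame_cmult tame_Diff) auto
    have "resample ?W (\<lambda>S. exp (?h S)) T \<le> exp (resample ?W ?g T)"
    proof (rule insert.IH[OF _ _ tg])
      show "incr ?g" unfolding incr_def
      proof (intro allI impI)
        fix S T :: "'a set" assume "finite T" "S \<subseteq> T"
        moreover from this have "S - A \<subseteq> T - A" "finite (T - A)" by auto
        ultimately show "?g S \<le> ?g T" using insert.prems(4) \<theta> unfolding incr_def
          by (intro add_mono mult_left_mono) auto
      qed
      show "?h \<in> borel_measurable fin_config" using insert.prems(5) by measurable
      show "?h S \<le> L" if "finite S" for S using insert.prems(6)[OF that] by (auto intro: order_trans[rotated])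
      show "certified \<A> ?g S (?h S)" if finS: "finite S" for S
      proof -
        obtain b t where bt: "certified \<A> g S b" "certified \<A> g (S - A) (b - t)" "h S \<le> b - t\<^sup>2 / 2"
          "\<forall>\<theta>\<in>{0..1}. certified \<A> (\<lambda>S. (1 - \<theta>) * g S + \<theta> * g (S - A)) S (b - \<theta> * t)"
          by (rule certified_insertE[OF insert.prems(7)[OF finS] insert.hyps(1,2)])
        show ?thesis
          by (rule certified_mono[OF bspec[OF bt(4), of \<theta>]]) (use bt(3) \<theta>(1,2) two_mult_le_squares[of \<theta> t] in auto)
      qed
      show "\<And>A. A \<in> \<A> \<Longrightarrow> bborel A" using insert.prems(1) by auto
      show "disjoint \<A>" using insert.prems(2) by (auto simp: disjoint_def)
    qed fact
    also have "resample ?W ?g T = (1 - \<theta>) * v T + \<theta> * v0"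
    proof -
      have "resample ?W ?g T = resample ?W (\<lambda>S. (1 - \<theta>) * g S) T + resample ?W (\<lambda>S. \<theta> * g (S - A)) T"
        using tame_g A W finT by (intro resample_add tame_cmult tame_Diff) auto
      also have "resample ?W (\<lambda>S. \<theta> * g (S - A)) T = \<theta> * v (T - A)"
        unfolding resample_cmult v_def using AW by (simp add: resample_Diff_disjoint Int_commute)
      finally show ?thesis by (simp add: resample_cmult v_def v0_def TA)
    qed
    also have "resample ?W (\<lambda>S. exp (?h S)) T = exp (- (\<theta>\<^sup>2 / 2)) * resample ?W (\<lambda>S. exp (h S)) T"
      unfolding resample_cmult[symmetric] by (simp flip: exp_add)
    finally have "exp (- (\<theta>\<^sup>2 / 2)) * resample ?W (\<lambda>S. exp (h S)) T \<le> exp ((1 - \<theta>) * v T + \<theta> * v0)" .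
    then have "exp (\<theta>\<^sup>2 / 2) * (exp (- (\<theta>\<^sup>2 / 2)) * resample ?W (\<lambda>S. exp (h S)) T) \<le>
        exp (\<theta>\<^sup>2 / 2) * exp ((1 - \<theta>) * v T + \<theta> * v0)" by (intro mult_left_mono) auto
    then have "resample ?W (\<lambda>S. exp (h S)) T \<le> exp (\<theta>\<^sup>2 / 2) * exp ((1 - \<theta>) * v T + \<theta> * v0)"
      by (simp add: mult.assoc[symmetric] exp_minus_inverse flip: exp_add)
    also have "\<dots> = exp v0 * exp (quad_inf (v T - v0))"
      unfolding \<theta>(3) by (simp add: algebra_simps flip: exp_add)
    also have "\<dots> \<le> exp v0 * (1 + (v T - v0))"
    proof (intro mult_left_mono exp_quad_inf_le)
      have "v (T - A) \<le> v T" unfolding v_def resample_def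
      proof (rule integral_mono)
        show "integrable P (\<lambda>\<omega>. g (patch ?W (\<eta> \<omega>) (T - A)))" "integrable P (\<lambda>\<omega>. g (patch ?W (\<eta> \<omega>) T))"
          using finT by (auto intro!: integrable_patch tame_g W)
        fix \<omega>' assume "\<omega>' \<in> space P"
        then show "g (patch ?W (\<eta> \<omega>') (T - A)) \<le> g (patch ?W (\<eta> \<omega>') T)"
          using insert.prems(4) finite_patch_points[OF W \<open>\<omega>' \<in> space P\<close> finT] patch_mono[of "T - A" T ?W "\<eta> \<omega>'"]
          unfolding incr_def by simp
      qed
      then show "0 \<le> v T - v0" by (simp add: v0_def TA)
    qed auto
    finally show ?thesis .
  qed
  have "resample (\<Union>(insert A \<A>)) (\<lambda>S. exp (h S)) S = resample A (resample ?W (\<lambda>S. exp (h S))) S"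
    using resample_Un[OF tame_h A W AW S] by simp
  also have "\<dots> \<le> resample A (\<lambda>T. exp v0 * (1 + (v T - v0))) S"
    by (rule resample_mono_patch)
      (use step S in \<open>auto intro!: tame_resample tame_h W A tame_cmult tame_add tame_diff tame_v\<close>)
  also have "\<dots> = exp v0 * (1 + (resample A v S - v0))"
  proof -
    have "resample A (\<lambda>T. 1 + (v T - v0)) S = resample A (\<lambda>T. v T + (1 - v0)) S" by (simp add: algebra_simps)
    also have "\<dots> = resample A v S + (1 - v0)" using resample_add[OF tame_v tame_const A S] by simp
    finally have eq: "resample A (\<lambda>T. 1 + (v T - v0)) S = resample A v S + (1 - v0)" .
    show ?thesis unfolding resample_cmult eq by simp
  qed
  also have "\<dots> \<le> exp v0 * exp (resample A v S - v0)"
    by (intro mult_left_mono exp_ge_add_one_self) auto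
  also have "\<dots> = exp (resample (\<Union>(insert A \<A>)) g S)"
    using resample_Un[OF tame_g A W AW S] by (simp add: v_def flip: exp_add)
  finally show ?case .
qed

text \<open>Here the certified values enter through an expectation in the exponent, and the
  induction would have to choose them measurably. \<open>R\<close> is a tame functional above all of
  them, built cell by cell: for the new cell it takes the minimum over \<open>\<theta>\<close> of
  \<open>(1 - \<theta>) * R S + \<theta> * R (S - A) + \<theta>\<^sup>2 / 2\<close>.\<close>

lemma exp_minus_inf_convolution:
  assumes "finite \<A>" "\<And>A. A \<in> \<A> \<Longrightarrow> bborel A" "disjoint \<A>"
    and g: "tame g" "incr g" "\<And>S. finite S \<Longrightarrow> 0 \<le> g S"
  shows "\<exists>R. tame R \<and>
    (\<forall>S. finite S \<longrightarrow> resample (\<Union>\<A>) (\<lambda>S. exp (- g S)) S \<le> exp (- resample (\<Union>\<A>) R S)) \<and>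
    (\<forall>S c. finite S \<longrightarrow> certified \<A> g S c \<longrightarrow> c \<le> R S)"
  using assms(1,2,3)
proof (induction \<A> rule: finite_induct)
  case empty
  show ?case using g by (intro exI[of _ g]) (simp add: certified_empty)
next
  case (insert A \<A>)
  let ?W = "\<Union>\<A>"
  have A: "bborel A" and W: "bborel ?W"
    using insert.hyps insert.prems(1) by (auto intro: bborel_Union)
  have AW: "A \<inter> ?W = {}" using insert.prems(2) insert.hyps(2) by (auto simp: disjoint_def)
  have "disjoint \<A>" using insert.prems(2) by (auto simp: disjoint_def)
  with insert.IH insert.prems(1) obtain R where tame_R: "tame R"
    and R1: "\<And>S. finite S \<Longrightarrow> resample ?W (\<lambda>S. exp (- g S)) S \<le> exp (- resample ?W R S)"
    and R2: "\<And>S c. finite S \<Longrightarrow> certified \<A> g S c \<Longrightarrow> c \<le> R S" by blast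
  define R' where "R' = (\<lambda>S. R (S - A) + quad_inf (R S - R (S - A)))"
  have tame_RA: "tame (\<lambda>S. R (S - A))" using tame_R A by (intro tame_Diff) auto
  have tame_R': "tame R'" unfolding R'_def
  proof (intro tame_add tame_RA)
    have t: "tame (\<lambda>S. R S - R (S - A))" by (intro tame_diff tame_R tame_RA)
    then show "tame (\<lambda>S. quad_inf (R S - R (S - A)))"
      by (rule tame_mono) (use tame_measurable[OF t] in \<open>auto intro: abs_quad_inf_le measurable_compose[OF _ quad_inf_measurable]\<close>)
  qed
  have tame_e: "tame (\<lambda>S. exp (- g S))"
    using g by (intro tame_exp_bounded[where L=0]) (auto dest: tame_measurable)
  define E where "E = resample ?W (\<lambda>S. exp (- g S))"
  define v where "v = resample ?W R"
  have E_pos: "0 < E S" if "finite S" for S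
    unfolding E_def by (rule resample_pos[OF tame_e W that]) auto
  have tame_E: "tame E" unfolding E_def by (intro tame_resample tame_e W)
  have main: "resample (\<Union>(insert A \<A>)) (\<lambda>S. exp (- g S)) S \<le> exp (- resample (\<Union>(insert A \<A>)) R' S)"
    if S: "finite S" for S
  proof -
    define E0 where "E0 = E (S - A)"
    define u0 where "u0 = - ln E0"
    have E0: "0 < E0" "E0 = exp (- u0)" using E_pos[of "S - A"] S by (auto simp: E0_def u0_def)
    have step: "E T \<le> E0 * (1 + u0 - resample ?W R' T)" if T: "T = patch A (\<eta> \<omega>) S" "\<omega> \<in> space P" for T \<omega>
    proof -
      have finT: "finite T" using T A S finite_patch_points by auto
      have TA: "T - A = S - A" using T by (simp add: patch_Diff)
      \<comment> \<open>In logarithmic scale the induction hypothesis reads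
        \<open>v T \<le> u\<close> and \<open>v (S - A) \<le> u0\<close>, while monotonicity of
        \<open>g\<close> gives \<open>u0 \<le> u\<close>.\<close>
      define u where "u = - ln (E T)"
      have u: "E T = exp (- u)" using E_pos[OF finT] by (simp add: u_def)
      have "E T \<le> E0" unfolding E0_def TA[symmetric] E_def resample_def
      proof (rule integral_mono)
        show "integrable P (\<lambda>\<omega>. exp (- g (patch ?W (\<eta> \<omega>) (T - A))))" "integrable P (\<lambda>\<omega>. exp (- g (patch ?W (\<eta> \<omega>) T)))"
          using finT by (auto intro!: integrable_patch[OF tame_e] W)
        fix \<omega>' assume "\<omega>' \<in> space P"
        then show "exp (- g (patch ?W (\<eta> \<omega>') T)) \<le> exp (- g (patch ?W (\<eta> \<omega>') (T - A)))"
          using g(2) finite_patch_points[OF W \<open>\<omega>' \<in> space P\<close> finT] patch_mono[of "T - A" T ?W "\<eta> \<omega>'"]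
          unfolding incr_def by simp
      qed
      then have "u0 \<le> u" using u E0 by simp
      have vT: "v T \<le> u" using R1[OF finT] u by (simp add: E_def v_def)
      have v0: "v (S - A) \<le> u0" using R1[of "S - A"] S E0 by (simp add: E_def v_def E0_def)
      \<comment> \<open>This weight is optimal for the numbers \<open>u\<close> and
        \<open>u0\<close>, not for \<open>R S\<close> and \<open>R (S - A)\<close>. As a fixed
        number it passes through the expectation, and \<open>quad_inf_le\<close> admits any
        weight.\<close>
      obtain \<theta> where \<theta>: "0 \<le> \<theta>" "\<theta> \<le> 1" "quad_inf (u - u0) = (1 - \<theta>) * (u - u0) + \<theta>\<^sup>2 / 2"
        by (rule quad_inf_attained)
      have "resample ?W R' T \<le> resample ?W (\<lambda>S. ((1 - \<theta>) * R S + \<theta> * R (S - A)) + \<theta>\<^sup>2 / 2) T"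
      proof (rule resample_mono)
        show "tame (\<lambda>S. ((1 - \<theta>) * R S + \<theta> * R (S - A)) + \<theta>\<^sup>2 / 2)"
          by (intro tame_add tame_cmult tame_R tame_RA tame_const)
        show "R' S \<le> ((1 - \<theta>) * R S + \<theta> * R (S - A)) + \<theta>\<^sup>2 / 2" for S
          using quad_inf_le[OF \<theta>(1,2), of "R S - R (S - A)"] by (simp add: R'_def algebra_simps)
      qed (intro tame_R' W finT)+
      also have "\<dots> = (1 - \<theta>) * v T + \<theta> * v (T - A) + \<theta>\<^sup>2 / 2"
        using AW by (subst resample_add resample_cmult | intro tame_add tame_cmult tame_R tame_RA tame_const W finT)+
          (simp add: resample_cmult v_def resample_Diff_disjoint Int_commute)
      also have "\<dots> \<le> (1 - \<theta>) * u + \<theta> * u0 + \<theta>\<^sup>2 / 2"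
        using vT v0 \<theta> unfolding TA by (intro add_mono mult_left_mono) auto
      also have "\<dots> = u0 + quad_inf (u - u0)" unfolding \<theta>(3) by (simp add: algebra_simps)
      finally have le: "resample ?W R' T \<le> u0 + quad_inf (u - u0)" .
      have "E T = E0 * exp (- (u - u0))" unfolding u E0(2) by (simp flip: exp_add)
      also have "\<dots> \<le> E0 * (1 - quad_inf (u - u0))"
        using E0 \<open>u0 \<le> u\<close> by (intro mult_left_mono exp_minus_le_quad_inf) auto
      also have "\<dots> \<le> E0 * (1 + u0 - resample ?W R' T)"
        using E0 le by (intro mult_left_mono) auto
      finally show ?thesis .
    qed
    have tame_WR': "tame (resample ?W R')" by (intro tame_resample tame_R' W)
    have "resample (\<Union>(insert A \<A>)) (\<lambda>S. exp (- g S)) S = resample A E S"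
      using resample_Un[OF tame_e A W AW S] by (simp add: E_def)
    also have "\<dots> \<le> resample A (\<lambda>T. E0 * (1 + u0 - resample ?W R' T)) S"
      by (rule resample_mono_patch) (use step S in \<open>auto intro!: tame_E A tame_cmult tame_diff tame_WR'\<close>)
    also have "\<dots> = E0 * (1 + u0 - resample A (resample ?W R') S)"
      unfolding resample_cmult using resample_diff[OF tame_const tame_WR' A S] by simp
    also have "\<dots> \<le> E0 * exp (u0 - resample A (resample ?W R') S)"
      using E0(1) exp_ge_add_one_self[of "u0 - resample A (resample ?W R') S"]
      by (intro mult_left_mono) linarith+
    also have "\<dots> = exp (- resample (\<Union>(insert A \<A>)) R' S)"
      using resample_Un[OF tame_R' A W AW S] unfolding E0(2) by (simp flip: exp_add)
    finally show ?thesis .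
  qed
  have cert: "c \<le> R' S" if S: "finite S" and c: "certified (insert A \<A>) g S c" for S c
  proof -
    obtain b t where bt: "certified \<A> g S b" "certified \<A> g (S - A) (b - t)" "c \<le> b - t\<^sup>2 / 2"
      by (rule certified_insertE[OF c insert.hyps(1,2)])
    obtain \<theta> where \<theta>: "0 \<le> \<theta>" "\<theta> \<le> 1"
      "quad_inf (R S - R (S - A)) = (1 - \<theta>) * (R S - R (S - A)) + \<theta>\<^sup>2 / 2"
      by (rule quad_inf_attained)
    have "c \<le> (1 - \<theta>) * b + \<theta> * (b - t) + \<theta>\<^sup>2 / 2"
      using bt(3) two_mult_le_squares[of \<theta> t] by (simp add: algebra_simps)
    also have "\<dots> \<le> (1 - \<theta>) * R S + \<theta> * R (S - A) + \<theta>\<^sup>2 / 2"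
      using \<theta> R2[OF S bt(1)] R2[OF _ bt(2)] S by (intro add_mono mult_left_mono) auto
    also have "\<dots> = R' S" unfolding R'_def \<theta>(3) by (simp add: algebra_simps)
    finally show ?thesis .
  qed
  show ?case using tame_R' main cert by blast
qed

lemma exp_minus_certified_le:
  assumes "finite \<A>" "\<And>A. A \<in> \<A> \<Longrightarrow> bborel A" "disjoint \<A>"
    and "tame g" "incr g" "\<And>S. finite S \<Longrightarrow> 0 \<le> g S" "tame h"
    and "\<And>S. finite S \<Longrightarrow> certified \<A> g S (h S)" "finite S"
  shows "resample (\<Union>\<A>) (\<lambda>S. exp (- g S)) S \<le> exp (- resample (\<Union>\<A>) h S)"
proof -
  obtain R where R: "tame R"
    "\<And>S. finite S \<Longrightarrow> resample (\<Union>\<A>) (\<lambda>S. exp (- g S)) S \<le> exp (- resample (\<Union>\<A>) R S)"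
    "\<And>S c. finite S \<Longrightarrow> certified \<A> g S c \<Longrightarrow> c \<le> R S"
    using exp_minus_inf_convolution[OF assms(1-6)] by blast
  have "resample (\<Union>\<A>) h S \<le> resample (\<Union>\<A>) R S"
    using assms R by (intro resample_mono bborel_Union) auto
  with R(2)[OF assms(9)] show ?thesis by (meson exp_le_cancel_iff neg_le_iff_le order_trans)
qed

end

section \<open>Degree and variance\<close>

text \<open>Vanishing of all \<open>k\<close>-fold replacement differences, an analogue for
  configurations of being a polynomial of degree less than \<open>k\<close>. Whole regions are
  replaced rather than single points added, which makes the notion stable under freezing and
  averaging the points of a cell.\<close>

primrec degree_less :: "nat \<Rightarrow> ('a set \<Rightarrow> real) \<Rightarrow> bool" where
  "degree_less 0 g \<longleftrightarrow> (\<forall>S. finite S \<longrightarrow> g S = 0)"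
| "degree_less (Suc k) g \<longleftrightarrow>
     (\<forall>A y z. finite y \<longrightarrow> finite z \<longrightarrow> degree_less k (\<lambda>S. g (patch A y S) - g (patch A z S)))"

lemma degree_less_cong:
  "(\<And>S. finite S \<Longrightarrow> g S = h S) \<Longrightarrow> degree_less k g \<longleftrightarrow> degree_less k h"
proof (induction k arbitrary: g h)
  case (Suc k)
  have "degree_less k (\<lambda>S. g (patch A y S) - g (patch A z S)) \<longleftrightarrow>
      degree_less k (\<lambda>S. h (patch A y S) - h (patch A z S))" if "finite y" "finite z" for A y z
    by (rule Suc.IH) (use Suc.prems that in \<open>auto intro!: finite_patch\<close>)
  then show ?case by auto
qed simp

lemma patch_patch: "patch A y (patch B u S) = patch (B - A) u (patch A y S)"
  by (auto simp: patch_def)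

lemma degree_less_patch: "degree_less k g \<Longrightarrow> finite y \<Longrightarrow> degree_less k (\<lambda>S. g (patch A y S))"
proof (induction k arbitrary: g)
  case 0
  then show ?case by (auto intro!: finite_patch)
next
  case (Suc k)
  show ?case unfolding degree_less.simps
  proof (intro allI impI)
    fix B u v assume "finite (u :: 'a set)" "finite (v :: 'a set)"
    then have "degree_less k (\<lambda>S. g (patch (B - A) u S) - g (patch (B - A) v S))" using Suc.prems by auto
    from Suc.IH[OF this Suc.prems(2)]
    show "degree_less k (\<lambda>S. g (patch A y (patch B u S)) - g (patch A y (patch B v S)))"
      by (subst (1 2) patch_patch)
  qed
qed

text \<open>Replacing the points in \<open>A\<close> affects only subsets
  \<open>T \<union> U\<close> with \<open>U\<close> nonempty inside the replaced part. Collected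
  according to \<open>T\<close>, these terms form a sum over subsets again, and \<open>T\<close> has
  at least one point fewer than \<open>T \<union> U\<close>.\<close>

lemma degree_less_sum_subsets:
  assumes "\<And>T. finite T \<Longrightarrow> k \<le> card T \<Longrightarrow> \<phi> T = 0"
  shows "degree_less k (\<lambda>S. \<Sum>T\<in>Pow S. \<phi> T)"
  using assms
proof (induction k arbitrary: \<phi>)
  case 0
  then show ?case by (auto intro!: sum.neutral intro: finite_subset)
next
  case (Suc k)
  show ?case unfolding degree_less.simps
  proof (intro allI impI)
    fix A and y z :: "'a set" assume yz: "finite y" "finite z"
    define \<psi> where "\<psi> = (\<lambda>y T. \<Sum>U\<in>Pow (y \<inter> A) - {{}}. \<phi> (T \<union> U))"
    \<comment> \<open>Sets that meet \<open>A\<close> get weight 0, which turns a sum over subsets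
      of \<open>S - A\<close> into one over subsets of \<open>S\<close>.\<close>
    define \<xi> where "\<xi> = (\<lambda>T. if T \<inter> A = {} then \<psi> y T - \<psi> z T else 0)"
    have "degree_less k (\<lambda>S. \<Sum>T\<in>Pow S. \<xi> T)"
    proof (rule Suc.IH)
      fix T :: "'a set" assume T: "finite T" "k \<le> card T"
      have "\<psi> w T = 0" if "T \<inter> A = {}" "finite w" for w
        unfolding \<psi>_def
      proof (intro sum.neutral ballI Suc.prems)
        fix U assume U: "U \<in> Pow (w \<inter> A) - {{}}"
        then have "finite U" "U \<noteq> {}" "T \<inter> U = {}" using that by (auto intro: finite_subset)
        then show "finite (T \<union> U)" "Suc k \<le> card (T \<union> U)"
          using T card_gt_0_iff[of U] by (auto simp: card_Un_disjoint)
      qed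
      then show "\<xi> T = 0" using yz by (simp add: \<xi>_def)
    qed
    also have "degree_less k (\<lambda>S. \<Sum>T\<in>Pow S. \<xi> T) \<longleftrightarrow>
       degree_less k (\<lambda>S. (\<Sum>T\<in>Pow (patch A y S). \<phi> T) - (\<Sum>T\<in>Pow (patch A z S). \<phi> T))"
    proof (rule degree_less_cong)
      fix S :: "'a set" assume S: "finite S"
      have eq: "(\<Sum>T\<in>Pow (patch A w S). \<phi> T) = (\<Sum>T\<in>Pow (S - A). \<phi> T) + (\<Sum>T\<in>Pow (S - A). \<psi> w T)"
        if w: "finite w" for w
      proof -
        have "(\<Sum>T\<in>Pow (patch A w S). \<phi> T) = (\<Sum>(T, U)\<in>Pow (S - A) \<times> Pow (w \<inter> A). \<phi> (T \<union> U))"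
          by (rule sum.reindex_bij_witness[of _ "\<lambda>(T, U). T \<union> U" "\<lambda>X. (X - A, X \<inter> A)"])
            (auto simp: patch_def Un_commute intro!: arg_cong[where f=\<phi>])
        also have "\<dots> = (\<Sum>T\<in>Pow (S - A). \<Sum>U\<in>Pow (w \<inter> A). \<phi> (T \<union> U))"
          by (rule sum.cartesian_product[symmetric])
        also have "\<dots> = (\<Sum>T\<in>Pow (S - A). \<phi> T + \<psi> w T)"
        proof (intro sum.cong refl)
          fix T
          have "finite (Pow (w \<inter> A))" using w by simp
          from sum.remove[OF this, of "{}" "\<lambda>U. \<phi> (T \<union> U)"]
          show "(\<Sum>U\<in>Pow (w \<inter> A). \<phi> (T \<union> U)) = \<phi> T + \<psi> w T" by (simp add: \<psi>_def)
        qed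
        finally show ?thesis by (simp add: sum.distrib)
      qed
      have "(\<Sum>T\<in>Pow S. \<xi> T) = (\<Sum>T\<in>Pow (S - A). \<xi> T)"
        using S by (intro sum.mono_neutral_right) (auto simp: \<xi>_def)
      also have "\<dots> = (\<Sum>T\<in>Pow (S - A). \<psi> y T - \<psi> z T)"
        by (intro sum.cong) (auto simp: \<xi>_def)
      finally show "(\<Sum>T\<in>Pow S. \<xi> T) = (\<Sum>T\<in>Pow (patch A y S). \<phi> T) - (\<Sum>T\<in>Pow (patch A z S). \<phi> T)"
        using eq[OF yz(1)] eq[OF yz(2)] by (simp add: sum_subtractf)
    qed
    finally show "degree_less k (\<lambda>S. (\<Sum>T\<in>Pow (patch A y S). \<phi> T) - (\<Sum>T\<in>Pow (patch A z S). \<phi> T))" .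
  qed
qed

context poisson_points
begin

lemma degree_less_integral:
  fixes G :: "'w \<Rightarrow> 'a set \<Rightarrow> real"
  assumes "\<And>\<omega>. \<omega> \<in> space P \<Longrightarrow> degree_less k (G \<omega>)"
    and "\<And>S. finite S \<Longrightarrow> integrable P (\<lambda>\<omega>. G \<omega> S)"
  shows "degree_less k (\<lambda>S. \<integral>\<omega>. G \<omega> S \<partial>P)"
  using assms
proof (induction k arbitrary: G)
  case 0
  then show ?case by (auto intro!: integral_eq_zero_AE AE_I2)
next
  case (Suc k)
  show ?case unfolding degree_less.simps
  proof (intro allI impI)
    fix A and y z :: "'a set" assume yz: "finite y" "finite z"
    have "degree_less k (\<lambda>S. \<integral>\<omega>. (G \<omega> (patch A y S) - G \<omega> (patch A z S)) \<partial>P)"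
      using Suc.prems yz by (intro Suc.IH Bochner_Integration.integrable_diff) (auto intro!: finite_patch)
    also have "?this \<longleftrightarrow> degree_less k (\<lambda>S. (\<integral>\<omega>. G \<omega> (patch A y S) \<partial>P) - (\<integral>\<omega>. G \<omega> (patch A z S) \<partial>P))"
      using Suc.prems yz by (intro degree_less_cong Bochner_Integration.integral_diff) (auto intro!: finite_patch)
    finally show "degree_less k (\<lambda>S. (\<integral>\<omega>. G \<omega> (patch A y S) \<partial>P) - (\<integral>\<omega>. G \<omega> (patch A z S) \<partial>P))" .
  qed
qed

lemma degree_less_resample:
  assumes "degree_less k g" "tame g" "bborel A" shows "degree_less k (resample A g)"
proof -
  have "degree_less k (\<lambda>S. g (patch A (\<eta> \<omega>) S))" if "\<omega> \<in> space P" for \<omega>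
    using degree_less_patch[OF assms(1) finite_points'[OF that assms(3)], of A] by (simp add: patch_Int)
  then show ?thesis
    unfolding resample_def[abs_def] using assms by (intro degree_less_integral integrable_patch) auto
qed

text \<open>Subtracting the mean over \<open>A\<close> amounts to averaging the replacement
  differences between \<open>y\<close> and a Poisson sample; each of them has lost one
  degree.\<close>

lemma degree_less_minus_resample:
  assumes "degree_less (Suc k) g" "tame g" "bborel A" "finite y"
  shows "degree_less k (\<lambda>S. g (patch A y S) - resample A g (patch A y S))"
proof -
  have "degree_less k (\<lambda>S. g (patch A y S) - g (patch A (\<eta> \<omega> \<inter> A) S))" if "\<omega> \<in> space P" for \<omega>
    using assms(1,4) finite_points'[OF that assms(3)] by auto
  then have "degree_less k (\<lambda>S. \<integral>\<omega>. (g (patch A y S) - g (patch A (\<eta> \<omega>) S)) \<partial>P)"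
    using assms by (intro degree_less_integral Bochner_Integration.integrable_diff integrable_patch)
      (auto simp: patch_Int)
  also have "?this \<longleftrightarrow> ?thesis"
  proof (rule degree_less_cong)
    fix S :: "'a set" assume "finite S"
    then have "(\<integral>\<omega>. (g (patch A y S) - g (patch A (\<eta> \<omega>) S)) \<partial>P) = (\<integral>\<omega>. g (patch A y S) \<partial>P) - resample A g S"
      unfolding resample_def using assms
      by (intro Bochner_Integration.integral_diff integrable_patch) auto
    then show "(\<integral>\<omega>. (g (patch A y S) - g (patch A (\<eta> \<omega>) S)) \<partial>P) = g (patch A y S) - resample A g (patch A y S)"
      by (simp add: prob_space resample_patch_same)
  qed
  finally show ?thesis .
qed

section \<open>Conditional variances and a reverse Efron-Stein inequality\<close>

definition var_on :: "'a set \<Rightarrow> ('a set \<Rightarrow> real) \<Rightarrow> 'a set \<Rightarrow> real" where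
  "var_on A g S = resample A (\<lambda>S. (g S)\<^sup>2) S - (resample A g S)\<^sup>2"

lemma tame_var_on [intro!]: "tame g \<Longrightarrow> bborel A \<Longrightarrow> tame (var_on A g)"
  unfolding var_on_def[abs_def] by auto

lemma var_on_patch: "A \<inter> B = {} \<Longrightarrow> var_on A (\<lambda>S. g (patch B y S)) S = var_on A g (patch B y S)"
  unfolding var_on_def
  by (simp add: resample_patch[of A B g] resample_patch[of A B "\<lambda>S. (g S)\<^sup>2"])

lemma resample_patch_indep: "A \<inter> B = {} \<Longrightarrow> (\<And>T. h (patch A y T) = h T) \<Longrightarrow> resample B h (patch A y S) = resample B h S"
  by (subst resample_patch[symmetric]) auto

lemma var_on_same:
  assumes "tame g" "bborel A" "finite S"
  shows "var_on A g S = resample A (\<lambda>S. (g S - resample A g S)\<^sup>2) S"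
proof -
  let ?m = "resample A g"
  have "resample A (\<lambda>S. (g S - ?m S)\<^sup>2) S = resample A (\<lambda>S. (g S)\<^sup>2 - ?m S * (2 * g S - ?m S)) S"
    by (simp add: power2_eq_square algebra_simps)
  also have "\<dots> = resample A (\<lambda>S. (g S)\<^sup>2) S - resample A (\<lambda>S. ?m S * (2 * g S - ?m S)) S"
    using assms by (intro resample_diff) auto
  also have "resample A (\<lambda>S. ?m S * (2 * g S - ?m S)) S = ?m S * resample A (\<lambda>S. 2 * g S - ?m S) S"
    by (rule resample_pull_out) (rule resample_patch_same)
  also have "resample A (\<lambda>S. 2 * g S - ?m S) S = resample A (\<lambda>S. 2 * g S) S - resample A (\<lambda>S. ?m S * 1) S"
    using assms by (simp add: resample_diff tame_cmult tame_resample)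
  also have "resample A (\<lambda>S. ?m S * 1) S = ?m S * resample A (\<lambda>_. 1) S"
    by (rule resample_pull_out) (rule resample_patch_same)
  finally show ?thesis by (simp add: var_on_def resample_cmult power2_eq_square)
qed

lemma resample_centred:
  assumes "tame g" "bborel A" "finite S"
  shows "resample A (\<lambda>S. g S - resample A g S) S = 0"
proof -
  have "resample A (\<lambda>S. resample A g S * 1) S = resample A g S * resample A (\<lambda>_. 1) S"
    by (rule resample_pull_out) (rule resample_patch_same)
  then show ?thesis using assms by (subst resample_diff) auto
qed

lemma resample_square_split:
  assumes "tame g" "bborel A" "finite S"
  shows "resample A (\<lambda>S. (g S)\<^sup>2) S = (resample A g S)\<^sup>2 + resample A (\<lambda>S. (g S - resample A g S)\<^sup>2) S"
  using var_on_same[OF assms] by (simp add: var_on_def)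

text \<open>The two parts of \<open>g = m + d\<close> contribute separately: \<open>m\<close> does
  not depend on the points in \<open>A\<close>, and \<open>d\<close> is centred over
  \<open>A\<close>, so the mixed terms average to zero.\<close>

lemma resample_var_on:
  assumes g: "tame g" and A: "bborel A" and B: "bborel B" and AB: "A \<inter> B = {}" and S: "finite S"
  defines "m \<equiv> resample A g" and "d \<equiv> \<lambda>S. g S - resample A g S"
  shows "resample A (var_on B g) S = var_on B m S + resample A (var_on B d) S"
proof -
  have m: "tame m" and d: "tame d" unfolding m_def d_def using g A by auto
  have BA: "B \<inter> A = {}" using AB by auto
  have dS: "resample A d T = 0" if "finite T" for T
    unfolding d_def by (rule resample_centred[OF g A that])
  have mA: "m (patch A y T) = m T" for y T unfolding m_def by (rule resample_patch_same)
  have sq: "resample A (resample B (\<lambda>S. (g S)\<^sup>2)) S = resample B (\<lambda>S. (m S)\<^sup>2) S + resample A (resample B (\<lambda>S. (d S)\<^sup>2)) S"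
  proof -
    have "resample A (resample B (\<lambda>S. (g S)\<^sup>2)) S = resample B (resample A (\<lambda>S. (g S)\<^sup>2)) S"
      using g A B AB S by (intro resample_commute) auto
    also have "\<dots> = resample B (\<lambda>S. (m S)\<^sup>2 + resample A (\<lambda>S. (d S)\<^sup>2) S) S"
      unfolding m_def d_def using B S resample_square_split[OF g A] by (intro resample_cong) auto
    also have "\<dots> = resample B (\<lambda>S. (m S)\<^sup>2) S + resample B (resample A (\<lambda>S. (d S)\<^sup>2)) S"
      using m d A B S by (intro resample_add) auto
    also have "resample B (resample A (\<lambda>S. (d S)\<^sup>2)) S = resample A (resample B (\<lambda>S. (d S)\<^sup>2)) S"
      using d A B BA S by (intro resample_commute) auto
    finally show ?thesis .
  qed
  have gB: "resample B g T = resample B m T + resample B d T" if "finite T" for T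
  proof -
    have "resample B (\<lambda>S. m S + d S) T = resample B m T + resample B d T"
      using m d B that by (intro resample_add) auto
    then show ?thesis by (simp add: m_def d_def)
  qed
  have dB: "resample A (resample B d) S = 0"
  proof -
    have "resample A (resample B d) S = resample B (resample A d) S"
      using d A B AB S by (intro resample_commute) auto
    also have "\<dots> = resample B (\<lambda>_. 0) S" using B S dS by (intro resample_cong) auto
    finally show ?thesis by simp
  qed
  have mB: "resample B m (patch A y T) = resample B m T" for y T
    by (rule resample_patch_indep[OF AB]) (rule mA)
  have "resample A (\<lambda>S. (resample B g S)\<^sup>2) S =
      resample A (\<lambda>S. (resample B d S)\<^sup>2 + resample B m S * (2 * resample B d S + resample B m S)) S"
    using A S by (intro resample_cong) (auto simp: gB power2_eq_square algebra_simps)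
  also have "\<dots> = resample A (\<lambda>S. (resample B d S)\<^sup>2) S
      + resample A (\<lambda>S. resample B m S * (2 * resample B d S + resample B m S)) S"
    using m d A B S by (intro resample_add) auto
  also have "resample A (\<lambda>S. resample B m S * (2 * resample B d S + resample B m S)) S
      = resample B m S * resample A (\<lambda>S. 2 * resample B d S + resample B m S) S"
    by (rule resample_pull_out) (rule mB)
  also have "resample A (\<lambda>S. 2 * resample B d S + resample B m S) S =
     resample A (\<lambda>S. 2 * resample B d S) S + resample A (\<lambda>S. resample B m S * 1) S"
    using m d A B S by (simp add: resample_add tame_cmult tame_resample)
  also have "resample A (\<lambda>S. resample B m S * 1) S = resample B m S * resample A (\<lambda>_. 1) S"
    by (rule resample_pull_out) (rule mB)
  finally have lin: "resample A (\<lambda>S. (resample B g S)\<^sup>2) S =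
      resample A (\<lambda>S. (resample B d S)\<^sup>2) S + (resample B m S)\<^sup>2"
    by (simp add: resample_cmult dB power2_eq_square)
  have split: "resample A (var_on B f) S = resample A (resample B (\<lambda>S. (f S)\<^sup>2)) S - resample A (\<lambda>S. (resample B f S)\<^sup>2) S"
    if "tame f" for f
    unfolding var_on_def[abs_def] using that A B S by (intro resample_diff) auto
  show ?thesis using split[OF g] split[OF d] sq lin by (simp add: var_on_def)
qed

text \<open>Law of total variance, with the mean over \<open>A\<close> as conditional mean. In the
  residual term the two averages are exchanged to match the induction on cells.\<close>

lemma var_on_Un:
  assumes g: "tame g" and A: "bborel A" and W: "bborel W" and AW: "A \<inter> W = {}" and S: "finite S"
  shows "var_on (A \<union> W) g S = var_on W (resample A g) S + resample A (resample W (\<lambda>S. (g S - resample A g S)\<^sup>2)) S"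
proof -
  have WA: "W \<inter> A = {}" using AW by auto
  have 1: "resample (A \<union> W) g S = resample W (resample A g) S"
    using resample_Un[OF g W A WA S] by (simp add: Un_commute)
  have "resample (A \<union> W) (\<lambda>S. (g S)\<^sup>2) S = resample W (resample A (\<lambda>S. (g S)\<^sup>2)) S"
    using resample_Un[OF tame_power2[OF g] W A WA S] by (simp add: Un_commute)
  also have "\<dots> = resample W (\<lambda>S. (resample A g S)\<^sup>2 + resample A (\<lambda>S. (g S - resample A g S)\<^sup>2) S) S"
    using W S resample_square_split[OF g A] by (intro resample_cong) auto
  also have "\<dots> = resample W (\<lambda>S. (resample A g S)\<^sup>2) S + resample W (resample A (\<lambda>S. (g S - resample A g S)\<^sup>2)) S"
    using g A W S by (intro resample_add) auto
  also have "resample W (resample A (\<lambda>S. (g S - resample A g S)\<^sup>2)) S = resample A (resample W (\<lambda>S. (g S - resample A g S)\<^sup>2)) S"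
    using g A W WA S by (intro resample_commute) auto
  finally show ?thesis by (simp add: var_on_def 1)
qed

text \<open>Induction on the cells: the part of \<open>g\<close> that is centred over the points in \<open>A\<close> has smaller
  degree as a function of the remaining points.\<close>

lemma reverse_efron_stein:
  assumes "finite \<A>" "\<And>A. A \<in> \<A> \<Longrightarrow> bborel A" "disjoint \<A>"
    and "degree_less k g" "tame g" "finite S"
  shows "(\<Sum>A\<in>\<A>. resample (\<Union>\<A>) (var_on A g) S) \<le> (real k - 1) * var_on (\<Union>\<A>) g S"
  using assms
proof (induction \<A> arbitrary: k g S rule: finite_induct)
  case empty
  then show ?case by (simp add: var_on_def)
next
  case (insert A \<A>)
  let ?W = "\<Union>\<A>"
  have A: "bborel A" and W: "bborel ?W" and \<A>: "\<And>B. B \<in> \<A> \<Longrightarrow> bborel B"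
    using insert.hyps insert.prems(1) by (auto intro: bborel_Union)
  have AW: "A \<inter> ?W = {}" and disj: "disjoint \<A>" and AB: "\<And>B. B \<in> \<A> \<Longrightarrow> A \<inter> B = {}"
    using insert.prems(2) insert.hyps(2) by (auto simp: disjoint_def)
  have WA: "?W \<inter> A = {}" using AW by auto
  note g = insert.prems(4) and S = insert.prems(5)
  show ?case
  proof (cases k)
    case 0
    then have g0: "g T = 0" if "finite T" for T using insert.prems(3) that by simp
    have r0: "resample B g T = 0" "resample B (\<lambda>S. (g S)\<^sup>2) T = 0" if "bborel B" "finite T" for B T
      using resample_cong[OF that, of g "\<lambda>_. 0"] resample_cong[OF that, of "\<lambda>S. (g S)\<^sup>2" "\<lambda>_. 0"] g0 by auto
    have v0: "var_on B g T = 0" if "bborel B" "finite T" for B T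
      using r0[OF that] by (simp add: var_on_def)
    have "resample (\<Union>(insert A \<A>)) (var_on B g) S = 0" if "B \<in> insert A \<A>" for B
      using resample_cong[of "\<Union>(insert A \<A>)" S "var_on B g" "\<lambda>_. 0"] v0 A W S that insert.prems(1) by auto
    then show ?thesis using v0[OF bborel_Un[OF A W] S] by simp
  next
    \<comment> \<open>In a Hoeffding decomposition over the cells, a component depending on
      \<open>j\<close> cells is counted \<open>j\<close> times on the left and once in the variance,
      and components with \<open>j \<ge> k\<close> vanish; this is the origin of the factor
      \<open>real k - 1\<close>.\<close>
    case (Suc n)
    define m where "m = resample A g"
    define d where "d = (\<lambda>S. g S - resample A g S)"
    have m: "tame m" and d: "tame d" unfolding m_def d_def using g A by auto
    have deg_m: "degree_less (Suc n) m"
      unfolding m_def using insert.prems(3) Suc g A by (intro degree_less_resample) auto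
    define X where "X = resample A (resample ?W (\<lambda>S. (d S)\<^sup>2)) S"
    define Y where "Y = resample A (var_on ?W d) S"
    have un: "resample (\<Union>(insert A \<A>)) f S = resample ?W (resample A f) S" if "tame f" for f
      using resample_Un[OF that W A WA S] by (simp add: Un_commute)
    have un': "resample (\<Union>(insert A \<A>)) f S = resample A (resample ?W f) S" if "tame f" for f
      using resample_Un[OF that A W AW S] by simp
    have "resample (\<Union>(insert A \<A>)) (var_on A g) S = resample ?W (resample A (var_on A g)) S"
      using g A by (intro un) auto
    also have "\<dots> = resample ?W (resample A (\<lambda>S. (d S)\<^sup>2)) S"
    proof (rule resample_cong[OF W S])
      fix T :: "'a set" assume T: "finite T"
      have "resample A (\<lambda>S. var_on A g S * 1) T = var_on A g T * resample A (\<lambda>_. 1) T"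
        by (rule resample_pull_out) (simp add: var_on_def resample_patch_same)
      then show "resample A (var_on A g) T = resample A (\<lambda>S. (d S)\<^sup>2) T"
        using var_on_same[OF g A T] by (simp add: d_def)
    qed
    also have "\<dots> = X" unfolding X_def using d A W WA S by (intro resample_commute) auto
    finally have first: "resample (\<Union>(insert A \<A>)) (var_on A g) S = X" .
    have rest: "resample (\<Union>(insert A \<A>)) (var_on B g) S =
      resample ?W (var_on B m) S + resample A (resample ?W (var_on B d)) S" if B: "B \<in> \<A>" for B
    proof -
      have "resample (\<Union>(insert A \<A>)) (var_on B g) S = resample ?W (resample A (var_on B g)) S"
        using g \<A>[OF B] by (intro un) auto
      also have "\<dots> = resample ?W (\<lambda>T. var_on B m T + resample A (var_on B d) T) S"
        unfolding m_def d_def using resample_var_on[OF g A \<A>[OF B] AB[OF B]]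
        by (intro resample_cong[OF W S]) auto
      also have "\<dots> = resample ?W (var_on B m) S + resample ?W (resample A (var_on B d)) S"
        using m d A \<A>[OF B] W S by (intro resample_add) auto
      also have "resample ?W (resample A (var_on B d)) S = resample A (resample ?W (var_on B d)) S"
        using d A \<A>[OF B] W WA S by (intro resample_commute) auto
      finally show ?thesis .
    qed
    have IH_m: "(\<Sum>B\<in>\<A>. resample ?W (var_on B m) S) \<le> real n * var_on ?W m S"
      using insert.IH[OF \<A> disj deg_m m S] by simp
    have IH_d: "(\<Sum>B\<in>\<A>. resample ?W (var_on B d) T) \<le> (real n - 1) * var_on ?W d T"
      and zero: "n = 0 \<Longrightarrow> resample ?W (\<lambda>S. (d S)\<^sup>2) T = 0 \<and> var_on ?W d T = 0"
      if T: "T = patch A (\<eta> \<omega>) S" "\<omega> \<in> space P" for T \<omega>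
    proof -
      \<comment> \<open>The points in \<open>A\<close> are frozen at a sample, and what remains has
        degree below \<open>n\<close>; the induction hypothesis is used for each sample
        separately.\<close>
      define dy where "dy = (\<lambda>S. d (patch A (\<eta> \<omega>) S))"
      have dy: "tame dy" unfolding dy_def by (rule tame_patch[OF d A T(2)])
      have deg: "degree_less n dy"
        using degree_less_minus_resample[OF insert.prems(3)[unfolded Suc] g A finite_points'[OF T(2) A]]
        by (simp add: dy_def d_def patch_Int)
      have BA: "B \<inter> A = {}" if "B \<in> \<A>" for B using AB[OF that] by auto
      have vB: "resample ?W (var_on B dy) S = resample ?W (var_on B d) T" if "B \<in> \<A>" for B
        unfolding dy_def T var_on_patch[OF BA[OF that]] by (rule resample_patch[OF WA])
      have vW: "var_on ?W dy S = var_on ?W d T"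
        unfolding dy_def T var_on_patch[OF WA] ..
      show "(\<Sum>B\<in>\<A>. resample ?W (var_on B d) T) \<le> (real n - 1) * var_on ?W d T"
        using insert.IH[OF \<A> disj deg dy S] vB vW by simp
      assume "n = 0"
      then have dy0: "dy T = 0" if "finite T" for T using deg that by simp
      have "resample ?W dy S = 0" "resample ?W (\<lambda>S. (dy S)\<^sup>2) S = 0"
        using resample_cong[OF W S, of dy "\<lambda>_. 0"] resample_cong[OF W S, of "\<lambda>S. (dy S)\<^sup>2" "\<lambda>_. 0"] dy0 by auto
      moreover from this have "var_on ?W dy S = 0" by (simp add: var_on_def)
      ultimately show "resample ?W (\<lambda>S. (d S)\<^sup>2) T = 0 \<and> var_on ?W d T = 0"
        using vW resample_patch[OF WA, of "\<lambda>S. (d S)\<^sup>2"] by (simp add: dy_def T)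
    qed
    have "(\<Sum>B\<in>\<A>. resample A (resample ?W (var_on B d)) S) = resample A (\<lambda>T. \<Sum>B\<in>\<A>. resample ?W (var_on B d) T) S"
      using d W \<A> A S by (intro resample_sum[symmetric]) auto
    also have "\<dots> \<le> resample A (\<lambda>T. (real n - 1) * var_on ?W d T) S"
      by (rule resample_mono_patch) (use d W \<A> A S IH_d in auto)
    finally have sum_d: "(\<Sum>B\<in>\<A>. resample A (resample ?W (var_on B d)) S) \<le> (real n - 1) * Y"
      by (simp add: resample_cmult Y_def)
    have total: "(\<Sum>B\<in>insert A \<A>. resample (\<Union>(insert A \<A>)) (var_on B g) S)
      \<le> X + (real n * var_on ?W m S + (real n - 1) * Y)"
      using insert.hyps first rest IH_m sum_d by (simp add: sum.distrib)
    have YX: "Y \<le> X" unfolding X_def Y_def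
    proof (rule resample_mono)
      show "var_on ?W d T \<le> resample ?W (\<lambda>S. (d S)\<^sup>2) T" for T by (simp add: var_on_def)
    qed (use d A W S in auto)
    \<comment> \<open>For \<open>n = 0\<close> the factor \<open>real n - 1\<close> is negative and
      \<open>Y \<le> X\<close> points the wrong way; but then \<open>d\<close> vanishes on all
      frozen samples, so \<open>X\<close> and \<open>Y\<close> are both 0.\<close>
    have XY: "X + (real n - 1) * Y \<le> real n * X"
    proof (cases n)
      case 0
      have "Y = 0"
        unfolding Y_def resample_def[of A] using zero[OF refl _ 0] by (intro integral_eq_zero_AE AE_I2) auto
      moreover have "X = 0"
        unfolding X_def resample_def[of A] using zero[OF refl _ 0] by (intro integral_eq_zero_AE AE_I2) auto
      ultimately show ?thesis by (simp add: 0)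
    next
      case (Suc l)
      then have "(real n - 1) * Y \<le> (real n - 1) * X" using YX by (intro mult_left_mono) auto
      then show ?thesis by (simp add: algebra_simps)
    qed
    have "var_on (\<Union>(insert A \<A>)) g S = var_on ?W m S + X"
      using var_on_Un[OF g A W AW S] by (simp add: m_def d_def X_def)
    then show ?thesis using total XY by (simp add: Suc algebra_simps)
  qed
qed

text \<open>The difference \<open>g S - g (S - A)\<close> vanishes when \<open>A\<close> holds no
  point, an event of probability at least \<open>1 - p\<close>. By Cauchy-Schwarz the square of its
  conditional mean is at most \<open>p\<close> times its second moment, so the variance over
  \<open>A\<close> retains the share \<open>1 - p\<close> of that moment. The sum over the cells is
  then controlled by \<open>reverse_efron_stein\<close>.\<close>

lemma sum_sq_diff_le_var:
  assumes \<A>: "finite \<A>" "\<And>A. A \<in> \<A> \<Longrightarrow> bborel A" "disjoint \<A>"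
    and g: "degree_less (Suc k) g" "tame g" and S: "finite S"
    and p: "0 < p" "p < 1" "\<And>A. A \<in> \<A> \<Longrightarrow> prob {\<omega>\<in>space P. card (\<eta> \<omega> \<inter> A) \<noteq> 0} \<le> p"
  shows "(1 - p) * resample (\<Union>\<A>) (\<lambda>S. \<Sum>A\<in>\<A>. (g S - g (S - A))\<^sup>2) S \<le> real k * var_on (\<Union>\<A>) g S"
proof -
  have W: "bborel (\<Union>\<A>)" using \<A> by (intro bborel_Union)
  have tA: "tame (\<lambda>S. g (S - A))" if "A \<in> \<A>" for A using \<A>(2)[OF that] g by (intro tame_Diff) auto
  have var: "(1 - p) * resample A (\<lambda>S. (g S - g (S - A))\<^sup>2) T \<le> var_on A g T"
    if A: "A \<in> \<A>" and T: "finite T" for A T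
  proof -
    define \<Delta> where "\<Delta> = (\<lambda>S. g S - g (S - A))"
    have t\<Delta>: "tame \<Delta>" unfolding \<Delta>_def using tA[OF A] g by auto
    have bA: "bborel A" using \<A> A by auto
    define m where "m = resample A \<Delta> T"
    define N where "N = {\<omega>\<in>space P. card (\<eta> \<omega> \<inter> A) \<noteq> 0}"
    have N: "N \<in> sets P" unfolding N_def using card_points_measurable[OF bA] by measurable
    have iN: "integrable P (\<lambda>\<omega>. (m / p)\<^sup>2 * indicator N \<omega>)" for m
      using N by (intro integrable_mult_right integrable_real_indicator) (auto simp: less_top[symmetric])
    define D where "D = (\<lambda>\<omega>. \<Delta> (patch A (\<eta> \<omega>) T))"
    have iD: "integrable P D" unfolding D_def by (rule integrable_patch[OF t\<Delta> bA T])
    have iD2: "integrable P (\<lambda>\<omega>. (D \<omega>)\<^sup>2)" unfolding D_def using t\<Delta> bA T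
      by (intro integrable_patch[where g="\<lambda>S. (\<Delta> S)\<^sup>2"]) auto
    have D0: "D \<omega> = D \<omega> * indicator N \<omega>" if "\<omega> \<in> space P" for \<omega>
    proof (cases "\<omega> \<in> N")
      case False
      then have "\<eta> \<omega> \<inter> A = {}" using that finite_points'[OF that bA] by (auto simp: N_def)
      then show ?thesis by (simp add: D_def \<Delta>_def patch_def)
    qed simp
    have Dm: "(\<integral>\<omega>. D \<omega> \<partial>P) = m" by (simp add: D_def m_def resample_def)
    \<comment> \<open>Cauchy-Schwarz from a square, in which \<open>m / p\<close> is the best
      multiple of the indicator when \<open>N\<close> has probability \<open>p\<close>.\<close>
    have "0 \<le> (\<integral>\<omega>. (D \<omega> - m / p * indicator N \<omega>)\<^sup>2 \<partial>P)" by simp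
    also have "\<dots> = (\<integral>\<omega>. (D \<omega>)\<^sup>2 - 2 * (m / p) * D \<omega> + (m / p)\<^sup>2 * indicator N \<omega> \<partial>P)"
    proof (intro Bochner_Integration.integral_cong refl)
      fix \<omega> assume "\<omega> \<in> space P"
      then show "(D \<omega> - m / p * indicator N \<omega>)\<^sup>2 = (D \<omega>)\<^sup>2 - 2 * (m / p) * D \<omega> + (m / p)\<^sup>2 * indicator N \<omega>"
        using D0[of \<omega>] by (cases "\<omega> \<in> N") (auto simp: power2_eq_square algebra_simps)
    qed
    also have "\<dots> = (\<integral>\<omega>. (D \<omega>)\<^sup>2 \<partial>P) - 2 * (m / p) * m + (m / p)\<^sup>2 * prob N"
    proof -
      have "(\<integral>\<omega>. (D \<omega>)\<^sup>2 - 2 * (m / p) * D \<omega> + (m / p)\<^sup>2 * indicator N \<omega> \<partial>P) =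
         (\<integral>\<omega>. (D \<omega>)\<^sup>2 - 2 * (m / p) * D \<omega> \<partial>P) + (\<integral>\<omega>. (m / p)\<^sup>2 * indicator N \<omega> \<partial>P)"
        using iD iD2 iN by (intro Bochner_Integration.integral_add) auto
      also have "(\<integral>\<omega>. (D \<omega>)\<^sup>2 - 2 * (m / p) * D \<omega> \<partial>P) = (\<integral>\<omega>. (D \<omega>)\<^sup>2 \<partial>P) - (\<integral>\<omega>. 2 * (m / p) * D \<omega> \<partial>P)"
        using iD iD2 by (intro Bochner_Integration.integral_diff integrable_mult_right) auto
      finally show ?thesis using N by (simp add: Dm)
    qed
    also have "\<dots> \<le> (\<integral>\<omega>. (D \<omega>)\<^sup>2 \<partial>P) - 2 * (m / p) * m + (m / p)\<^sup>2 * p"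
      using p(3)[OF A] by (simp add: N_def mult_left_mono)
    also have "\<dots> = (\<integral>\<omega>. (D \<omega>)\<^sup>2 \<partial>P) - m\<^sup>2 / p" using p by (simp add: power2_eq_square field_simps)
    finally have "m\<^sup>2 \<le> p * resample A (\<lambda>S. (\<Delta> S)\<^sup>2) T"
      using p by (simp add: D_def resample_def field_simps)
    moreover have "var_on A g T = resample A (\<lambda>S. (\<Delta> S)\<^sup>2) T - m\<^sup>2"
    proof -
      define c where "c = g (T - A)"
      have c: "g (patch A y T - A) = c" for y by (simp add: c_def patch_Diff)
      have 1: "resample A g T = c + m"
      proof -
        have "resample A g T = resample A (\<lambda>S. c + \<Delta> S) T" unfolding resample_def \<Delta>_def c by simp
        also have "\<dots> = c + m" using resample_add[OF tame_const t\<Delta> bA T] by (simp add: m_def)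
        finally show ?thesis .
      qed
      have "resample A (\<lambda>S. (g S)\<^sup>2) T = resample A (\<lambda>S. (c\<^sup>2 + 2 * c * \<Delta> S) + (\<Delta> S)\<^sup>2) T"
        unfolding resample_def \<Delta>_def c by (simp add: power2_eq_square algebra_simps)
      also have "\<dots> = resample A (\<lambda>S. c\<^sup>2 + 2 * c * \<Delta> S) T + resample A (\<lambda>S. (\<Delta> S)\<^sup>2) T"
        using t\<Delta> bA T by (intro resample_add) auto
      also have "resample A (\<lambda>S. c\<^sup>2 + 2 * c * \<Delta> S) T = c\<^sup>2 + 2 * c * m"
        using resample_add[OF tame_const tame_cmult[OF t\<Delta>] bA T, of "c\<^sup>2" "2 * c"] by (simp add: resample_cmult m_def)
      finally show ?thesis by (simp add: var_on_def 1 power2_eq_square algebra_simps)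
    qed
    ultimately show ?thesis by (simp add: \<Delta>_def algebra_simps)
  qed
  have "(1 - p) * resample (\<Union>\<A>) (\<lambda>S. \<Sum>A\<in>\<A>. (g S - g (S - A))\<^sup>2) S
      = (\<Sum>A\<in>\<A>. (1 - p) * resample (\<Union>\<A>) (\<lambda>S. (g S - g (S - A))\<^sup>2) S)"
    using g tA W S by (subst resample_sum) (auto simp: sum_distrib_left)
  also have "\<dots> \<le> (\<Sum>A\<in>\<A>. resample (\<Union>\<A>) (var_on A g) S)"
  proof (rule sum_mono)
    fix A assume A: "A \<in> \<A>"
    define W' where "W' = \<Union>(\<A> - {A})"
    have bA: "bborel A" and W': "bborel W'" using \<A> A unfolding W'_def by (auto intro!: bborel_Union)
    have W'A: "W' \<inter> A = {}" using \<A>(3) A by (auto simp: W'_def disjoint_def)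
    have UA: "\<Union>\<A> = W' \<union> A" using A by (auto simp: W'_def)
    let ?f = "\<lambda>S. (g S - g (S - A))\<^sup>2"
    have tf: "tame ?f" using g tA[OF A] by auto
    have "(1 - p) * resample (\<Union>\<A>) ?f S = resample W' (\<lambda>T. (1 - p) * resample A ?f T) S"
      unfolding UA using resample_Un[OF tf W' bA W'A S] by (simp add: resample_cmult)
    also have "\<dots> \<le> resample W' (var_on A g) S"
      using var[OF A] tf g bA W' S by (intro resample_mono) auto
    also have "\<dots> = resample W' (resample A (var_on A g)) S"
    proof (rule resample_cong[OF W' S])
      fix T :: "'a set" assume T: "finite T"
      have "resample A (\<lambda>S. var_on A g S * 1) T = var_on A g T * resample A (\<lambda>_. 1) T"
        by (rule resample_pull_out) (simp add: var_on_def resample_patch_same)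
      then show "var_on A g T = resample A (var_on A g) T" by simp
    qed
    also have "\<dots> = resample (\<Union>\<A>) (var_on A g) S"
      unfolding UA using resample_Un[OF tame_var_on[OF g(2) bA] W' bA W'A S] by simp
    finally show "(1 - p) * resample (\<Union>\<A>) ?f S \<le> resample (\<Union>\<A>) (var_on A g) S" .
  qed
  also have "\<dots> \<le> real k * var_on (\<Union>\<A>) g S"
    using reverse_efron_stein[OF \<A> g S] by simp
  finally show ?thesis .
qed

end

section \<open>U-statistics of finite configurations\<close>

definition ustat :: "nat \<Rightarrow> ((nat \<Rightarrow> 'a) \<Rightarrow> real) \<Rightarrow> 'a set \<Rightarrow> real" where
  "ustat k f S = (\<Sum>x\<in>distinct_tuples k S. f x)"

lemma finite_distinct_tuples [simp]: "finite S \<Longrightarrow> finite (distinct_tuples k S)"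
  unfolding distinct_tuples_def by (rule finite_subset[of _ "{..<k} \<rightarrow>\<^sub>E S"]) (auto intro: finite_PiE)

lemma distinct_tuples_mono: "S \<subseteq> T \<Longrightarrow> distinct_tuples k S \<subseteq> distinct_tuples k T"
  unfolding distinct_tuples_def by (auto simp: PiE_iff)

lemma distinct_tuples_extensional: "x \<in> distinct_tuples k S \<Longrightarrow> x \<in> {..<k} \<rightarrow>\<^sub>E UNIV"
  unfolding distinct_tuples_def by (auto simp: PiE_iff)

lemma card_distinct_tuples_le: "finite S \<Longrightarrow> card (distinct_tuples k S) \<le> card S ^ k"
  using card_mono[of "{..<k} \<rightarrow>\<^sub>E S" "distinct_tuples k S"]
  by (simp add: card_funcsetE finite_PiE distinct_tuples_def subset_iff)

lemma card_distinct_tuples: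
  assumes "finite S" shows "real (card (distinct_tuples k S)) = fact k * real (card S choose k)"
proof -
  have "card (distinct_tuples k S) = (\<Prod>i<k. card S - i)"
  proof (cases "k \<le> card S")
    case True
    then show ?thesis
      unfolding distinct_tuples_def using card_inj_on_subset_funcset[of "{..<k}" S "{..<k}"] assms
      by (simp add: lessThan_atLeast0)
  next
    case False
    have "distinct_tuples k S = {}"
      using False assms card_inj_on_le[of _ "{..<k}" S] by (fastforce simp: distinct_tuples_def PiE_iff)
    moreover have "(\<Prod>i<k. card S - i) = 0" using False by (intro prod_zero) auto
    ultimately show ?thesis by simp
  qed
  moreover have "real (\<Prod>i<k. card S - i) = fact k * real (card S choose k)"
  proof (cases "k \<le> card S")
    case True
    then have "real (\<Prod>i<k. card S - i) = (\<Prod>i = 0..<k. real (card S) - of_nat i)"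
      by (simp add: lessThan_atLeast0 of_nat_diff)
    also have "\<dots> = fact k * (real (card S) gchoose k)" by (rule gbinomial_mult_fact[symmetric])
    finally show ?thesis by (simp add: binomial_gbinomial)
  next
    case False
    then have "(\<Prod>i<k. card S - i) = 0" by (intro prod_zero) auto
    then show ?thesis using False by (simp only: of_nat_0) simp
  qed
  ultimately show ?thesis by simp
qed

text \<open>Any finite family of tuples has its entries in one window \<open>B n\<close>, so the
  windows exhaust the finite partial sums. Both the measurability of the U-statistic and its
  approximation from bounded windows come from this formula.\<close>

lemma u_statistic_eq_SUP:
  assumes S: "\<And>n::nat. finite (S \<inter> B n)" and B: "incseq B" "(\<Union>n. B n) = UNIV"
    and f: "\<And>x. x \<in> {..<k} \<rightarrow>\<^sub>E UNIV \<Longrightarrow> 0 \<le> f x"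
  shows "u_statistic k f S = (SUP n. ennreal (ustat k f (S \<inter> B n)))"
proof -
  have eq: "ennreal (ustat k f (S \<inter> B n)) = (\<Sum>x\<in>distinct_tuples k (S \<inter> B n). ennreal (f x))" for n
    unfolding ustat_def using f by (intro sum_ennreal[symmetric]) (auto dest: distinct_tuples_extensional)
  have "u_statistic k f S = (SUP X\<in>{X. finite X \<and> X \<subseteq> distinct_tuples k S}. \<Sum>x\<in>X. ennreal (f x))"
    unfolding u_statistic_def by (rule nonneg_infsum_complete) simp
  also have "\<dots> = (SUP n. ennreal (ustat k f (S \<inter> B n)))"
  proof (rule antisym)
    show "(SUP n. ennreal (ustat k f (S \<inter> B n))) \<le> (SUP X\<in>{X. finite X \<and> X \<subseteq> distinct_tuples k S}. \<Sum>x\<in>X. ennreal (f x))"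
      unfolding eq using S distinct_tuples_mono[of "S \<inter> B _" S k]
      by (intro SUP_least SUP_upper) auto
    show "(SUP X\<in>{X. finite X \<and> X \<subseteq> distinct_tuples k S}. \<Sum>x\<in>X. ennreal (f x)) \<le> (SUP n. ennreal (ustat k f (S \<inter> B n)))"
    proof (rule SUP_least, clarify)
      fix X assume X: "finite X" "X \<subseteq> distinct_tuples k S"
      define R where "R = (\<Union>x\<in>X. x ` {..<k})"
      have "finite R" using X by (auto simp: R_def)
      then have "\<exists>n. R \<subseteq> B n"
      proof induction
        case (insert x R)
        then obtain n where n: "R \<subseteq> B n" by blast
        obtain l where l: "x \<in> B l" using B(2) by blast
        have "B n \<subseteq> B (max n l)" "B l \<subseteq> B (max n l)" using B(1) by (auto simp: incseq_def)
        then show ?case using n l by blast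
      qed auto
      then obtain n where n: "R \<subseteq> B n" by blast
      have "X \<subseteq> distinct_tuples k (S \<inter> B n)"
        using X n by (fastforce simp: distinct_tuples_def PiE_iff R_def)
      then have "(\<Sum>x\<in>X. ennreal (f x)) \<le> ennreal (ustat k f (S \<inter> B n))"
        unfolding eq using S[of n] by (intro sum_mono2) auto
      also have "\<dots> \<le> (SUP n. ennreal (ustat k f (S \<inter> B n)))" by (rule SUP_upper) simp
      finally show "(\<Sum>x\<in>X. ennreal (f x)) \<le> (SUP n. ennreal (ustat k f (S \<inter> B n)))" .
    qed
  qed
  finally show ?thesis .
qed

text \<open>Tuples with repeated entries are included on purpose: the tuples in a product set are
  then counted by a product of point counts, which starts a monotone class argument. Distinctness of
  the entries is put into \<open>h\<close> in \<open>F_measurable\<close>.\<close>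

lemma measurable_sum_tuples:
  fixes h :: "(nat \<Rightarrow> 'a::topological_space) \<Rightarrow> ennreal"
  assumes "h \<in> borel_measurable (PiM {..<k} (\<lambda>_. borel))"
  shows "(\<lambda>S. \<Sum>x\<in>{..<k} \<rightarrow>\<^sub>E S. h x) \<in> borel_measurable fin_config"
  using assms
proof (induction rule: borel_measurable_induct)
  case (cong f g)
  have "(\<lambda>S. \<Sum>x\<in>{..<k} \<rightarrow>\<^sub>E S. f x) = (\<lambda>S. \<Sum>x\<in>{..<k} \<rightarrow>\<^sub>E S. g x)"
    by (intro ext sum.cong refl cong(3)) (auto simp: space_PiM PiE_iff)
  then show ?case using cong(4) by simp
next
  case (set A)
  let ?C = "\<lambda>A S. card (({..<k} \<rightarrow>\<^sub>E S) \<inter> A)"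
  have sets: "sets (PiM {..<k} (\<lambda>_. borel :: 'a measure)) =
      sigma_sets ({..<k} \<rightarrow>\<^sub>E UNIV) {Pi\<^sub>E {..<k} E | E. \<forall>i\<in>{..<k}. E i \<in> sets borel}"
    unfolding sets_PiM by (subst prod_algebra_eq_finite) (auto simp: Pi_iff)
  from set have A: "A \<in> sigma_sets ({..<k} \<rightarrow>\<^sub>E UNIV) {Pi\<^sub>E {..<k} E | E. \<forall>i\<in>{..<k}. E i \<in> sets (borel :: 'a measure)}"
    unfolding sets .
  have closed: "{Pi\<^sub>E {..<k} E | E. \<forall>i\<in>{..<k}. E i \<in> sets (borel :: 'a measure)} \<subseteq> Pow ({..<k} \<rightarrow>\<^sub>E UNIV)"
    by (auto simp: PiE_iff)
  have "(\<lambda>S. real (?C A S)) \<in> borel_measurable fin_config"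
    using Int_stable_PiE[of "{..<k}" "{..<k}" "\<lambda>_. borel :: 'a measure"] closed A
  proof (induction rule: sigma_sets_induct_disjoint)
    case (basic A)
    then obtain E where E: "A = Pi\<^sub>E {..<k} E" "\<And>i. i < k \<Longrightarrow> E i \<in> sets borel" by auto
    have "({..<k} \<rightarrow>\<^sub>E S) \<inter> A = (\<Pi>\<^sub>E i\<in>{..<k}. S \<inter> E i)" for S using E by (auto simp: PiE_iff)
    then have "real (?C A S) = (\<Prod>i<k. real (card (S \<inter> E i)))" for S by (simp add: card_PiE)
    moreover have "(\<lambda>S. \<Prod>i<k. real (card (S \<inter> E i))) \<in> borel_measurable fin_config"
      using E(2) by (intro borel_measurable_prod measurable_compose[OF measurable_card_Int]) auto
    ultimately show ?case by simp
  next
    case empty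
    then show ?case by simp
  next
    case (compl A)
    have "(\<lambda>S :: 'a set. real (?C ({..<k} \<rightarrow>\<^sub>E UNIV) S) - real (?C A S)) \<in> borel_measurable fin_config"
    proof (rule borel_measurable_diff[OF _ compl(2)])
      have "({..<k} \<rightarrow>\<^sub>E S) \<inter> ({..<k} \<rightarrow>\<^sub>E UNIV) = {..<k} \<rightarrow>\<^sub>E S \<inter> UNIV" for S :: "'a set" by (auto simp: PiE_iff)
      then have "real (?C ({..<k} \<rightarrow>\<^sub>E UNIV) S) = real (card (S \<inter> UNIV)) ^ k" for S :: "'a set"
        by (simp add: card_funcsetE)
      moreover have "(\<lambda>S :: 'a set. real (card (S \<inter> UNIV)) ^ k) \<in> borel_measurable fin_config"
        by (intro borel_measurable_power measurable_compose[OF measurable_card_Int]) auto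
      ultimately show "(\<lambda>S :: 'a set. real (?C ({..<k} \<rightarrow>\<^sub>E UNIV) S)) \<in> borel_measurable fin_config" by simp
    qed
    also have "?this \<longleftrightarrow> (\<lambda>S. real (?C (({..<k} \<rightarrow>\<^sub>E UNIV) - A) S)) \<in> borel_measurable fin_config"
    proof (rule measurable_cong)
      fix S :: "'a set" assume "S \<in> space fin_config"
      then have fin: "finite ({..<k} \<rightarrow>\<^sub>E S)" by (auto intro: finite_PiE)
      have "A \<subseteq> {..<k} \<rightarrow>\<^sub>E UNIV" using compl(1) by (rule sigma_sets_into_sp[rotated]) auto
      then have "({..<k} \<rightarrow>\<^sub>E S) \<inter> ({..<k} \<rightarrow>\<^sub>E UNIV) = (({..<k} \<rightarrow>\<^sub>E S) \<inter> A) \<union> (({..<k} \<rightarrow>\<^sub>E S) \<inter> (({..<k} \<rightarrow>\<^sub>E UNIV) - A))"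
        by auto
      then have "?C ({..<k} \<rightarrow>\<^sub>E UNIV) S = ?C A S + ?C (({..<k} \<rightarrow>\<^sub>E UNIV) - A) S"
        using fin by (simp, subst card_Un_disjoint) auto
      then show "real (?C ({..<k} \<rightarrow>\<^sub>E UNIV) S) - real (?C A S) = real (?C (({..<k} \<rightarrow>\<^sub>E UNIV) - A) S)" by simp
    qed
    finally show ?case .
  next
    case (union A)
    have "(\<lambda>S. \<Sum>i. ennreal (real (?C (A i) S))) \<in> borel_measurable fin_config"
      by (intro borel_measurable_suminf_order measurable_compose[OF union(3) measurable_ennreal])
    then have "(\<lambda>S. enn2real (\<Sum>i. ennreal (real (?C (A i) S)))) \<in> borel_measurable fin_config"
      by measurable
    also have "?this \<longleftrightarrow> (\<lambda>S. real (?C (\<Union>i. A i) S)) \<in> borel_measurable fin_config"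
    proof (rule measurable_cong)
      fix S :: "'a set" assume "S \<in> space fin_config"
      then have fin: "finite ({..<k} \<rightarrow>\<^sub>E S)" by (auto intro: finite_PiE)
      have "(\<Sum>i. ennreal (real (?C (A i) S))) = (\<Sum>i. emeasure (count_space UNIV) (({..<k} \<rightarrow>\<^sub>E S) \<inter> A i))"
        using fin by (intro suminf_cong) (simp add: emeasure_count_space_finite ennreal_of_nat_eq_real_of_nat)
      also have "\<dots> = emeasure (count_space UNIV) (\<Union>i. ({..<k} \<rightarrow>\<^sub>E S) \<inter> A i)"
        using union(1) by (intro suminf_emeasure) (auto simp: disjoint_family_on_def)
      also have "(\<Union>i. ({..<k} \<rightarrow>\<^sub>E S) \<inter> A i) = ({..<k} \<rightarrow>\<^sub>E S) \<inter> (\<Union>i. A i)" by auto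
      also have "emeasure (count_space UNIV) \<dots> = ennreal (real (?C (\<Union>i. A i) S))"
        using fin by (simp add: emeasure_count_space_finite ennreal_of_nat_eq_real_of_nat)
      finally show "enn2real (\<Sum>i. ennreal (real (?C (A i) S))) = real (?C (\<Union>i. A i) S)" by simp
    qed
    finally show ?case .
  qed
  then have "(\<lambda>S. ennreal (real (?C A S))) \<in> borel_measurable fin_config" by measurable
  also have "?this \<longleftrightarrow> ?case"
  proof (rule measurable_cong)
    fix S :: "'a set" assume "S \<in> space fin_config"
    then have fin: "finite ({..<k} \<rightarrow>\<^sub>E S)" by (auto intro: finite_PiE)
    then show "ennreal (real (?C A S)) = (\<Sum>x\<in>{..<k} \<rightarrow>\<^sub>E S. indicator A x)"
      by (simp add: indicator_def of_bool_def sum.If_cases ennreal_of_nat_eq_real_of_nat)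
  qed
  finally show ?case .
next
  case (mult u c)
  then show ?case by (simp flip: sum_distrib_left)
next
  case (add u v)
  then show ?case by (simp add: sum.distrib)
next
  case (seq U)
  have "(SUP i. \<Sum>x\<in>{..<k} \<rightarrow>\<^sub>E S. U i x) = (\<Sum>x\<in>{..<k} \<rightarrow>\<^sub>E S. SUP i. U i x)" for S :: "'a set"
  proof (rule ennreal_SUP_sum)
    fix x show "incseq (\<lambda>i. U i x)" using seq.hyps(3) by (simp add: incseq_def le_fun_def)
  qed
  moreover have "(SUP i. U i) x = (SUP i. U i x)" for x by (simp add: image_comp)
  moreover have "(\<lambda>S :: 'a set. SUP i. \<Sum>x\<in>{..<k} \<rightarrow>\<^sub>E S. U i x) \<in> borel_measurable fin_config"
    using seq.IH by (intro borel_measurable_SUP) auto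
  ultimately show ?case by presburger
qed

locale bounded_kernel =
  fixes k :: nat and f :: "(nat \<Rightarrow> 'a::euclidean_space) \<Rightarrow> real" and M :: real
  assumes k_pos: "1 \<le> k"
    and f_measurable: "f \<in> borel_measurable (PiM {..<k} (\<lambda>_. borel))"
    and f_nonneg: "\<And>x. x \<in> {..<k} \<rightarrow>\<^sub>E UNIV \<Longrightarrow> 0 \<le> f x"
    and f_le: "\<And>x. x \<in> {..<k} \<rightarrow>\<^sub>E UNIV \<Longrightarrow> f x \<le> M"
    and M_pos: "0 < M"
begin

abbreviation F where "F \<equiv> ustat k f"

lemma f_tuple: "x \<in> distinct_tuples k S \<Longrightarrow> 0 \<le> f x" "x \<in> distinct_tuples k S \<Longrightarrow> f x \<le> M"
  using f_nonneg f_le distinct_tuples_extensional by blast+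

lemma F_nonneg: "0 \<le> F S"
  unfolding ustat_def by (intro sum_nonneg f_tuple)

lemma F_mono: "finite T \<Longrightarrow> S \<subseteq> T \<Longrightarrow> F S \<le> F T"
  unfolding ustat_def by (intro sum_mono2 distinct_tuples_mono finite_distinct_tuples) (auto intro: f_tuple)

lemma incr_F: "incr F"
  by (auto simp: incr_def intro: F_mono)

lemma F_le_card: "finite S \<Longrightarrow> F S \<le> M * real (card S) ^ k"
proof -
  assume S: "finite S"
  have "F S \<le> (\<Sum>x\<in>distinct_tuples k S. M)" unfolding ustat_def by (intro sum_mono f_tuple)
  also have "\<dots> = M * real (card (distinct_tuples k S))" by simp
  also have "\<dots> \<le> M * real (card S ^ k)"
    using M_pos card_distinct_tuples_le[OF S, of k] by (intro mult_left_mono) auto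
  finally show ?thesis by simp
qed

lemma F_measurable [measurable]: "F \<in> borel_measurable fin_config"
proof -
  let ?h = "\<lambda>x. ennreal (f x) * indicator {x\<in>space (PiM {..<k} (\<lambda>_. borel)). \<forall>i\<in>{..<k}. \<forall>j\<in>{..<k}. i \<noteq> j \<longrightarrow> x i \<noteq> x j} x"
  have inj: "{x\<in>space (PiM {..<k} (\<lambda>_. borel :: 'a measure)). \<forall>i\<in>{..<k}. \<forall>j\<in>{..<k}. i \<noteq> j \<longrightarrow> x i \<noteq> x j}
       \<in> sets (PiM {..<k} (\<lambda>_. borel))"
  proof (intro sets.sets_Collect_finite_All sets.sets_Collect_imp sets.sets_Collect_const)
    fix i j assume "i \<in> {..<k}" "j \<in> {..<k}"
    then have [measurable]: "(\<lambda>x. x i) \<in> borel_measurable (PiM {..<k} (\<lambda>_. borel :: 'a measure))"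
      "(\<lambda>x. x j) \<in> borel_measurable (PiM {..<k} (\<lambda>_. borel :: 'a measure))"
      by (auto intro: measurable_component_singleton)
    have "{x \<in> space (PiM {..<k} (\<lambda>_. borel :: 'a measure)). dist (x i) (x j) \<noteq> 0} \<in> sets (PiM {..<k} (\<lambda>_. borel))"
      by measurable
    then show "{x \<in> space (PiM {..<k} (\<lambda>_. borel :: 'a measure)). x i \<noteq> x j} \<in> sets (PiM {..<k} (\<lambda>_. borel))"
      by simp
  qed auto
  have "?h \<in> borel_measurable (PiM {..<k} (\<lambda>_. borel))"
    by (intro borel_measurable_times_ennreal borel_measurable_indicator
        measurable_compose[OF f_measurable measurable_ennreal] inj)
  from measurable_sum_tuples[OF this]
  have "(\<lambda>S. enn2real (\<Sum>x\<in>{..<k} \<rightarrow>\<^sub>E S. ?h x)) \<in> borel_measurable fin_config" by measurable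
  also have "?this \<longleftrightarrow> ?thesis"
  proof (rule measurable_cong)
    fix S :: "'a set" assume "S \<in> space fin_config"
    then have fin: "finite ({..<k} \<rightarrow>\<^sub>E S)" by (auto intro: finite_PiE)
    have h: "?h x = (if inj_on x {..<k} then ennreal (f x) else 0)" if "x \<in> {..<k} \<rightarrow>\<^sub>E S" for x
    proof -
      have "x \<in> space (PiM {..<k} (\<lambda>_. borel))" using that by (auto simp: space_PiM PiE_iff)
      then show ?thesis by (simp add: indicator_def inj_on_def) blast
    qed
    have "(\<Sum>x\<in>{..<k} \<rightarrow>\<^sub>E S. ?h x) = (\<Sum>x\<in>{..<k} \<rightarrow>\<^sub>E S. if inj_on x {..<k} then ennreal (f x) else 0)"
      by (intro sum.cong refl h)
    also have "\<dots> = (\<Sum>x\<in>distinct_tuples k S. ennreal (f x))"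
      unfolding distinct_tuples_def by (rule sum.inter_filter[OF fin, symmetric])
    also have "\<dots> = ennreal (F S)" unfolding ustat_def by (intro sum_ennreal f_tuple)
    finally show "enn2real (\<Sum>x\<in>{..<k} \<rightarrow>\<^sub>E S. ?h x) = F S" using F_nonneg by simp
  qed
  finally show ?thesis .
qed

lemma tame_F: "tame F"
\<comment> \<open>The constant comes from \<open>F_le_card\<close> and
  \<open>card S < 2 ^ card S\<close>.\<close>
proof (rule tameI[where C="(1 + M) * 2 ^ k"])
  show "1 \<le> (1 + M) * 2 ^ k" using M_pos mult_mono[of 1 "1 + M" 1 "2 ^ k"] by simp
  fix S :: "'a set" assume S: "finite S"
  have "real (card S) ^ k \<le> (2 ^ card S) ^ k"
    using less_exp[of "card S"] by (intro power_mono) (auto simp flip: of_nat_less_iff)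
  then have "M * real (card S) ^ k \<le> M * (2 ^ card S) ^ k"
    using M_pos by (intro mult_left_mono) auto
  then have "\<bar>F S\<bar> \<le> M * (2 ^ card S) ^ k"
    using F_le_card[OF S] F_nonneg[of S] by linarith
  also have "\<dots> = M * (2 ^ k) ^ card S" by (simp add: mult.commute flip: power_mult)
  also have "\<dots> \<le> (1 + M) * (2 ^ k) ^ (card S + 1)"
    using M_pos by (intro mult_mono power_increasing) auto
  also have "\<dots> \<le> (1 + M) ^ (card S + 1) * (2 ^ k) ^ (card S + 1)"
    using M_pos by (intro mult_right_mono self_le_power) auto
  finally show "\<bar>F S\<bar> \<le> ((1 + M) * 2 ^ k) ^ (card S + 1)"
    by (simp add: power_mult_distrib mult_ac)
qed simp

text \<open>Grouping the tuples by their set of entries writes the U-statistic as a sum over subsets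
  in which sets with more than \<open>k\<close> points have weight zero.\<close>

lemma degree_F: "degree_less (Suc k) F"
proof -
  define \<phi> where "\<phi> = (\<lambda>T. \<Sum>x\<in>{x\<in>distinct_tuples k T. x ` {..<k} = T}. f x)"
  have "degree_less (Suc k) (\<lambda>S. \<Sum>T\<in>Pow S. \<phi> T)"
  proof (rule degree_less_sum_subsets)
    fix T :: "'a set" assume "Suc k \<le> card T"
    moreover have "card (x ` {..<k}) \<le> k" for x :: "nat \<Rightarrow> 'a" using card_image_le[of "{..<k}" x] by simp
    ultimately have "x ` {..<k} \<noteq> T" for x :: "nat \<Rightarrow> 'a" by (metis not_less_eq_eq)
    then have "{x\<in>distinct_tuples k T. x ` {..<k} = T} = {}" by blast
    then show "\<phi> T = 0" unfolding \<phi>_def by (simp only: sum.empty)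
  qed
  also have "?this \<longleftrightarrow> ?thesis"
  proof (rule degree_less_cong)
    fix S :: "'a set" assume S: "finite S"
    have "(\<Sum>T\<in>Pow S. \<phi> T) = (\<Sum>T\<in>Pow S. \<Sum>x\<in>{x\<in>distinct_tuples k S. x ` {..<k} = T}. f x)"
      unfolding \<phi>_def by (intro sum.cong refl) (auto simp: distinct_tuples_def PiE_iff)
    also have "\<dots> = F S" unfolding ustat_def
      by (rule sum.group[OF finite_distinct_tuples[OF S]]) (use S in \<open>auto simp: distinct_tuples_def\<close>)
    finally show "(\<Sum>T\<in>Pow S. \<phi> T) = F S" .
  qed
  finally show ?thesis .
qed

lemma F_diff:
  assumes "finite S"
  shows "F S - F (S - A) = (\<Sum>x\<in>{x\<in>distinct_tuples k S. x ` {..<k} \<inter> A \<noteq> {}}. f x)"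
proof -
  have "distinct_tuples k S - distinct_tuples k (S - A) = {x\<in>distinct_tuples k S. x ` {..<k} \<inter> A \<noteq> {}}"
    by (auto simp: distinct_tuples_def PiE_iff)
  then show ?thesis unfolding ustat_def
    using assms sum_diff[of "distinct_tuples k S" "distinct_tuples k (S - A)" f] distinct_tuples_mono[of "S - A" S k]
    by auto
qed

lemma F_diff_nonneg: "finite S \<Longrightarrow> 0 \<le> F S - F (S - A)"
  using F_mono[of S "S - A"] by auto

text \<open>A tuple destroyed by deleting the union is destroyed by deleting some member of
  \<open>J\<close>; as the kernel is nonnegative, counting it more than once only helps.\<close>

lemma F_diff_Union_le:
  assumes S: "finite S" and J: "finite J"
  shows "F S - F (S - \<Union>J) \<le> (\<Sum>A\<in>J. F S - F (S - A))"
  using J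
proof induction
  case empty
  then show ?case by simp
next
  case (insert A J)
  have "F S - F (S - \<Union>(insert A J)) \<le> (F S - F (S - A)) + (F S - F (S - \<Union>J))"
    unfolding F_diff[OF S]
  proof -
    let ?T = "\<lambda>A. {x\<in>distinct_tuples k S. x ` {..<k} \<inter> A \<noteq> {}}"
    have "?T (\<Union>(insert A J)) = ?T A \<union> ?T (\<Union>J)" by auto
    moreover have "sum f (?T A \<union> ?T (\<Union>J)) + sum f (?T A \<inter> ?T (\<Union>J)) = sum f (?T A) + sum f (?T (\<Union>J))"
      using S by (intro sum.union_inter) auto
    moreover have "0 \<le> sum f (?T A \<inter> ?T (\<Union>J))" by (intro sum_nonneg) (auto intro: f_tuple)
    ultimately show "sum f (?T (\<Union>(insert A J))) \<le> sum f (?T A) + sum f (?T (\<Union>J))" by simp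
  qed
  then show ?case using insert by simp
qed

text \<open>Double counting: a tuple of distinct points disappears with each of its \<open>k\<close>
  entries.\<close>

lemma sum_F_diff: "finite S \<Longrightarrow> (\<Sum>x\<in>S. F S - F (S - {x})) = real k * F S"
proof -
  assume S: "finite S"
  have "(\<Sum>x\<in>S. F S - F (S - {x})) = (\<Sum>x\<in>S. \<Sum>t\<in>distinct_tuples k S. f t * indicator (t ` {..<k}) x)"
    unfolding F_diff[OF S] using S
    by (intro sum.cong refl sum.mono_neutral_cong_left) (auto simp: indicator_def)
  also have "\<dots> = (\<Sum>t\<in>distinct_tuples k S. f t * (\<Sum>x\<in>S. indicator (t ` {..<k}) x))"
    by (subst sum.swap) (simp add: sum_distrib_left)
  also have "\<dots> = (\<Sum>t\<in>distinct_tuples k S. f t * real k)"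
  proof (intro sum.cong refl arg_cong[where f="\<lambda>c. f _ * c"])
    fix t assume t: "t \<in> distinct_tuples k S"
    then have "S \<inter> t ` {..<k} = t ` {..<k}" "inj_on t {..<k}" by (auto simp: distinct_tuples_def)
    then show "(\<Sum>x\<in>S. indicator (t ` {..<k}) x) = real k"
      using S by (simp add: indicator_def of_bool_def sum.If_cases card_image)
  qed
  finally show ?thesis by (simp add: ustat_def sum_distrib_left mult.commute)
qed

lemma sum_cells_sq_le:
  assumes S: "finite S" and \<A>: "finite \<A>" "disjoint \<A>" "\<And>A. A \<in> \<A> \<Longrightarrow> card (S \<inter> A) \<le> 1"
  shows "(\<Sum>A\<in>\<A>. (F S - F (S - A))\<^sup>2) \<le> (\<Sum>x\<in>S. (F S - F (S - {x}))\<^sup>2)"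
proof -
  have "(\<Sum>A\<in>\<A>. (F S - F (S - A))\<^sup>2) = (\<Sum>A\<in>\<A>. \<Sum>x\<in>S \<inter> A. (F S - F (S - {x}))\<^sup>2)"
  proof (intro sum.cong refl)
    fix A assume A: "A \<in> \<A>"
    consider "S \<inter> A = {}" | x where "S \<inter> A = {x}"
      using \<A>(3)[OF A] S by (metis card_1_singletonE card_eq_0_iff finite_Int le_neq_implies_less less_one)
    then show "(F S - F (S - A))\<^sup>2 = (\<Sum>x\<in>S \<inter> A. (F S - F (S - {x}))\<^sup>2)"
    proof cases
      case 1
      then have "S - A = S" by auto
      then show ?thesis using 1 by simp
    next
      case (2 x)
      then have "S - A = S - {x}" by auto
      then show ?thesis using 2 by simp
    qed
  qed
  also have "\<dots> = (\<Sum>x\<in>(\<Union>A\<in>\<A>. S \<inter> A). (F S - F (S - {x}))\<^sup>2)"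
    using S \<A> by (intro sum.UNION_disjoint[symmetric]) (auto simp: disjoint_def)
  also have "\<dots> \<le> (\<Sum>x\<in>S. (F S - F (S - {x}))\<^sup>2)"
    using S by (intro sum_mono2) auto
  finally show ?thesis .
qed

end

section \<open>Kernels of finite range\<close>

locale local_kernel = bounded_kernel k f M
  for k :: nat and f :: "(nat \<Rightarrow> real ^ 'd) \<Rightarrow> real" and M :: real +
  fixes \<rho> \<Theta> m :: real
  assumes symmetric: "symmetric_kernel k f"
    and rho_pos: "0 < \<rho>" and Theta_ge_1: "1 \<le> \<Theta>" and m_pos: "0 < m" and m_le_M: "m \<le> M"
    and f_pos: "\<And>x. x \<in> {..<k} \<rightarrow>\<^sub>E UNIV \<Longrightarrow> tuple_diam k x \<le> \<rho> \<Longrightarrow> 0 < f x"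
    and f_zero: "\<And>x. x \<in> {..<k} \<rightarrow>\<^sub>E UNIV \<Longrightarrow> \<Theta> * \<rho> < tuple_diam k x \<Longrightarrow> f x = 0"
    and f_ge: "\<And>x. x \<in> {..<k} \<rightarrow>\<^sub>E UNIV \<Longrightarrow> 0 < f x \<Longrightarrow> m \<le> f x"
begin

text \<open>Makes the diameter of a cube at most \<open>\<rho>\<close>, so that (K1) and (K3) apply
  to all tuples within one cube.\<close>

definition side :: real where "side = \<rho> / sqrt (real CARD('d))"

definition cube :: "real ^ 'd \<Rightarrow> int ^ 'd" where "cube x = (\<chi> i. \<lfloor>x $ i / side\<rfloor>)"

text \<open>The range \<open>\<Theta> * \<rho>\<close> of the kernel in units of
  \<open>side\<close>, rounded up. This is the ceiling in the constant of the theorem;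
  \<open>2 * reach + 1\<close> bounds the number of cubes within range in one coordinate
  direction.\<close>

definition reach :: int where "reach = \<lceil>\<Theta> * sqrt (real CARD('d))\<rceil>"

definition neighbours :: nat where "neighbours = nat (2 * reach + 1) ^ CARD('d)"

lemma side_pos: "0 < side"
  using rho_pos by (simp add: side_def)

lemma reach_nonneg: "0 \<le> reach"
  unfolding reach_def using Theta_ge_1 by (simp add: le_ceiling_iff mult_nonneg_nonneg order.strict_trans2[of _ 0])

lemma dist_same_cube:
  assumes "cube x = cube y" shows "dist x y \<le> \<rho>"
proof -
  have le: "\<bar>(x - y) $ i\<bar> \<le> side" for i
  proof -
    have "\<lfloor>x $ i / side\<rfloor> = \<lfloor>y $ i / side\<rfloor>" using assms by (simp add: cube_def vec_eq_iff)
    then have "\<bar>x $ i / side - y $ i / side\<bar> \<le> 1" by linarith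
    then show ?thesis using side_pos by (simp add: field_simps abs_le_iff)
  qed
  have "dist x y = L2_set (\<lambda>i. norm ((x - y) $ i)) UNIV" by (simp add: dist_norm norm_vec_def)
  also have "\<dots> \<le> L2_set (\<lambda>i::'d. side) UNIV" using le by (intro L2_set_mono) auto
  also have "\<dots> = sqrt (real CARD('d)) * side" using side_pos by (simp add: L2_set_constant)
  finally show ?thesis by (simp add: side_def)
qed

lemma cube_near:
  assumes "dist x y \<le> \<Theta> * \<rho>" shows "\<bar>cube y $ i - cube x $ i\<bar> \<le> reach"
proof -
  have "\<bar>(y - x) $ i\<bar> \<le> \<Theta> * \<rho>"
    using component_le_norm_cart[of "y - x" i] assms by (simp add: dist_norm norm_minus_commute)
  then have "\<bar>y $ i - x $ i\<bar> / side \<le> \<Theta> * \<rho> / side" using side_pos by (intro divide_right_mono) auto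
  also have "\<Theta> * \<rho> / side = \<Theta> * sqrt (real CARD('d))" using rho_pos by (simp add: side_def field_simps)
  also have "\<dots> \<le> real_of_int reach" unfolding reach_def by linarith
  finally have "\<bar>y $ i / side - x $ i / side\<bar> \<le> real_of_int reach"
    using side_pos by (simp flip: diff_divide_distrib)
  then have le: "y $ i / side \<le> x $ i / side + of_int reach" "x $ i / side \<le> y $ i / side + of_int reach" by auto
  from floor_mono[OF le(1)] floor_mono[OF le(2)] show ?thesis by (simp add: cube_def)
qed

lemma card_near_cubes:
  "finite {z :: int ^ 'd. \<forall>i. \<bar>z $ i - w $ i\<bar> \<le> reach}" (is "finite ?Z")
  "card {z :: int ^ 'd. \<forall>i. \<bar>z $ i - w $ i\<bar> \<le> reach} \<le> neighbours"
proof -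
  let ?P = "Pi\<^sub>E UNIV (\<lambda>i. {w $ i - reach..w $ i + reach})"
  have "z \<in> (\<lambda>g. \<chi> i. g i) ` ?P" if z: "z \<in> ?Z" for z
  proof (rule image_eqI[of _ _ "\<lambda>i. z $ i"])
    have "w $ i - reach \<le> z $ i \<and> z $ i \<le> w $ i + reach" for i
      using spec[OF z[unfolded mem_Collect_eq], of i] by linarith
    then show "(\<lambda>i. z $ i) \<in> ?P" by (auto simp: PiE_iff)
  qed (simp add: vec_eq_iff)
  then have sub: "?Z \<subseteq> (\<lambda>g. \<chi> i. g i) ` ?P" by blast
  have fin: "finite ?P" by (intro finite_PiE) auto
  show "finite ?Z" using sub fin finite_surj by blast
  have "card ?Z \<le> card ?P" using sub fin by (meson card_image_le card_mono finite_imageI order_trans)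
  also have "\<dots> = neighbours" by (simp add: card_PiE neighbours_def)
  finally show "card ?Z \<le> neighbours" .
qed

lemma card_near_le:
  assumes S: "finite S" and N: "\<And>z. real (card {y\<in>S. cube y = z}) \<le> N"
  shows "real (card {y\<in>S. dist x y \<le> \<Theta> * \<rho>}) \<le> real neighbours * N"
proof -
  let ?Z = "{z. \<forall>i. \<bar>z $ i - cube x $ i\<bar> \<le> reach}"
  have "N \<ge> 0" using N[of 0] by (rule order_trans[rotated]) simp
  have "{y\<in>S. dist x y \<le> \<Theta> * \<rho>} \<subseteq> (\<Union>z\<in>?Z. {y\<in>S. cube y = z})" using cube_near by auto
  then have "card {y\<in>S. dist x y \<le> \<Theta> * \<rho>} \<le> card (\<Union>z\<in>?Z. {y\<in>S. cube y = z})"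
    using S by (intro card_mono) (auto intro!: finite_subset[of "\<Union>z\<in>?Z. {y\<in>S. cube y = z}" S])
  also have "\<dots> \<le> (\<Sum>z\<in>?Z. card {y\<in>S. cube y = z})" by (intro card_UN_le card_near_cubes)
  finally have "real (card {y\<in>S. dist x y \<le> \<Theta> * \<rho>}) \<le> (\<Sum>z\<in>?Z. real (card {y\<in>S. cube y = z}))"
    by (simp flip: of_nat_sum)
  also have "\<dots> \<le> (\<Sum>z\<in>?Z. N)" by (intro sum_mono N)
  also have "\<dots> = real (card ?Z) * N" by simp
  also have "\<dots> \<le> real neighbours * N"
    using card_near_cubes(2)[of "cube x"] \<open>N \<ge> 0\<close> by (intro mult_right_mono) auto
  finally show ?thesis .
qed

text \<open>Points crowded into one cube make the statistic large, since each of their tuples has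
  diameter at most \<open>\<rho>\<close> and contributes at least \<open>m\<close>.\<close>

lemma F_ge_cube:
  assumes S: "finite S" shows "m * fact k * real (card {y\<in>S. cube y = z} choose k) \<le> F S"
proof -
  let ?C = "{y\<in>S. cube y = z}"
  have "m * (fact k * real (card ?C choose k)) = (\<Sum>t\<in>distinct_tuples k ?C. m)"
    using S by (simp add: card_distinct_tuples mult_ac)
  also have "\<dots> \<le> (\<Sum>t\<in>distinct_tuples k ?C. f t)"
  proof (rule sum_mono)
    fix t assume t: "t \<in> distinct_tuples k ?C"
    then have ext: "t \<in> {..<k} \<rightarrow>\<^sub>E UNIV" by (rule distinct_tuples_extensional)
    have "tuple_diam k t \<le> \<rho>" unfolding tuple_diam_def
    proof (rule diameter_le)
      show "t ` {..<k} \<noteq> {} \<or> 0 \<le> \<rho>" using rho_pos by simp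
      fix x y assume "x \<in> t ` {..<k}" "y \<in> t ` {..<k}"
      then have "cube x = cube y" using t by (auto simp: distinct_tuples_def PiE_iff)
      then show "norm (x - y) \<le> \<rho>" using dist_same_cube by (simp add: dist_norm)
    qed
    then show "m \<le> f t" using f_ge[OF ext] f_pos[OF ext] by auto
  qed
  also have "\<dots> \<le> F S" using F_mono[OF S, of ?C] by (simp add: ustat_def)
  finally show ?thesis by (simp add: mult_ac)
qed

text \<open>By symmetry a single tuple with positive value brings all its rearrangements along. This
  provides \<open>F S / (m * fact k) \<ge> 1\<close>, which settles cubes with fewer than
  \<open>k\<close> points in \<open>card_cube_le\<close>.\<close>

lemma F_ge_permutations:
  assumes S: "finite S" and pos: "0 < F S" shows "m * fact k \<le> F S"
proof -
  obtain t where t: "t \<in> distinct_tuples k S" "0 < f t"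
  proof -
    have "\<exists>t\<in>distinct_tuples k S. \<not> f t \<le> 0"
    proof (rule ccontr)
      assume "\<not> ?thesis"
      then have "F S \<le> 0" unfolding ustat_def by (intro sum_nonpos) auto
      then show False using pos by simp
    qed
    then show ?thesis using that by auto
  qed
  let ?\<Pi> = "{\<pi>. \<pi> permutes {..<k}}"
  have ext: "t \<in> {..<k} \<rightarrow>\<^sub>E UNIV" using t(1) by (rule distinct_tuples_extensional)
  have inj: "inj_on (\<lambda>\<pi>. t \<circ> \<pi>) ?\<Pi>"
  proof (rule inj_onI)
    fix \<pi> \<sigma> assume p: "\<pi> \<in> ?\<Pi>" "\<sigma> \<in> ?\<Pi>" and eq: "t \<circ> \<pi> = t \<circ> \<sigma>"
    show "\<pi> = \<sigma>"
    proof
      fix i show "\<pi> i = \<sigma> i"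
      proof (cases "i < k")
        case True
        then have "\<pi> i \<in> {..<k}" "\<sigma> i \<in> {..<k}"
          using p permutes_in_image[of \<pi> "{..<k}" i] permutes_in_image[of \<sigma> "{..<k}" i] by auto
        moreover have "t (\<pi> i) = t (\<sigma> i)" using fun_cong[OF eq, of i] by simp
        ultimately show ?thesis using t(1) by (auto simp: distinct_tuples_def inj_on_def)
      next
        case False
        then show ?thesis using p by (auto simp: permutes_def)
      qed
    qed
  qed
  have img: "(\<lambda>\<pi>. t \<circ> \<pi>) ` ?\<Pi> \<subseteq> distinct_tuples k S"
  proof clarify
    fix \<pi> assume p: "\<pi> permutes {..<k}"
    have pi: "\<pi> i < k" if "i < k" for i using permutes_in_image[OF p, of i] that by simp
    have "t (\<pi> i) = undefined" if "\<not> i < k" for i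
      using t(1) p that by (auto simp: distinct_tuples_def PiE_iff extensional_def permutes_def)
    moreover have "inj_on (t \<circ> \<pi>) {..<k}"
      using t(1) permutes_image[OF p] permutes_inj_on[OF p, of "{..<k}"]
      by (intro comp_inj_on) (auto simp: distinct_tuples_def)
    ultimately show "t \<circ> \<pi> \<in> distinct_tuples k S"
      using t(1) pi by (auto simp: distinct_tuples_def PiE_iff extensional_def)
  qed
  have "m * fact k = (\<Sum>x\<in>(\<lambda>\<pi>. t \<circ> \<pi>) ` ?\<Pi>. m)"
    using card_image[OF inj] card_permutations[of "{..<k}" k] by simp
  also have "\<dots> \<le> (\<Sum>x\<in>(\<lambda>\<pi>. t \<circ> \<pi>) ` ?\<Pi>. f x)"
  proof (rule sum_mono)
    fix x assume "x \<in> (\<lambda>\<pi>. t \<circ> \<pi>) ` ?\<Pi>"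
    then have "f x = f t" using symmetric ext by (auto simp: symmetric_kernel_def)
    then show "m \<le> f x" using f_ge[OF ext t(2)] by simp
  qed
  also have "\<dots> \<le> F S" unfolding ustat_def using S img by (intro sum_mono2) (auto intro: f_tuple)
  finally show ?thesis .
qed

text \<open>Solves \<open>F_ge_cube\<close> for the number of points by means of
  \<open>(n / k) ^ k \<le> n choose k\<close>; hence the quotient of \<open>k ^ k\<close> and
  \<open>m * fact k\<close> in the final constant.\<close>

lemma card_cube_le:
  assumes S: "finite S" and pos: "0 < F S"
  shows "real (card {y\<in>S. cube y = z}) \<le> real k * (F S / (m * fact k)) powr (1 / real k)"
proof -
  let ?n = "card {y\<in>S. cube y = z}" and ?r = "F S / (m * fact k)"
  have r: "1 \<le> ?r" using F_ge_permutations[OF S pos] m_pos by (simp add: field_simps)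
  show ?thesis
  proof (cases "k \<le> ?n")
    case False
    have "1 \<le> ?r powr (1 / real k)" using r by (intro ge_one_powr_ge_zero) auto
    then have "real k * 1 \<le> real k * ?r powr (1 / real k)" by (intro mult_left_mono) auto
    then show ?thesis using False by linarith
  next
    case True
    have "(real ?n / real k) ^ k \<le> real (?n choose k)" by (rule binomial_ge_n_over_k_pow_k[OF True])
    also have "\<dots> \<le> ?r" using F_ge_cube[OF S, of z] m_pos by (simp add: field_simps)
    finally have "((real ?n / real k) ^ k) powr (1 / real k) \<le> ?r powr (1 / real k)"
      by (intro powr_mono2) auto
    moreover have "((real ?n / real k) ^ k) powr (1 / real k) = real ?n / real k"
      using k_pos by (cases "?n = 0") (auto simp: powr_powr simp flip: powr_realpow)
    ultimately have "real ?n / real k \<le> ?r powr (1 / real k)" by (simp only:)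
    then show ?thesis using k_pos by (simp add: field_simps)
  qed
qed

text \<open>By (K2) a contributing tuple through \<open>x\<close> stays within distance
  \<open>\<Theta> * \<rho>\<close> of \<open>x\<close>: there are \<open>k\<close> positions for
  \<open>x\<close>, and \<open>k - 1\<close> entries to be chosen among the near points.\<close>

lemma F_diff_le_near:
  assumes S: "finite S"
  shows "F S - F (S - {x}) \<le> real k * M * real (card {y\<in>S. dist x y \<le> \<Theta> * \<rho>}) ^ (k - 1)"
proof -
  let ?N = "{y\<in>S. dist x y \<le> \<Theta> * \<rho>}"
  let ?T = "{t\<in>distinct_tuples k S. t ` {..<k} \<inter> {x} \<noteq> {}}"
  let ?E = "\<lambda>j. Pi\<^sub>E {..<k} (\<lambda>i. if i = j then {x} else ?N)"
  have finE: "finite (?E j)" for j using S by (intro finite_PiE) auto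
  have cardE: "card (?E j) = card ?N ^ (k - 1)" if "j < k" for j
  proof -
    have "card (?E j) = (\<Prod>i<k. if i = j then 1 else card ?N)"
      by (subst card_PiE) (auto intro!: prod.cong)
    also have "\<dots> = (\<Prod>i\<in>{..<k} - {j}. card ?N)"
      using that by (subst prod.remove[of _ j]) (auto intro!: prod.cong)
    finally show ?thesis using that by simp
  qed
  have sub: "{t\<in>?T. f t \<noteq> 0} \<subseteq> (\<Union>j<k. ?E j)"
  proof
    fix t assume tT: "t \<in> {t\<in>?T. f t \<noteq> 0}"
    then have t: "t \<in> distinct_tuples k S" "f t \<noteq> 0" by auto
    from tT obtain j where j: "j < k" "t j = x" by auto
    have "tuple_diam k t \<le> \<Theta> * \<rho>"
      using f_zero[OF distinct_tuples_extensional[OF t(1)]] t(2) by force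
    moreover have "dist (t j) (t i) \<le> tuple_diam k t" if "i < k" for i
      unfolding tuple_diam_def using that j(1) by (intro diameter_bounded_bound finite_imp_bounded) auto
    ultimately have "dist (t j) (t i) \<le> \<Theta> * \<rho>" if "i < k" for i using that by (meson order_trans)
    then have "t \<in> ?E j" using t(1) j by (auto simp: distinct_tuples_def PiE_iff)
    then show "t \<in> (\<Union>j<k. ?E j)" using j by blast
  qed
  have "F S - F (S - {x}) = (\<Sum>t\<in>{t\<in>?T. f t \<noteq> 0}. f t)"
    unfolding F_diff[OF S] using S by (intro sum.mono_neutral_right) auto
  also have "\<dots> \<le> (\<Sum>t\<in>{t\<in>?T. f t \<noteq> 0}. M)" by (intro sum_mono) (auto intro: f_tuple)
  also have "\<dots> = M * real (card {t\<in>?T. f t \<noteq> 0})" by simp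
  also have "\<dots> \<le> M * real (k * card ?N ^ (k - 1))"
  proof -
    have "card {t\<in>?T. f t \<noteq> 0} \<le> card (\<Union>j<k. ?E j)" using sub finE by (intro card_mono) auto
    also have "\<dots> \<le> (\<Sum>j<k. card (?E j))" by (intro card_UN_le) auto
    also have "\<dots> = k * card ?N ^ (k - 1)" using cardE by simp
    finally have "real (card {t\<in>?T. f t \<noteq> 0}) \<le> real (k * card ?N ^ (k - 1))" by (rule of_nat_mono)
    then show ?thesis using M_pos by (intro mult_left_mono) auto
  qed
  finally show ?thesis by (simp add: mult_ac)
qed

definition c_d :: real where "c_d = c_const (CARD('d)) k \<Theta> M m"

lemma c_d_pos: "0 < c_d"
proof -
  have "0 \<le> real_of_int \<lceil>\<Theta> * sqrt (real CARD('d))\<rceil>"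
    using reach_nonneg unfolding reach_def by (simp only: of_int_0_le_iff)
  then have "0 < 2 * real_of_int \<lceil>\<Theta> * sqrt (real CARD('d))\<rceil> + 1" by linarith
  then show ?thesis
    unfolding c_d_def c_const_def using M_pos m_pos k_pos by (intro mult_pos_pos zero_less_power) auto
qed

text \<open>Of the two factors in each square, one is bounded uniformly through the crowding of
  cubes, the other is summed by \<open>sum_F_diff\<close>. The first yields the power
  \<open>1 - 1 / k\<close> of \<open>F S\<close>, the second the power 1.\<close>

lemma sum_sq_F_diff_le:
  assumes S: "finite S"
  shows "(\<Sum>x\<in>S. (F S - F (S - {x}))\<^sup>2) \<le> (real k)\<^sup>2 * c_d * F S powr (2 - 1 / real k)"
proof (cases "F S = 0")
  case True
  have "F S - F (S - {x}) = 0" for x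
    using F_diff_nonneg[OF S, of "{x}"] F_nonneg[of "S - {x}"] True by simp
  then show ?thesis using True by simp
next
  case False
  then have pos: "0 < F S" using F_nonneg[of S] by simp
  define q where "q = real k ^ k / (m * fact k)"
  have q_pos: "0 < q" using m_pos k_pos by (simp add: q_def)
  define D where "D = real neighbours ^ (k - 1)"
  have nb: "1 \<le> neighbours" unfolding neighbours_def using reach_nonneg by (intro one_le_power) auto
  have D1: "1 \<le> D" unfolding D_def using nb by (intro one_le_power) auto
  have B: "real k * (F S / (m * fact k)) powr (1 / real k) = (q * F S) powr (1 / real k)"
  proof -
    have "(q * F S) powr (1 / real k) = (real k ^ k) powr (1 / real k) * (F S / (m * fact k)) powr (1 / real k)"
      using k_pos m_pos pos by (subst powr_mult[symmetric]) (auto simp: q_def)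
    also have "(real k ^ k) powr (1 / real k) = real k"
      using k_pos by (auto simp: powr_powr simp flip: powr_realpow)
    finally show ?thesis by simp
  qed
  have a_le: "F S - F (S - {x}) \<le> real k * M * (D * (q * F S) powr (1 - 1 / real k))" for x
  proof -
    have "F S - F (S - {x}) \<le> real k * M * real (card {y\<in>S. dist x y \<le> \<Theta> * \<rho>}) ^ (k - 1)"
      by (rule F_diff_le_near[OF S])
    also have "\<dots> \<le> real k * M * (real neighbours * (q * F S) powr (1 / real k)) ^ (k - 1)"
    proof (intro mult_left_mono power_mono)
      show "real (card {y\<in>S. dist x y \<le> \<Theta> * \<rho>}) \<le> real neighbours * (q * F S) powr (1 / real k)"
        using card_cube_le[OF S pos] unfolding B by (intro card_near_le[OF S]) auto
    qed (use M_pos in auto)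
    also have "((q * F S) powr (1 / real k)) ^ (k - 1) = (q * F S) powr (1 - 1 / real k)"
    proof -
      have "((q * F S) powr (1 / real k)) ^ (k - 1) = ((q * F S) powr (1 / real k)) powr real (k - 1)"
        using q_pos pos by (subst powr_realpow) auto
      also have "\<dots> = (q * F S) powr (1 / real k * real (k - 1))" by (rule powr_powr)
      also have "1 / real k * real (k - 1) = 1 - 1 / real k" using k_pos by (simp add: of_nat_diff field_simps)
      finally show ?thesis .
    qed
    then have "(real neighbours * (q * F S) powr (1 / real k)) ^ (k - 1) = D * (q * F S) powr (1 - 1 / real k)"
      by (simp add: power_mult_distrib D_def)
    finally show ?thesis .
  qed
  let ?R = "real k * M * (D * (q * F S) powr (1 - 1 / real k))"
  have "(\<Sum>x\<in>S. (F S - F (S - {x}))\<^sup>2) \<le> (\<Sum>x\<in>S. (F S - F (S - {x})) * ?R)"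
    unfolding power2_eq_square by (intro sum_mono mult_left_mono a_le F_diff_nonneg S)
  also have "\<dots> = real k * F S * ?R" using sum_F_diff[OF S] by (simp flip: sum_distrib_right)
  also have "\<dots> = (real k)\<^sup>2 * (D * M * F S * (q * F S) powr (1 - 1 / real k))"
    by (simp add: power2_eq_square)
  \<comment> \<open>The inserted factor \<open>D * (M * q)\<close> is at least 1, because
    \<open>fact k \<le> k ^ k\<close> and \<open>m \<le> M\<close>; it completes the squares of
    \<open>D\<close> and \<open>M\<close> and the exponent of \<open>q\<close> in
    \<open>c_d\<close>.\<close>
  also have "\<dots> \<le> (real k)\<^sup>2 * (D * M * F S * (q * F S) powr (1 - 1 / real k)) * (D * (M * q))"
  proof -
    have "fact k \<le> real k ^ k" using fact_le_power[of k, where 'a=real] by simp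
    then have "m * fact k \<le> M * real k ^ k" using m_le_M m_pos by (intro mult_mono) auto
    then have "1 \<le> M * q" using m_pos by (simp add: q_def field_simps)
    then have "1 * 1 \<le> D * (M * q)" using D1 by (intro mult_mono) auto
    moreover have "0 \<le> (real k)\<^sup>2 * (D * M * F S * (q * F S) powr (1 - 1 / real k))"
      using D1 M_pos pos by auto
    ultimately show ?thesis using mult_left_mono[of 1 "D * (M * q)"] by fastforce
  qed
  also have "\<dots> = (real k)\<^sup>2 * (D\<^sup>2 * M\<^sup>2 * ((q * F S) powr (1 - 1 / real k) * (q * F S)))"
    by (simp add: power2_eq_square algebra_simps)
  also have "(q * F S) powr (1 - 1 / real k) * (q * F S) = (q * F S) powr (2 - 1 / real k)"
    using q_pos pos powr_add[of "q * F S" "1 - 1 / real k" 1] by simp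
  also have "\<dots> = q powr (2 - 1 / real k) * F S powr (2 - 1 / real k)"
    by (rule powr_mult)
  also have "D\<^sup>2 * M\<^sup>2 * (q powr (2 - 1 / real k) * F S powr (2 - 1 / real k)) = c_d * F S powr (2 - 1 / real k)"
  proof -
    have "real neighbours = (2 * of_int reach + 1) ^ CARD('d)"
      using reach_nonneg by (simp add: neighbours_def)
    then have "D\<^sup>2 = (2 * of_int reach + 1) ^ (2 * CARD('d) * (k - 1))"
      by (simp add: D_def mult_ac flip: power_mult)
    moreover have "2 - 1 / real k = (2 * real k - 1) / real k" using k_pos by (simp add: field_simps)
    ultimately show ?thesis unfolding c_d_def c_const_def by (simp add: q_def reach_def)
  qed
  finally show ?thesis by (simp add: mult_ac)
qed

end

section \<open>Small cells and bounded windows\<close>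

lemma lim_inverse_Suc: "(\<lambda>n. 1 / real (Suc n)) \<longlonglongrightarrow> 0"
  by (rule LIMSEQ_Suc[OF lim_1_over_n])

definition cell_partition :: "'a::euclidean_space set \<Rightarrow> real \<Rightarrow> 'a set set \<Rightarrow> bool" where
  "cell_partition W e \<A> \<longleftrightarrow> finite \<A> \<and> disjoint \<A> \<and> \<Union>\<A> = W \<and>
     (\<forall>A\<in>\<A>. bborel A \<and> (\<forall>x\<in>A. \<forall>y\<in>A. dist x y < e))"

text \<open>Total boundedness gives finitely many balls of radius \<open>e / 2\<close>. Points that
  lie in exactly the same balls form a cell; they share at least one ball and so are closer than
  \<open>e\<close>.\<close>

lemma cell_partition_exists:
  assumes W: "bborel W" and e: "0 < e"
  obtains \<A> where "cell_partition W e \<A>"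
proof -
  have "compact (closure W)" using W by auto
  then obtain K where K: "finite K" "closure W \<subseteq> (\<Union>c\<in>K. ball c (e / 2))"
    using e unfolding compact_eq_totally_bounded by (meson half_gt_zero)
  define \<tau> where "\<tau> = (\<lambda>x. {c\<in>K. dist c x < e / 2})"
  define \<A> where "\<A> = (\<lambda>J. {x\<in>W. \<tau> x = J}) ` (Pow K - {{}})"
  have cell: "{x\<in>W. \<tau> x = J} \<in> sets borel" if "J \<subseteq> K" for J
  proof -
    have "{x\<in>W. \<tau> x = J} = {x\<in>space borel. \<forall>c\<in>K. dist c x < e / 2 \<longleftrightarrow> c \<in> J} \<inter> W"
      using that by (auto simp: \<tau>_def)
    also have "\<dots> \<in> sets borel"
    proof (intro sets.Int sets.sets_Collect_finite_All K(1))
      fix c show "{x \<in> space borel. dist c x < e / 2 \<longleftrightarrow> c \<in> J} \<in> sets borel" by measurable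
    qed (use W in auto)
    finally show ?thesis .
  qed
  have "cell_partition W e \<A>" unfolding cell_partition_def
  proof (intro conjI ballI)
    show "finite \<A>" using K by (simp add: \<A>_def)
    show "disjoint \<A>" by (auto simp: \<A>_def disjoint_def)
    show "\<Union>\<A> = W"
    proof
      show "W \<subseteq> \<Union>\<A>"
      proof
        fix x assume x: "x \<in> W"
        then have "x \<in> closure W" using closure_subset by auto
        then obtain c where "c \<in> K" "x \<in> ball c (e / 2)" using K(2) by blast
        then have "\<tau> x \<noteq> {}" by (auto simp: \<tau>_def)
        then have "\<tau> x \<in> Pow K - {{}}" by (auto simp: \<tau>_def)
        then show "x \<in> \<Union>\<A>" using x unfolding \<A>_def by blast
      qed
    qed (auto simp: \<A>_def)
    fix A assume "A \<in> \<A>"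
    then obtain J where J: "A = {x\<in>W. \<tau> x = J}" "J \<subseteq> K" "J \<noteq> {}" by (auto simp: \<A>_def)
    show "bborel A" using cell[OF J(2)] W J(1) by (auto simp: bborel_def intro: bounded_subset)
    fix x y assume "x \<in> A" "y \<in> A"
    moreover obtain c where "c \<in> J" using J(3) by auto
    ultimately have "dist c x < e / 2" "dist c y < e / 2" by (auto simp: J(1) \<tau>_def)
    then show "dist x y < e" by (metis dist_commute dist_triangle_half_l)
  qed
  then show ?thesis by (rule that)
qed

lemma finite_separated:
  fixes S :: "'a::metric_space set"
  assumes "finite S"
  obtains \<delta> where "0 < \<delta>" "\<And>x y. x \<in> S \<Longrightarrow> y \<in> S \<Longrightarrow> dist x y < \<delta> \<Longrightarrow> x = y"
proof -
  let ?D = "insert 1 ((\<lambda>(x, y). dist x y) ` {(x, y)\<in>S \<times> S. x \<noteq> y})"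
  have fin: "finite ?D" using assms by (auto intro: finite_subset[of _ "S \<times> S"])
  show ?thesis
  proof (rule that[of "Min ?D"])
    show "0 < Min ?D" using fin by (subst Min_gr_iff) auto
    fix x y assume "x \<in> S" "y \<in> S" "dist x y < Min ?D"
    then show "x = y" using Min_le[OF fin, of "dist x y"] by force
  qed
qed

lemma card_cell_le_1:
  assumes "finite S" "\<And>x y. x \<in> S \<Longrightarrow> y \<in> S \<Longrightarrow> dist x y < \<delta> \<Longrightarrow> x = y"
    and "\<And>x y. x \<in> A \<Longrightarrow> y \<in> A \<Longrightarrow> dist x y < e" "e \<le> \<delta>"
  shows "card (S \<inter> A) \<le> 1"
proof -
  have "x = y" if "x \<in> S \<inter> A" "y \<in> S \<inter> A" for x y
    using assms(2)[of x y] assms(3)[of x y] assms(4) that by auto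
  then show ?thesis using assms(1) by (metis One_nat_def card_le_Suc0_iff_eq finite_Int)
qed

context local_kernel
begin

text \<open>The bound of \<open>sum_sq_F_diff_le\<close> at the level \<open>b\<close>; it acts as
  the variance proxy of \<open>min F b\<close>.\<close>

definition proxy :: "real \<Rightarrow> real" where
  "proxy b = (real k)\<^sup>2 * c_d * b powr (2 - 1 / real k)"

lemma proxy_pos: "0 < b \<Longrightarrow> 0 < proxy b"
  using k_pos c_d_pos by (simp add: proxy_def)

lemma truncated_certified:
  assumes S: "finite S" and \<A>: "finite \<A>" "disjoint \<A>" "\<And>A. A \<in> \<A> \<Longrightarrow> card (S \<inter> A) \<le> 1"
    and b: "0 < b" and l: "0 < l"
  shows "certified \<A> (\<lambda>S. l * min (F S) b) S (l * min (F S) b - l\<^sup>2 * proxy b / 2)"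
proof -
  \<comment> \<open>Scaling by \<open>w\<close> brings \<open>F S\<close> down to
    \<open>min (F S) b\<close>, and on every subconfiguration of \<open>S\<close> it stays below the
    truncated value. For \<open>F S\<close> above \<open>b\<close> the bound on the scaled squares
    is a multiple of \<open>b\<^sup>2 * F S powr (- (1 / real k))\<close>, which decreases in
    \<open>F S\<close>.\<close>
  define w where "w = (if F S \<le> b then 1 else b / F S)"
  have w: "0 \<le> w" "w * F S = min (F S) b" "w \<le> 1" using b by (auto simp: w_def)
  have alpha: "0 \<le> 2 - 1 / real k" using k_pos by (simp add: field_simps)
  show ?thesis unfolding certified_def
  proof (intro exI[of _ "l * min (F S) b"] exI[of _ "\<lambda>A. l * (w * (F S - F (S - A)))"] conjI allI impI)
    fix J assume "J \<subseteq> \<A>"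
    then have J: "finite J" using \<A>(1) finite_subset by blast
    have "min (F S) b - w * (\<Sum>A\<in>J. F S - F (S - A)) \<le> w * F S - w * (F S - F (S - \<Union>J))"
      using F_diff_Union_le[OF S J] w by (simp add: mult_left_mono)
    also have "\<dots> = w * F (S - \<Union>J)" by (simp add: algebra_simps)
    also have "\<dots> \<le> min (F (S - \<Union>J)) b"
    proof (rule min.boundedI)
      show "w * F (S - \<Union>J) \<le> F (S - \<Union>J)" using w F_nonneg by (simp add: mult_left_le_one_le)
      have "w * F (S - \<Union>J) \<le> w * F S" using w F_mono[OF S, of "S - \<Union>J"] by (intro mult_left_mono) auto
      then show "w * F (S - \<Union>J) \<le> b" using w(2) by simp
    qed
    finally have "l * (min (F S) b - w * (\<Sum>A\<in>J. F S - F (S - A))) \<le> l * min (F (S - \<Union>J)) b"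
      using l by (intro mult_left_mono) auto
    then show "l * min (F S) b - (\<Sum>A\<in>J. l * (w * (F S - F (S - A)))) \<le> l * min (F (S - \<Union>J)) b"
      unfolding sum_distrib_left[symmetric] by (simp only: right_diff_distrib)
  next
    have "(\<Sum>A\<in>\<A>. (F S - F (S - A))\<^sup>2) \<le> (real k)\<^sup>2 * c_d * F S powr (2 - 1 / real k)"
      using sum_cells_sq_le[OF S \<A>] sum_sq_F_diff_le[OF S] by (rule order_trans)
    then have "w\<^sup>2 * (\<Sum>A\<in>\<A>. (F S - F (S - A))\<^sup>2) \<le> w\<^sup>2 * ((real k)\<^sup>2 * c_d * F S powr (2 - 1 / real k))"
      by (intro mult_left_mono) auto
    also have "\<dots> = (real k)\<^sup>2 * c_d * (w\<^sup>2 * F S powr (2 - 1 / real k))" by simp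
    also have "\<dots> \<le> (real k)\<^sup>2 * c_d * b powr (2 - 1 / real k)"
    proof (intro mult_left_mono)
      show "w\<^sup>2 * F S powr (2 - 1 / real k) \<le> b powr (2 - 1 / real k)"
      proof (cases "F S \<le> b")
        case True
        then show ?thesis using alpha F_nonneg by (simp add: w_def powr_mono2)
      next
        case False
        then have pos: "0 < F S" using b by simp
        have "F S powr (2 - 1 / real k) = F S powr 2 * F S powr (- (1 / real k))"
          "b powr (2 - 1 / real k) = b powr 2 * b powr (- (1 / real k))" by (simp_all flip: powr_add)
        then have "w\<^sup>2 * F S powr (2 - 1 / real k) = b\<^sup>2 * F S powr (- (1 / real k))"
          using pos False by (simp add: w_def power_divide)
        also have "\<dots> \<le> b\<^sup>2 * b powr (- (1 / real k))"
          using False b by (intro mult_left_mono powr_mono2') auto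
        also have "\<dots> = b powr (2 - 1 / real k)"
          using b \<open>b powr (2 - 1 / real k) = b powr 2 * b powr (- (1 / real k))\<close> by simp
        finally show ?thesis .
      qed
    qed (use c_d_pos in auto)
    finally have "w\<^sup>2 * (\<Sum>A\<in>\<A>. (F S - F (S - A))\<^sup>2) \<le> proxy b" by (simp add: proxy_def)
    then have "l\<^sup>2 * (w\<^sup>2 * (\<Sum>A\<in>\<A>. (F S - F (S - A))\<^sup>2)) \<le> l\<^sup>2 * proxy b"
      by (intro mult_left_mono) auto
    moreover have "(\<Sum>A\<in>\<A>. (l * (w * (F S - F (S - A))))\<^sup>2) = l\<^sup>2 * (w\<^sup>2 * (\<Sum>A\<in>\<A>. (F S - F (S - A))\<^sup>2))"
      by (simp add: power_mult_distrib sum_distrib_left)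
    ultimately show "l * min (F S) b - l\<^sup>2 * proxy b / 2 \<le> l * min (F S) b - (\<Sum>A\<in>\<A>. (l * (w * (F S - F (S - A))))\<^sup>2) / 2"
      by simp
  qed
qed

end

text \<open>Without truncation the quadratic term remains a functional of the configuration. This
  suffices for the lower tail, where it enters only through its expectation.\<close>

lemma (in bounded_kernel) F_certified:
  assumes S: "finite S" and \<A>: "finite \<A>" and l: "0 < l"
  shows "certified \<A> (\<lambda>S. l * F S) S (l * F S - l\<^sup>2 / 2 * (\<Sum>A\<in>\<A>. (F S - F (S - A))\<^sup>2))"
  unfolding certified_def
proof (intro exI[of _ "l * F S"] exI[of _ "\<lambda>A. l * (F S - F (S - A))"] conjI allI impI)
  fix J assume "J \<subseteq> \<A>"
  then have J: "finite J" using \<A> finite_subset by blast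
  have "F S - (\<Sum>A\<in>J. F S - F (S - A)) \<le> F (S - \<Union>J)" using F_diff_Union_le[OF S J] by simp
  then have "l * (F S - (\<Sum>A\<in>J. F S - F (S - A))) \<le> l * F (S - \<Union>J)" using l by (intro mult_left_mono) auto
  then show "l * F S - (\<Sum>A\<in>J. l * (F S - F (S - A))) \<le> l * F (S - \<Union>J)"
    unfolding sum_distrib_left[symmetric] by (simp only: right_diff_distrib)
next
  show "l * F S - l\<^sup>2 / 2 * (\<Sum>A\<in>\<A>. (F S - F (S - A))\<^sup>2) \<le> l * F S - (\<Sum>A\<in>\<A>. (l * (F S - F (S - A)))\<^sup>2) / 2"
    by (simp add: power_mult_distrib sum_distrib_left sum_divide_distrib)
qed

context poisson_points
begin

text \<open>Compactness. Cells of measure above \<open>p\<close> with diameters tending to zero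
  would accumulate at some \<open>z\<close>; all closed balls around \<open>z\<close> would have
  measure above \<open>p\<close>, and by continuity from above, available since bounded sets have
  finite measure, \<open>z\<close> would be an atom.\<close>

lemma small_cells:
  assumes W: "bborel W" and na: "non_atomic \<mu>" and p: "0 < p"
  obtains e where "0 < e"
    "\<And>A. bborel A \<Longrightarrow> A \<subseteq> W \<Longrightarrow> (\<And>x y. x \<in> A \<Longrightarrow> y \<in> A \<Longrightarrow> dist x y < e) \<Longrightarrow> measure \<mu> A \<le> p"
proof -
  have fin: "emeasure \<mu> A < \<infinity>" if "bborel A" for A
    using that locally_finite_mu sets_mu unfolding locally_finite_measure_def by auto
  have "\<exists>e>0. \<forall>A. bborel A \<longrightarrow> A \<subseteq> W \<longrightarrow> (\<forall>x\<in>A. \<forall>y\<in>A. dist x y < e) \<longrightarrow> measure \<mu> A \<le> p"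
  proof (rule ccontr)
    assume contra: "\<not> ?thesis"
    have "\<exists>A. bborel A \<and> A \<subseteq> W \<and> (\<forall>x\<in>A. \<forall>y\<in>A. dist x y < 1 / real (Suc n)) \<and> p < measure \<mu> A" for n
    proof -
      have "0 < 1 / real (Suc n)" by simp
      then show ?thesis using contra by (meson not_le)
    qed
    then obtain A where A: "\<And>n. bborel (A n)" "\<And>n. A n \<subseteq> W"
      "\<And>n x y. x \<in> A n \<Longrightarrow> y \<in> A n \<Longrightarrow> dist x y < 1 / real (Suc n)" "\<And>n. p < measure \<mu> (A n)" by metis
    have "A n \<noteq> {}" for n using A(4)[of n] p by auto
    then have "\<forall>n. \<exists>x. x \<in> A n" by blast
    then obtain x where x: "\<And>n. x n \<in> A n" by metis
    have "compact (closure W)" using W by auto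
    moreover have "\<forall>n. x n \<in> closure W" using x A(2) closure_subset by blast
    ultimately obtain z r where zr: "strict_mono (r :: nat \<Rightarrow> nat)" "(x \<circ> r) \<longlonglongrightarrow> z"
      unfolding compact_def by blast
    have ball: "p < measure \<mu> (cball z (1 / real (Suc j)))" for j
    proof -
      have half: "0 < 1 / real (Suc j) / 2" by simp
      have "eventually (\<lambda>n. dist ((x \<circ> r) n) z < 1 / real (Suc j) / 2) sequentially"
        using zr(2) half by (rule tendstoD)
      moreover have "eventually (\<lambda>n. 1 / real (Suc n) < 1 / real (Suc j) / 2) sequentially"
        using lim_inverse_Suc half by (rule order_tendstoD(2))
      ultimately have "eventually (\<lambda>n. dist ((x \<circ> r) n) z < 1 / real (Suc j) / 2 \<and> 1 / real (Suc n) < 1 / real (Suc j) / 2) sequentially"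
        by eventually_elim simp
      then obtain n where n: "dist (x (r n)) z < 1 / real (Suc j) / 2" "1 / real (Suc n) < 1 / real (Suc j) / 2"
        unfolding eventually_sequentially by auto
      have "1 / real (Suc (r n)) \<le> 1 / real (Suc n)"
        using seq_suble[OF zr(1), of n] by (simp add: field_simps)
      have "A (r n) \<subseteq> cball z (1 / real (Suc j))"
      proof
        fix y assume "y \<in> A (r n)"
        then have "dist (x (r n)) y < 1 / real (Suc j) / 2"
          using A(3)[OF x[of "r n"]] n(2) \<open>1 / real (Suc (r n)) \<le> 1 / real (Suc n)\<close> by (meson less_le_trans less_trans)
        then have "dist z y < 1 / real (Suc j)" using n(1) by (metis dist_commute dist_triangle_half_l)
        then show "y \<in> cball z (1 / real (Suc j))" by simp
      qed
      moreover have "bborel (cball z (1 / real (Suc j)))" by (auto simp: bborel_def)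
      ultimately have "measure \<mu> (A (r n)) \<le> measure \<mu> (cball z (1 / real (Suc j)))"
        using fin A(1)[of "r n"] sets_mu by (intro measure_mono_fmeasurable) (auto simp: fmeasurable_def)
      then show ?thesis using A(4)[of "r n"] by simp
    qed
    have "(\<lambda>j. emeasure \<mu> (cball z (1 / real (Suc j)))) \<longlonglongrightarrow> emeasure \<mu> (\<Inter>j. cball z (1 / real (Suc j)))"
    proof (rule Lim_emeasure_decseq)
      show "range (\<lambda>j. cball z (1 / real (Suc j))) \<subseteq> sets \<mu>" by (simp add: sets_mu image_subset_iff)
      show "decseq (\<lambda>j. cball z (1 / real (Suc j)))"
        by (rule decseq_SucI, rule subset_cball) (simp add: field_simps)
      show "emeasure \<mu> (cball z (1 / real (Suc j))) \<noteq> \<infinity>" for j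
        using fin[of "cball z (1 / real (Suc j))"] by (auto simp: bborel_def)
    qed
    moreover have "(\<Inter>j. cball z (1 / real (Suc j))) = {z}"
    proof -
      have "y = z" if "\<And>j. dist z y \<le> 1 / real (Suc j)" for y
      proof -
        have "dist z y \<le> 0"
          using LIMSEQ_le_const[OF lim_inverse_Suc, of "dist z y"] that by auto
        then show ?thesis by simp
      qed
      then show ?thesis by auto
    qed
    moreover have "emeasure \<mu> {z} = 0"
      using na sets_mu sets_eq_imp_space_eq[OF sets_mu] by (simp add: non_atomic_def)
    ultimately have "(\<lambda>j. emeasure \<mu> (cball z (1 / real (Suc j)))) \<longlonglongrightarrow> 0" by simp
    then have "eventually (\<lambda>j. emeasure \<mu> (cball z (1 / real (Suc j))) < ennreal p) sequentially"
      by (rule order_tendstoD(2)) (use p in simp)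
    then obtain j where "emeasure \<mu> (cball z (1 / real (Suc j))) < ennreal p"
      unfolding eventually_sequentially by auto
    moreover have "emeasure \<mu> (cball z (1 / real (Suc j))) = ennreal (measure \<mu> (cball z (1 / real (Suc j))))"
      using fin[of "cball z (1 / real (Suc j))"] by (intro emeasure_eq_ennreal_measure) (auto simp: bborel_def)
    ultimately show False using ball[of j] by (simp add: ennreal_less_iff)
  qed
  then show ?thesis using that by metis
qed

lemma prob_nonempty_le:
  assumes "bborel A" shows "prob {\<omega>\<in>space P. card (\<eta> \<omega> \<inter> A) \<noteq> 0} \<le> measure \<mu> A"
proof -
  have [measurable]: "(\<lambda>\<omega>. card (\<eta> \<omega> \<inter> A)) \<in> measurable P (count_space UNIV)"
    by (rule card_points_measurable[OF assms])
  have "prob {\<omega>\<in>space P. card (\<eta> \<omega> \<inter> A) \<noteq> 0} = 1 - prob {\<omega>\<in>space P. card (\<eta> \<omega> \<inter> A) = 0}"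
    by (subst prob_neg[symmetric]) auto
  also have "\<dots> = 1 - exp (- measure \<mu> A)" using prob_card_points[OF assms, of 0] by simp
  also have "\<dots> \<le> measure \<mu> A" using exp_ge_add_one_self[of "- measure \<mu> A"] by simp
  finally show ?thesis .
qed

lemma resample_empty_arg: "resample W g {} = (\<integral>\<omega>. g (\<eta> \<omega> \<inter> W) \<partial>P)"
  by (simp add: resample_def patch_def)

end

locale poisson_ustat = poisson_points P \<mu> \<eta> + local_kernel k f M \<rho> \<Theta> m
  for P :: "'w measure" and \<mu> :: "(real ^ 'd) measure" and \<eta> :: "'w \<Rightarrow> (real ^ 'd) set"
    and k and f :: "(nat \<Rightarrow> real ^ 'd) \<Rightarrow> real" and M \<rho> \<Theta> m +
  assumes na: "non_atomic \<mu>"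
begin

text \<open>A configuration lies in \<open>T n\<close> once the mesh is below its minimal distance,
  so \<open>h n\<close> converges pointwise to the desired certificate, and dominated convergence
  removes the partition.\<close>

lemma window_truncated:
  assumes W: "bborel W" and b: "0 < b" and l: "0 < l"
  defines "G \<equiv> \<lambda>\<omega>. min (F (\<eta> \<omega> \<inter> W)) b"
  shows "(\<integral>\<omega>. exp (l * G \<omega>) \<partial>P) \<le> exp (l * expectation G + l\<^sup>2 * proxy b / 2)"
    and "(\<integral>\<omega>. exp (- (l * G \<omega>)) \<partial>P) \<le> exp (- (l * expectation G) + l\<^sup>2 * proxy b / 2)"
proof -
  define g where "g = (\<lambda>S. l * min (F S) b)"
  have g_meas [measurable]: "g \<in> borel_measurable fin_config" unfolding g_def by measurable
  have g_bound: "0 \<le> g S" "g S \<le> l * b" for S using F_nonneg[of S] b l by (auto simp: g_def)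
  have tame_g: "tame g" by (rule tame_bounded[OF g_meas, where C="l * b"]) (use g_bound in auto)
  have incr_g: "incr g" unfolding incr_def g_def
  proof (intro allI impI)
    fix S T :: "(real ^ 'd) set" assume "finite T" "S \<subseteq> T"
    then have "F S \<le> F T" by (rule F_mono)
    then show "l * min (F S) b \<le> l * min (F T) b" using l by (intro mult_left_mono) auto
  qed
  define v where "v = l\<^sup>2 * proxy b / 2"
  have v: "0 \<le> v" using proxy_pos[OF b] by (simp add: v_def)
  have "\<exists>\<A>. cell_partition W (1 / real (Suc n)) \<A>" for n
    using cell_partition_exists[OF W, of "1 / real (Suc n)"] by (metis of_nat_0_less_iff zero_less_Suc zero_less_divide_1_iff)
  then obtain \<A> where "\<And>n. cell_partition W (1 / real (Suc n)) (\<A> n)" by metis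
  then have \<A>: "finite (\<A> n)" "disjoint (\<A> n)" "\<Union>(\<A> n) = W" "\<And>A. A \<in> \<A> n \<Longrightarrow> bborel A"
    "\<And>A x y. A \<in> \<A> n \<Longrightarrow> x \<in> A \<Longrightarrow> y \<in> A \<Longrightarrow> dist x y < 1 / real (Suc n)" for n
    unfolding cell_partition_def by blast+
  define T where "T = (\<lambda>n. {S\<in>space fin_config. \<forall>A\<in>\<A> n. card (S \<inter> A) \<le> 1})"
  have T [measurable]: "T n \<in> sets fin_config" for n
    unfolding T_def
  proof (intro sets.sets_Collect_finite_All \<A>(1))
    fix A assume "A \<in> \<A> n"
    then have [measurable]: "A \<in> sets borel" using \<A>(4) by auto
    show "{S \<in> space fin_config. card (S \<inter> A) \<le> 1} \<in> sets fin_config" by measurable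
  qed
  \<comment> \<open>Off \<open>T n\<close>, where some cell holds at least two points, this is
    \<open>- v\<close>, certified trivially because \<open>g\<close> is nonnegative.\<close>
  define h where "h = (\<lambda>n S. g S * indicator (T n) S - v)"
  have h_meas [measurable]: "h n \<in> borel_measurable fin_config" for n unfolding h_def by measurable
  have h_bound: "h n S \<le> l * b" "\<bar>h n S\<bar> \<le> l * b + v" for n S
    using g_bound[of S] v by (auto simp: h_def indicator_def)
  have tame_h: "tame (h n)" for n by (rule tame_bounded[OF h_meas, where C="l * b + v"]) (rule h_bound)
  have cert: "certified (\<A> n) g S (h n S)" if S: "finite S" for n S
  proof (cases "S \<in> T n")
    case True
    then show ?thesis
      using truncated_certified[OF S \<A>(1,2)[of n] _ b l] by (auto simp: h_def v_def g_def T_def)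
  next
    case False
    then show ?thesis unfolding certified_def using v g_bound
      by (intro exI[of _ 0] exI[of _ "\<lambda>_. 0"]) (auto simp: h_def)
  qed
  have conv: "(\<lambda>n. h n (\<eta> \<omega> \<inter> W)) \<longlonglongrightarrow> g (\<eta> \<omega> \<inter> W) - v" if \<omega>: "\<omega> \<in> space P" for \<omega>
  proof -
    have S: "finite (\<eta> \<omega> \<inter> W)" using \<omega> W by (rule finite_points')
    obtain \<delta> where \<delta>: "0 < \<delta>" "\<And>x y. x \<in> \<eta> \<omega> \<inter> W \<Longrightarrow> y \<in> \<eta> \<omega> \<inter> W \<Longrightarrow> dist x y < \<delta> \<Longrightarrow> x = y"
      using finite_separated[OF S] by metis
    have "eventually (\<lambda>n. 1 / real (Suc n) < \<delta>) sequentially"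
      using lim_inverse_Suc \<delta>(1) by (rule order_tendstoD(2))
    then have "eventually (\<lambda>n. h n (\<eta> \<omega> \<inter> W) = g (\<eta> \<omega> \<inter> W) - v) sequentially"
    proof eventually_elim
      case (elim n)
      have "card (\<eta> \<omega> \<inter> W \<inter> A) \<le> 1" if "A \<in> \<A> n" for A
        by (rule card_cell_le_1[OF S \<delta>(2) \<A>(5)[OF that]]) (use elim in auto)
      then have "\<eta> \<omega> \<inter> W \<in> T n" using S by (simp add: T_def)
      then show ?case by (simp add: h_def)
    qed
    then show ?thesis by (rule tendsto_eventually)
  qed
  have [measurable]: "(\<lambda>\<omega>. \<eta> \<omega> \<inter> W) \<in> measurable P fin_config" by (rule points_measurable[OF W])
  have int_bdd: "integrable P (\<lambda>\<omega>. \<phi> (\<eta> \<omega> \<inter> W))"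
    if "\<phi> \<in> borel_measurable fin_config" "\<And>S. \<bar>\<phi> S\<bar> \<le> (B::real)" for \<phi> B
    by (rule integrable_const_bound[of _ B]) (use that in \<open>auto intro!: measurable_compose[OF _ that(1)]\<close>)
  have gG: "g (\<eta> \<omega> \<inter> W) = l * G \<omega>" for \<omega> by (simp add: g_def G_def)
  have Wn: "\<Union>(\<A> n) = W" for n by (rule \<A>(3))
  have lim_int: "(\<lambda>n. \<integral>\<omega>. h n (\<eta> \<omega> \<inter> W) \<partial>P) \<longlonglongrightarrow> (\<integral>\<omega>. g (\<eta> \<omega> \<inter> W) - v \<partial>P)"
    by (rule integral_dominated_convergence[where w="\<lambda>_. l * b + v"])
      (use conv h_bound in \<open>auto intro!: measurable_compose[OF _ h_meas] measurable_compose[OF _ g_meas]\<close>)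
  have "resample W (\<lambda>S. exp (- g S)) {} \<le> exp (- resample W (h n) {})" for n
    using exp_minus_certified_le[OF \<A>(1)[of n] \<A>(4) \<A>(2)[of n] tame_g incr_g g_bound(1) tame_h[of n] cert[of _ n] finite.emptyI]
    by (simp add: Wn)
  then have "(\<integral>\<omega>. exp (- (l * G \<omega>)) \<partial>P) \<le> exp (- (\<integral>\<omega>. h n (\<eta> \<omega> \<inter> W) \<partial>P))" for n
    by (simp add: resample_empty_arg gG)
  moreover have "(\<lambda>n. exp (- (\<integral>\<omega>. h n (\<eta> \<omega> \<inter> W) \<partial>P))) \<longlonglongrightarrow> exp (- (\<integral>\<omega>. g (\<eta> \<omega> \<inter> W) - v \<partial>P))"
    by (intro tendsto_exp tendsto_minus lim_int)
  ultimately have "(\<integral>\<omega>. exp (- (l * G \<omega>)) \<partial>P) \<le> exp (- (\<integral>\<omega>. g (\<eta> \<omega> \<inter> W) - v \<partial>P))"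
    by (intro LIMSEQ_le_const) auto
  also have "(\<integral>\<omega>. g (\<eta> \<omega> \<inter> W) - v \<partial>P) = l * expectation G - v"
    using int_bdd[OF g_meas, of "l * b"] g_bound by (simp add: gG prob_space)
  finally show "(\<integral>\<omega>. exp (- (l * G \<omega>)) \<partial>P) \<le> exp (- (l * expectation G) + l\<^sup>2 * proxy b / 2)"
    by (simp add: v_def)
  have lim_exp: "(\<lambda>n. \<integral>\<omega>. exp (h n (\<eta> \<omega> \<inter> W)) \<partial>P) \<longlonglongrightarrow> (\<integral>\<omega>. exp (g (\<eta> \<omega> \<inter> W) - v) \<partial>P)"
  proof (rule integral_dominated_convergence[where w="\<lambda>_. exp (l * b)"])
    show "AE \<omega> in P. (\<lambda>n. exp (h n (\<eta> \<omega> \<inter> W))) \<longlonglongrightarrow> exp (g (\<eta> \<omega> \<inter> W) - v)"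
      by (intro AE_I2 tendsto_exp conv)
  qed (use h_bound in \<open>auto intro!: measurable_compose[OF _ h_meas] measurable_compose[OF _ g_meas] borel_measurable_exp borel_measurable_diff\<close>)
  have "resample W (\<lambda>S. exp (h n S)) {} \<le> exp (resample W g {})" for n
    using exp_certified_le[OF \<A>(1)[of n] \<A>(4) \<A>(2)[of n] tame_g incr_g h_meas[of n] h_bound(1) cert[of _ n] finite.emptyI]
    by (simp add: Wn)
  then have "(\<integral>\<omega>. exp (h n (\<eta> \<omega> \<inter> W)) \<partial>P) \<le> exp (l * expectation G)" for n
    by (simp add: resample_empty_arg gG)
  then have "(\<integral>\<omega>. exp (g (\<eta> \<omega> \<inter> W) - v) \<partial>P) \<le> exp (l * expectation G)"
    by (intro LIMSEQ_le_const2[OF lim_exp]) auto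
  then have "exp v * (\<integral>\<omega>. exp (g (\<eta> \<omega> \<inter> W) - v) \<partial>P) \<le> exp v * exp (l * expectation G)"
    by (intro mult_left_mono) auto
  also have "exp v * (\<integral>\<omega>. exp (g (\<eta> \<omega> \<inter> W) - v) \<partial>P) = (\<integral>\<omega>. exp (l * G \<omega>) \<partial>P)"
    by (simp add: gG flip: integral_mult_right_zero exp_add)
  finally show "(\<integral>\<omega>. exp (l * G \<omega>) \<partial>P) \<le> exp (l * expectation G + l\<^sup>2 * proxy b / 2)"
    by (simp add: v_def add.commute flip: exp_add)
qed

lemma integrable_window: "bborel W \<Longrightarrow> tame g \<Longrightarrow> integrable P (\<lambda>\<omega>. g (\<eta> \<omega> \<inter> W))"
  using integrable_patch[of g W "{}"] by (simp add: patch_def)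

text \<open>A partition into cells of measure at most \<open>p\<close> gives the bound with the
  variance divided by \<open>1 - p\<close>; then \<open>p\<close> tends to 0.\<close>

lemma window_lower:
  assumes W: "bborel W" and l: "0 < l"
  defines "X \<equiv> \<lambda>\<omega>. F (\<eta> \<omega> \<inter> W)"
  shows "(\<integral>\<omega>. exp (- (l * X \<omega>)) \<partial>P) \<le> exp (- (l * expectation X) + l\<^sup>2 / 2 * (real k * variance X))"
proof -
  have var: "var_on W F {} = variance X"
  proof -
    have "integrable P X" "integrable P (\<lambda>\<omega>. (X \<omega>)\<^sup>2)"
      unfolding X_def using integrable_window[OF W tame_F] integrable_window[OF W tame_power2[OF tame_F]] .
    then have "variance X = (\<integral>\<omega>. (X \<omega>)\<^sup>2 \<partial>P) - (expectation X)\<^sup>2" by (intro variance_eq)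
    then show ?thesis by (simp add: var_on_def resample_empty_arg X_def)
  qed
  have bound: "(\<integral>\<omega>. exp (- (l * X \<omega>)) \<partial>P) \<le> exp (- (l * expectation X) + l\<^sup>2 / 2 * (real k * variance X / (1 - p)))"
    if p: "0 < p" "p < 1" for p
  proof -
    obtain e where e: "0 < e" "\<And>A. bborel A \<Longrightarrow> A \<subseteq> W \<Longrightarrow> (\<And>x y. x \<in> A \<Longrightarrow> y \<in> A \<Longrightarrow> dist x y < e) \<Longrightarrow> measure \<mu> A \<le> p"
      using small_cells[OF W na p(1)] by metis
    obtain \<A> where "cell_partition W e \<A>" using cell_partition_exists[OF W e(1)] .
    then have \<A>: "finite \<A>" "disjoint \<A>" "\<Union>\<A> = W" "\<And>A. A \<in> \<A> \<Longrightarrow> bborel A"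
      "\<And>A x y. A \<in> \<A> \<Longrightarrow> x \<in> A \<Longrightarrow> y \<in> A \<Longrightarrow> dist x y < e"
      unfolding cell_partition_def by blast+
    have prob_le: "prob {\<omega>\<in>space P. card (\<eta> \<omega> \<inter> A) \<noteq> 0} \<le> p" if "A \<in> \<A>" for A
      using prob_nonempty_le[OF \<A>(4)[OF that]] e(2)[OF \<A>(4)[OF that] _ \<A>(5)[OF that]] \<A>(3) that
      by (meson Union_upper order_trans)
    define D where "D = (\<lambda>S. \<Sum>A\<in>\<A>. (F S - F (S - A))\<^sup>2)"
    have tame_D: "tame D" unfolding D_def
      using tame_F \<A>(4) by (intro tame_sum tame_power2 tame_diff tame_Diff) auto
    have ED: "resample W D {} \<le> real k * variance X / (1 - p)"
      using sum_sq_diff_le_var[OF \<A>(1) \<A>(4) \<A>(2) degree_F tame_F finite.emptyI p prob_le] p \<A>(3)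
      by (simp add: D_def var field_simps)
    have "resample W (\<lambda>S. exp (- (l * F S))) {} \<le> exp (- resample W (\<lambda>S. l * F S - l\<^sup>2 / 2 * D S) {})"
    proof -
      have "resample (\<Union>\<A>) (\<lambda>S. exp (- (l * F S))) {} \<le> exp (- resample (\<Union>\<A>) (\<lambda>S. l * F S - l\<^sup>2 / 2 * D S) {})"
      proof (rule exp_minus_certified_le[OF \<A>(1) \<A>(4) \<A>(2)])
        show "tame (\<lambda>S. l * F S)" by (rule tame_cmult[OF tame_F])
        show "incr (\<lambda>S. l * F S)" using incr_F l by (auto simp: incr_def)
        show "tame (\<lambda>S. l * F S - l\<^sup>2 / 2 * D S)" by (intro tame_diff tame_cmult tame_F tame_D)
        show "certified \<A> (\<lambda>S. l * F S) S (l * F S - l\<^sup>2 / 2 * D S)" if "finite S" for S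
          unfolding D_def by (rule F_certified[OF that \<A>(1) l])
      qed (use F_nonneg l in auto)
      then show ?thesis by (simp add: \<A>(3))
    qed
    also have "resample W (\<lambda>S. l * F S - l\<^sup>2 / 2 * D S) {} = l * resample W F {} - l\<^sup>2 / 2 * resample W D {}"
      using resample_diff[OF tame_cmult[OF tame_F] tame_cmult[OF tame_D] W, of "{}" l "l\<^sup>2 / 2"]
      unfolding resample_cmult by simp
    finally have "(\<integral>\<omega>. exp (- (l * X \<omega>)) \<partial>P) \<le> exp (- (l * expectation X) + l\<^sup>2 / 2 * resample W D {})"
      by (simp add: resample_empty_arg X_def)
    also have "\<dots> \<le> exp (- (l * expectation X) + l\<^sup>2 / 2 * (real k * variance X / (1 - p)))"
      unfolding exp_le_cancel_iff by (intro add_left_mono mult_left_mono ED) auto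
    finally show ?thesis .
  qed
  have lim: "(\<lambda>n. exp (- (l * expectation X) + l\<^sup>2 / 2 * (real k * variance X / (1 - 1 / real (Suc n)))))
      \<longlonglongrightarrow> exp (- (l * expectation X) + l\<^sup>2 / 2 * (real k * variance X / (1 - 0)))"
    by (intro tendsto_intros lim_inverse_Suc) auto
  \<comment> \<open>The index starts at 1 to keep \<open>1 / real (Suc n)\<close> below 1.\<close>
  have ex: "\<exists>N. \<forall>n\<ge>N. (\<integral>\<omega>. exp (- (l * X \<omega>)) \<partial>P) \<le>
      exp (- (l * expectation X) + l\<^sup>2 / 2 * (real k * variance X / (1 - 1 / real (Suc n))))"
    by (rule exI[of _ 1], intro allI impI bound) (auto simp: field_simps)
  show ?thesis using LIMSEQ_le_const[OF lim ex] by simp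
qed

end

section \<open>Tail bounds\<close>

lemma power_div_fact_le_exp:
  fixes x :: real assumes "0 \<le> x" shows "x ^ n / fact n \<le> exp x"
proof -
  have "(\<Sum>i\<in>{n}. x ^ i /\<^sub>R fact i) \<le> (\<Sum>i. x ^ i /\<^sub>R fact i)"
    using assms by (intro sum_le_suminf summable_exp_generic) auto
  then show ?thesis by (simp add: exp_def divide_inverse mult.commute)
qed

context prob_space
begin

lemma prob_ge_le_exp:
  assumes [measurable]: "X \<in> borel_measurable M" and int: "integrable M (\<lambda>x. exp (l * X x))" and l: "0 \<le> l"
  shows "prob {x\<in>space M. a \<le> X x} \<le> exp (- (l * a)) * expectation (\<lambda>x. exp (l * X x))"
proof -
  have "prob {x\<in>space M. a \<le> X x} = expectation (indicator {x\<in>space M. a \<le> X x})" by simp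
  also have "\<dots> \<le> expectation (\<lambda>x. exp (- (l * a)) * exp (l * X x))"
  proof (rule integral_mono)
    show "integrable M (indicator {x\<in>space M. a \<le> X x} :: 'a \<Rightarrow> real)"
      by (intro integrable_real_indicator) (auto simp: less_top[symmetric])
    show "integrable M (\<lambda>x. exp (- (l * a)) * exp (l * X x))" by (intro integrable_mult_right int)
    fix x assume "x \<in> space M"
    show "indicator {x\<in>space M. a \<le> X x} x \<le> exp (- (l * a)) * exp (l * X x)"
    proof (cases "a \<le> X x")
      case True
      then have "l * a \<le> l * X x" using l by (rule mult_left_mono)
      then have "1 \<le> exp (- (l * a)) * exp (l * X x)" by (simp flip: exp_add)
      then show ?thesis by (simp add: indicator_def)
    qed (simp add: indicator_def)
  qed
  finally show ?thesis by simp
qed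

lemma prob_le_le_exp:
  assumes "X \<in> borel_measurable M" and "integrable M (\<lambda>x. exp (- (l * X x)))" and "0 \<le> l"
  shows "prob {x\<in>space M. X x \<le> a} \<le> exp (l * a) * expectation (\<lambda>x. exp (- (l * X x)))"
  using prob_ge_le_exp[of "\<lambda>x. - X x" l "- a"] assms by simp

lemma subgaussian_tail:
  assumes X: "X \<in> borel_measurable M" and v: "0 < v" and s: "0 \<le> s"
    and int: "\<And>l. 0 < l \<Longrightarrow> integrable M (\<lambda>x. exp (l * X x))"
    and le: "\<And>l. 0 < l \<Longrightarrow> expectation (\<lambda>x. exp (l * X x)) \<le> exp (l * a + l\<^sup>2 * v / 2)"
  shows "prob {x\<in>space M. a + s \<le> X x} \<le> exp (- (s\<^sup>2 / (2 * v)))"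
proof (cases "s = 0")
  case False
  \<comment> \<open>Minimises the exponent \<open>l\<^sup>2 * v / 2 - l * s\<close>; it is positive
    because \<open>s = 0\<close> has been set aside.\<close>
  define l where "l = s / v"
  have l: "0 < l" using False s v by (simp add: l_def)
  have "prob {x\<in>space M. a + s \<le> X x} \<le> exp (- (l * (a + s))) * expectation (\<lambda>x. exp (l * X x))"
    using l by (intro prob_ge_le_exp X int) auto
  also have "\<dots> \<le> exp (- (l * (a + s))) * exp (l * a + l\<^sup>2 * v / 2)"
    by (intro mult_left_mono le l) auto
  also have "\<dots> = exp (l\<^sup>2 * v / 2 - l * s)" by (simp add: algebra_simps flip: exp_add)
  also have "l\<^sup>2 * v / 2 - l * s = - (s\<^sup>2 / (2 * v))" using v by (simp add: l_def field_simps power2_eq_square)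
  finally show ?thesis .
qed simp

text \<open>Integer levels are summed. Half of the decay rate \<open>\<delta>\<close> absorbs the
  factor \<open>real (Suc j) ^ N\<close>, the other half leaves a geometric series.\<close>

lemma integrable_power_of_exponential_tail:
  fixes Y :: "'a \<Rightarrow> real"
  assumes [measurable]: "Y \<in> borel_measurable M" and nonneg: "\<And>x. 0 \<le> Y x"
    and \<delta>: "0 < \<delta>" and tail: "\<And>j::nat. prob {x\<in>space M. real j < Y x} \<le> C * exp (- (\<delta> * real j))"
  shows "integrable M (\<lambda>x. Y x ^ N)"
proof (rule integrableI_nonneg)
  show "(\<lambda>x. Y x ^ N) \<in> borel_measurable M" by measurable
  show "AE x in M. 0 \<le> Y x ^ N" using nonneg by simp
  have "0 \<le> prob {x\<in>space M. real 0 < Y x}" by simp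
  also have "\<dots> \<le> C" using tail[of 0] by simp
  finally have C: "0 \<le> C" .
  define D where "D = fact N / (\<delta> / 2) ^ N"
  have D: "0 \<le> D" using \<delta> by (simp add: D_def)
  have pow: "y ^ N \<le> D * exp (\<delta> / 2 * y)" if "0 \<le> y" for y :: real
    using power_div_fact_le_exp[of "\<delta> / 2 * y" N] that \<delta> by (simp add: D_def power_mult_distrib field_simps)
  \<comment> \<open>A value \<open>Y x = 0\<close> exceeds no level \<open>j\<close>; the summand
    \<open>0 ^ N\<close> accounts for it and is 1 when \<open>N = 0\<close>.\<close>
  have "(\<integral>\<^sup>+x. ennreal (Y x ^ N) \<partial>M) \<le>
     (\<integral>\<^sup>+x. ennreal (0 ^ N) + (\<Sum>j. ennreal (real (Suc j) ^ N) * indicator {x\<in>space M. real j < Y x} x) \<partial>M)"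
  proof (rule nn_integral_mono)
    fix x assume x: "x \<in> space M"
    show "ennreal (Y x ^ N) \<le> ennreal (0 ^ N) + (\<Sum>j. ennreal (real (Suc j) ^ N) * indicator {x\<in>space M. real j < Y x} x)"
    proof (cases "Y x = 0")
      case False
      define j where "j = nat (\<lceil>Y x\<rceil> - 1)"
      have "0 < Y x" using False nonneg[of x] by simp
      then have j: "real j < Y x" "Y x \<le> real (Suc j)" unfolding j_def by linarith+
      define h where "h = (\<lambda>j. ennreal (real (Suc j) ^ N) * indicator {x\<in>space M. real j < Y x} x)"
      have "ennreal (Y x ^ N) \<le> h j"
        using j x nonneg[of x] by (auto simp: h_def intro!: ennreal_leI power_mono simp del: of_nat_Suc)
      also have "\<dots> \<le> (\<Sum>j. h j)" using sum_le_suminf[of h "{j}"] by simp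
      also have "\<dots> = (\<Sum>j. ennreal (real (Suc j) ^ N) * indicator {x\<in>space M. real j < Y x} x)"
        by (simp only: h_def)
      finally show ?thesis by (rule order_trans) simp
    qed simp
  qed
  also have "\<dots> = ennreal (0 ^ N) + (\<Sum>j. ennreal (real (Suc j) ^ N) * emeasure M {x\<in>space M. real j < Y x})"
    by (simp add: nn_integral_add nn_integral_suminf nn_integral_cmult emeasure_space_1)
  also have "\<dots> \<le> ennreal (0 ^ N) + (\<Sum>j. ennreal (D * exp (\<delta> / 2) * C * exp (- (\<delta> / 2)) ^ j))"
  proof (intro add_left_mono suminf_le summableI)
    fix j
    have "real (Suc j) ^ N * prob {x\<in>space M. real j < Y x} \<le> (D * exp (\<delta> / 2 * real (Suc j))) * (C * exp (- (\<delta> * real j)))"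
      using pow[of "real (Suc j)"] tail[of j] D by (intro mult_mono) auto
    also have "\<dots> = D * exp (\<delta> / 2) * C * exp (- (\<delta> / 2)) ^ j"
    proof -
      have "exp (\<delta> / 2 * real (Suc j)) * exp (- (\<delta> * real j)) = exp (\<delta> / 2) * exp (- (\<delta> / 2)) ^ j"
        unfolding exp_of_nat_mult[symmetric] exp_add[symmetric]
        by (rule arg_cong[where f=exp]) (simp add: field_simps)
      then show ?thesis by (metis (no_types, lifting) mult.assoc mult.commute)
    qed
    finally show "ennreal (real (Suc j) ^ N) * emeasure M {x\<in>space M. real j < Y x} \<le> ennreal (D * exp (\<delta> / 2) * C * exp (- (\<delta> / 2)) ^ j)"
      by (simp add: emeasure_eq_measure ennreal_leI del: of_nat_Suc flip: ennreal_mult)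
  qed
  also have "\<dots> < \<infinity>"
  proof -
    have "summable (\<lambda>j. D * exp (\<delta> / 2) * C * exp (- (\<delta> / 2)) ^ j)"
      using \<delta> by (intro summable_mult summable_geometric) auto
    then show ?thesis using D C by (subst suminf_ennreal2) auto
  qed
  finally show "(\<integral>\<^sup>+x. ennreal (Y x ^ N) \<partial>M) < \<infinity>" .
qed

section \<open>The smallest median\<close>

context
  fixes Z :: "'a \<Rightarrow> real"
  assumes Z [measurable]: "Z \<in> borel_measurable M" and Z_nonneg: "\<And>x. 0 \<le> Z x"
begin

lemma prob_le_mono: "x \<le> y \<Longrightarrow> prob {\<omega>\<in>space M. Z \<omega> \<le> x} \<le> prob {\<omega>\<in>space M. Z \<omega> \<le> y}"
  by (intro finite_measure_mono) auto

lemma median_set: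
  "{x. 1 / 2 \<le> prob {\<omega>\<in>space M. Z \<omega> \<le> x}} \<noteq> {}" (is "?A \<noteq> {}")
  "x \<in> {x. 1 / 2 \<le> prob {\<omega>\<in>space M. Z \<omega> \<le> x}} \<Longrightarrow> 0 \<le> x"
proof -
  have "(\<lambda>n. prob {\<omega>\<in>space M. Z \<omega> \<le> real n}) \<longlonglongrightarrow> prob (\<Union>n. {\<omega>\<in>space M. Z \<omega> \<le> real n})"
    by (rule finite_Lim_measure_incseq) (auto simp: incseq_def)
  also have "(\<Union>n. {\<omega>\<in>space M. Z \<omega> \<le> real n}) = space M" using real_arch_simple by auto
  finally have "(\<lambda>n. prob {\<omega>\<in>space M. Z \<omega> \<le> real n}) \<longlonglongrightarrow> 1" by (simp add: prob_space)
  then have "eventually (\<lambda>n. 1 / 2 < prob {\<omega>\<in>space M. Z \<omega> \<le> real n}) sequentially"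
    by (rule order_tendstoD) simp
  then obtain n where "1 / 2 < prob {\<omega>\<in>space M. Z \<omega> \<le> real n}" unfolding eventually_sequentially by auto
  then show "?A \<noteq> {}" by (auto intro!: exI[of _ "real n"])
next
  assume x: "x \<in> ?A"
  show "0 \<le> x"
  proof (rule ccontr)
    assume "\<not> 0 \<le> x"
    then have "\<not> Z \<omega> \<le> x" for \<omega> using Z_nonneg[of \<omega>] by linarith
    then have "{\<omega>\<in>space M. Z \<omega> \<le> x} = {}" by blast
    then show False using x by (simp only: measure_empty mem_Collect_eq)
  qed
qed

lemma median_nonneg: "0 \<le> smallest_median M Z"
  unfolding smallest_median_def using median_set by (intro cInf_greatest) auto

text \<open>Right-continuity of the distribution function: the infimum is attained.\<close>

lemma prob_le_median: "1 / 2 \<le> prob {\<omega>\<in>space M. Z \<omega> \<le> smallest_median M Z}"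
proof -
  let ?m = "smallest_median M Z"
  have ge: "1 / 2 \<le> prob {\<omega>\<in>space M. Z \<omega> \<le> ?m + 1 / real (Suc n)}" for n
  proof -
    have "?m < ?m + 1 / real (Suc n)" by simp
    then obtain x where x: "1 / 2 \<le> prob {\<omega>\<in>space M. Z \<omega> \<le> x}" "x < ?m + 1 / real (Suc n)"
      using cInf_lessD[OF median_set(1)] unfolding smallest_median_def by blast
    then show ?thesis using prob_le_mono[of x "?m + 1 / real (Suc n)"] by linarith
  qed
  have lim: "(\<lambda>n. prob {\<omega>\<in>space M. Z \<omega> \<le> ?m + 1 / real (Suc n)}) \<longlonglongrightarrow>
     prob (\<Inter>n. {\<omega>\<in>space M. Z \<omega> \<le> ?m + 1 / real (Suc n)})"
    by (rule finite_Lim_measure_decseq) (auto simp: decseq_def frac_le intro: order_trans)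
  have eq: "(\<Inter>n. {\<omega>\<in>space M. Z \<omega> \<le> ?m + 1 / real (Suc n)}) = {\<omega>\<in>space M. Z \<omega> \<le> ?m}"
  proof -
    have "Z \<omega> \<le> ?m" if "\<And>n. Z \<omega> \<le> ?m + 1 / real (Suc n)" for \<omega>
      using LIMSEQ_le_const[OF tendsto_add[OF tendsto_const[of ?m] lim_inverse_Suc], of "Z \<omega>"] that by auto
    then show ?thesis by (auto intro: order_trans)
  qed
  show ?thesis by (rule LIMSEQ_le_const[OF lim[unfolded eq]]) (use ge in blast)
qed

text \<open>Levels below the infimum are reached with probability at most 1/2; letting them increase
  bounds the probability that \<open>Z\<close> lies strictly below its median, and the complement is
  taken.\<close>

lemma prob_ge_median: "1 / 2 \<le> prob {\<omega>\<in>space M. smallest_median M Z \<le> Z \<omega>}"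
proof -
  let ?m = "smallest_median M Z"
  have le: "prob {\<omega>\<in>space M. Z \<omega> \<le> ?m - 1 / real (Suc n)} \<le> 1 / 2" for n
  proof (rule ccontr)
    assume "\<not> ?thesis"
    then have "?m \<le> ?m - 1 / real (Suc n)"
      using median_set(2) unfolding smallest_median_def[of M Z] by (intro cInf_lower bdd_belowI[of _ 0]) auto
    then show False by simp
  qed
  have lim: "(\<lambda>n. prob {\<omega>\<in>space M. Z \<omega> \<le> ?m - 1 / real (Suc n)}) \<longlonglongrightarrow>
     prob (\<Union>n. {\<omega>\<in>space M. Z \<omega> \<le> ?m - 1 / real (Suc n)})"
    by (rule finite_Lim_measure_incseq) (auto simp: incseq_def frac_le intro: order_trans)
  have eq: "(\<Union>n. {\<omega>\<in>space M. Z \<omega> \<le> ?m - 1 / real (Suc n)}) = {\<omega>\<in>space M. Z \<omega> < ?m}"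
  proof -
    have "\<exists>n. Z \<omega> \<le> ?m - 1 / real (Suc n)" if less: "Z \<omega> < ?m" for \<omega>
    proof -
      obtain n where "inverse (real (Suc n)) < ?m - Z \<omega>" using less reals_Archimedean[of "?m - Z \<omega>"] by auto
      then show ?thesis by (intro exI[of _ n]) (simp add: inverse_eq_divide)
    qed
    moreover have "Z \<omega> < ?m" if "Z \<omega> \<le> ?m - 1 / real (Suc n)" for \<omega> n
    proof -
      have "0 < 1 / real (Suc n)" by simp
      then show ?thesis using that by linarith
    qed
    ultimately show ?thesis by blast
  qed
  have "prob {\<omega>\<in>space M. Z \<omega> < ?m} \<le> 1 / 2"
    by (rule LIMSEQ_le_const2[OF lim[unfolded eq]]) (use le in blast)
  moreover have "prob {\<omega>\<in>space M. Z \<omega> < ?m} = 1 - prob {\<omega>\<in>space M. ?m \<le> Z \<omega>}"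
    by (subst prob_neg[symmetric]) (auto simp: not_le)
  ultimately show ?thesis by simp
qed

end

end

section \<open>Passage to the whole space and the four tail bounds\<close>

context poisson_ustat
begin

definition Z :: "'w \<Rightarrow> real" where "Z \<omega> = enn2real (u_statistic k f (\<eta> \<omega>))"

definition X :: "nat \<Rightarrow> 'w \<Rightarrow> real" where "X n \<omega> = F (\<eta> \<omega> \<inter> cball 0 (real n))"

lemma bborel_cball: "bborel (cball 0 (real n) :: (real ^ 'd) set)"
  by (simp add: bborel_def)

lemma X_measurable [measurable]: "X n \<in> borel_measurable P"
  unfolding X_def by (intro measurable_compose[OF points_measurable[OF bborel_cball] F_measurable])

lemma X_nonneg: "0 \<le> X n \<omega>"
  by (simp add: X_def F_nonneg)

lemma X_mono: "\<omega> \<in> space P \<Longrightarrow> i \<le> j \<Longrightarrow> X i \<omega> \<le> X j \<omega>"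
  unfolding X_def by (intro F_mono finite_points'[OF _ bborel_cball]) auto

lemma u_statistic_SUP: "\<omega> \<in> space P \<Longrightarrow> u_statistic k f (\<eta> \<omega>) = (SUP n. ennreal (X n \<omega>))"
  unfolding X_def
proof (rule u_statistic_eq_SUP)
  assume "\<omega> \<in> space P"
  then show "finite (\<eta> \<omega> \<inter> cball 0 (real n))" for n by (rule finite_points'[OF _ bborel_cball])
  show "incseq (\<lambda>n. cball (0 :: real ^ 'd) (real n))" by (auto simp: incseq_def intro!: subset_cball)
  show "(\<Union>n. cball (0 :: real ^ 'd) (real n)) = UNIV" using real_arch_simple by auto
qed (rule f_nonneg)

lemma Z_measurable [measurable]: "Z \<in> borel_measurable P"
proof -
  have "(\<lambda>\<omega>. enn2real (SUP n. ennreal (X n \<omega>))) \<in> borel_measurable P" by measurable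
  also have "?this \<longleftrightarrow> ?thesis" by (intro measurable_cong) (simp add: Z_def u_statistic_SUP)
  finally show ?thesis .
qed

lemma Z_nonneg: "0 \<le> Z \<omega>"
  by (simp add: Z_def)

context
  assumes fin: "AE \<omega> in P. u_statistic k f (\<eta> \<omega>) < \<infinity>"
begin

lemma X_tendsto: "AE \<omega> in P. (\<lambda>n. X n \<omega>) \<longlonglongrightarrow> Z \<omega> \<and> (\<forall>n. X n \<omega> \<le> Z \<omega>)"
proof (rule AE_mp[OF fin], rule AE_I2, rule impI)
  fix \<omega> assume \<omega>: "\<omega> \<in> space P" and "u_statistic k f (\<eta> \<omega>) < \<infinity>"
  then have "u_statistic k f (\<eta> \<omega>) = ennreal (Z \<omega>)" by (simp add: Z_def)
  moreover have "(\<lambda>n. ennreal (X n \<omega>)) \<longlonglongrightarrow> (SUP n. ennreal (X n \<omega>))"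
    using X_mono[OF \<omega>] by (intro LIMSEQ_SUP) (auto simp: incseq_def intro: ennreal_leI)
  ultimately have "(\<lambda>n. ennreal (X n \<omega>)) \<longlonglongrightarrow> ennreal (Z \<omega>)" by (simp add: u_statistic_SUP[OF \<omega>])
  then have lim: "(\<lambda>n. X n \<omega>) \<longlonglongrightarrow> Z \<omega>"
    by (rule tendsto_ennrealD) (auto simp: X_nonneg Z_nonneg)
  moreover have "X n \<omega> \<le> Z \<omega>" for n
    using X_mono[OF \<omega>] by (intro incseq_le[OF _ lim]) (auto simp: incseq_def)
  ultimately show "(\<lambda>n. X n \<omega>) \<longlonglongrightarrow> Z \<omega> \<and> (\<forall>n. X n \<omega> \<le> Z \<omega>)" by simp
qed

lemma expectation_limit:
  fixes \<phi> :: "real \<Rightarrow> real"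
  assumes \<phi>: "continuous_on UNIV \<phi>" and w: "integrable P w"
    and bound: "\<And>n. AE \<omega> in P. \<bar>\<phi> (X n \<omega>)\<bar> \<le> w \<omega>"
  shows "(\<lambda>n. \<integral>\<omega>. \<phi> (X n \<omega>) \<partial>P) \<longlonglongrightarrow> (\<integral>\<omega>. \<phi> (Z \<omega>) \<partial>P)"
proof (rule integral_dominated_convergence[where w=w])
  have [measurable]: "\<phi> \<in> borel_measurable borel" using \<phi> by (rule borel_measurable_continuous_onI)
  show "(\<lambda>\<omega>. \<phi> (Z \<omega>)) \<in> borel_measurable P" "(\<lambda>\<omega>. \<phi> (X n \<omega>)) \<in> borel_measurable P" for n by measurable
  show "AE \<omega> in P. (\<lambda>n. \<phi> (X n \<omega>)) \<longlonglongrightarrow> \<phi> (Z \<omega>)"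
    using X_tendsto
  proof eventually_elim
    case (elim \<omega>)
    then show ?case using \<phi> by (intro continuous_on_tendsto_compose[OF \<phi>]) auto
  qed
  show "AE \<omega> in P. norm (\<phi> (X n \<omega>)) \<le> w \<omega>" for n using bound[of n] by simp
qed (rule w)

lemma truncated:
  assumes b: "0 < b" and l: "0 < l"
  defines "G \<equiv> \<lambda>\<omega>. min (Z \<omega>) b"
  shows "(\<integral>\<omega>. exp (l * G \<omega>) \<partial>P) \<le> exp (l * expectation G + l\<^sup>2 * proxy b / 2)"
    and "(\<integral>\<omega>. exp (- (l * G \<omega>)) \<partial>P) \<le> exp (- (l * expectation G) + l\<^sup>2 * proxy b / 2)"
proof -
  have G: "(\<lambda>n. \<integral>\<omega>. min (X n \<omega>) b \<partial>P) \<longlonglongrightarrow> expectation G"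
    unfolding G_def using b X_nonneg
    by (intro expectation_limit[where w="\<lambda>_. b"] continuous_intros) auto
  have up: "(\<lambda>n. \<integral>\<omega>. exp (l * min (X n \<omega>) b) \<partial>P) \<longlonglongrightarrow> (\<integral>\<omega>. exp (l * G \<omega>) \<partial>P)"
    unfolding G_def using l
    by (intro expectation_limit[where w="\<lambda>_. exp (l * b)" and \<phi>="\<lambda>x. exp (l * min x b)"] continuous_intros) auto
  have lo: "(\<lambda>n. \<integral>\<omega>. exp (- (l * min (X n \<omega>) b)) \<partial>P) \<longlonglongrightarrow> (\<integral>\<omega>. exp (- (l * G \<omega>)) \<partial>P)"
    unfolding G_def using b l X_nonneg
    by (intro expectation_limit[where w="\<lambda>_. 1" and \<phi>="\<lambda>x. exp (- (l * min x b))"] continuous_intros) auto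
  show "(\<integral>\<omega>. exp (l * G \<omega>) \<partial>P) \<le> exp (l * expectation G + l\<^sup>2 * proxy b / 2)"
    by (rule LIMSEQ_le[OF up tendsto_exp[OF tendsto_add[OF tendsto_mult[OF tendsto_const G] tendsto_const]]])
      (use window_truncated(1)[OF bborel_cball b l] in \<open>auto simp: X_def\<close>)
  show "(\<integral>\<omega>. exp (- (l * G \<omega>)) \<partial>P) \<le> exp (- (l * expectation G) + l\<^sup>2 * proxy b / 2)"
    by (rule LIMSEQ_le[OF lo tendsto_exp[OF tendsto_add[OF tendsto_minus[OF tendsto_mult[OF tendsto_const G]] tendsto_const]]])
      (use window_truncated(2)[OF bborel_cball b l] in \<open>auto simp: X_def\<close>)
qed

lemma integrable_exp_truncated:
  assumes "0 < b" "0 \<le> l"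
  shows "integrable P (\<lambda>\<omega>. exp (l * min (Z \<omega>) b))" "integrable P (\<lambda>\<omega>. exp (- (l * min (Z \<omega>) b)))"
proof -
  have [measurable]: "(\<lambda>\<omega>. min (Z \<omega>) b) \<in> borel_measurable P" by measurable
  show "integrable P (\<lambda>\<omega>. exp (l * min (Z \<omega>) b))"
    by (rule integrable_const_bound[of _ "exp (l * b)"]) (use assms in \<open>auto intro!: AE_I2 mult_left_mono\<close>)
  show "integrable P (\<lambda>\<omega>. exp (- (l * min (Z \<omega>) b)))"
    by (rule integrable_const_bound[of _ 1]) (use assms Z_nonneg in auto)
qed

text \<open>Two Chernoff bounds with the same parameter are multiplied, and the mean of the
  truncated variable cancels. In this way the median is treated without being compared with the
  mean.\<close>

lemma prob_truncated_le:
  assumes b: "0 < b" and s: "0 \<le> s"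
  shows "prob {\<omega>\<in>space P. min (Z \<omega>) b \<le> a} * prob {\<omega>\<in>space P. a + s \<le> min (Z \<omega>) b} \<le> exp (- (s\<^sup>2 / (4 * proxy b)))"
proof (cases "s = 0")
  case True
  then show ?thesis by (simp add: mult_le_one)
next
  case False
  define v where "v = proxy b"
  have v: "0 < v" using proxy_pos[OF b] by (simp add: v_def)
  \<comment> \<open>The exponents add up to \<open>l\<^sup>2 * v - l * s\<close>, which is least
    here, with value \<open>- (s\<^sup>2 / (4 * v))\<close>; hence the 4 in the bounds at the
    median.\<close>
  define l where "l = s / (2 * v)"
  have l: "0 < l" using False s v by (simp add: l_def)
  let ?G = "\<lambda>\<omega>. min (Z \<omega>) b"
  let ?E = "\<integral>\<omega>. ?G \<omega> \<partial>P"
  have "prob {\<omega>\<in>space P. ?G \<omega> \<le> a} * prob {\<omega>\<in>space P. a + s \<le> ?G \<omega>}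
    \<le> (exp (l * a) * exp (- (l * ?E) + l\<^sup>2 * v / 2)) * (exp (- (l * (a + s))) * exp (l * ?E + l\<^sup>2 * v / 2))"
  proof (rule mult_mono)
    have "prob {\<omega>\<in>space P. ?G \<omega> \<le> a} \<le> exp (l * a) * expectation (\<lambda>\<omega>. exp (- (l * ?G \<omega>)))"
      using l integrable_exp_truncated[OF b] by (intro prob_le_le_exp) auto
    also have "\<dots> \<le> exp (l * a) * exp (- (l * ?E) + l\<^sup>2 * v / 2)"
      unfolding v_def by (intro mult_left_mono truncated(2) b l) auto
    finally show "prob {\<omega>\<in>space P. ?G \<omega> \<le> a} \<le> exp (l * a) * exp (- (l * ?E) + l\<^sup>2 * v / 2)" .
    have "prob {\<omega>\<in>space P. a + s \<le> ?G \<omega>} \<le> exp (- (l * (a + s))) * expectation (\<lambda>\<omega>. exp (l * ?G \<omega>))"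
      using l integrable_exp_truncated[OF b] by (intro prob_ge_le_exp) auto
    also have "\<dots> \<le> exp (- (l * (a + s))) * exp (l * ?E + l\<^sup>2 * v / 2)"
      unfolding v_def by (intro mult_left_mono truncated(1) b l) auto
    finally show "prob {\<omega>\<in>space P. a + s \<le> ?G \<omega>} \<le> exp (- (l * (a + s))) * exp (l * ?E + l\<^sup>2 * v / 2)" .
  qed auto
  also have "\<dots> = exp (l\<^sup>2 * v - l * s)" by (simp add: algebra_simps flip: exp_add)
  also have "l\<^sup>2 * v - l * s = - (s\<^sup>2 / (4 * v))" using v by (simp add: l_def field_simps power2_eq_square)
  finally show ?thesis by (simp add: v_def)
qed

lemma prob_truncated_mean:
  assumes b: "0 < b" and s: "0 \<le> s"
  shows "prob {\<omega>\<in>space P. expectation (\<lambda>\<omega>. min (Z \<omega>) b) + s \<le> min (Z \<omega>) b} \<le> exp (- (s\<^sup>2 / (2 * proxy b)))"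
  by (rule subgaussian_tail[OF _ proxy_pos[OF b] s])
    (auto intro: integrable_exp_truncated(1)[OF b] truncated(1)[OF b])

text \<open>Both events survive truncation at the level that is to be exceeded, and the proxy then
  involves this level only. The factor 2 is the reciprocal of the probability 1/2 on the other side
  of the median.\<close>

lemma upper_tail_median:
  assumes "0 \<le> r" "0 < smallest_median P Z + r"
  shows "prob {\<omega>\<in>space P. smallest_median P Z + r < Z \<omega>} \<le> 2 * exp (- (r\<^sup>2 / (4 * proxy (smallest_median P Z + r))))"
proof -
  let ?m = "smallest_median P Z"
  have "1 / 2 * prob {\<omega>\<in>space P. ?m + r < Z \<omega>} \<le>
      prob {\<omega>\<in>space P. min (Z \<omega>) (?m + r) \<le> ?m} * prob {\<omega>\<in>space P. ?m + r \<le> min (Z \<omega>) (?m + r)}"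
  proof (rule mult_mono)
    have "1 / 2 \<le> prob {\<omega>\<in>space P. Z \<omega> \<le> ?m}" using Z_nonneg by (intro prob_le_median) auto
    also have "\<dots> \<le> prob {\<omega>\<in>space P. min (Z \<omega>) (?m + r) \<le> ?m}" by (intro finite_measure_mono) auto
    finally show "1 / 2 \<le> prob {\<omega>\<in>space P. min (Z \<omega>) (?m + r) \<le> ?m}" .
    show "prob {\<omega>\<in>space P. ?m + r < Z \<omega>} \<le> prob {\<omega>\<in>space P. ?m + r \<le> min (Z \<omega>) (?m + r)}"
      by (intro finite_measure_mono) auto
  qed auto
  also have "\<dots> \<le> exp (- (r\<^sup>2 / (4 * proxy (?m + r))))" using assms by (intro prob_truncated_le) auto
  finally show ?thesis by simp
qed

lemma lower_tail_median:
  assumes "0 \<le> r" "0 < smallest_median P Z"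
  shows "prob {\<omega>\<in>space P. Z \<omega> < smallest_median P Z - r} \<le> 2 * exp (- (r\<^sup>2 / (4 * proxy (smallest_median P Z))))"
proof -
  let ?m = "smallest_median P Z"
  have "prob {\<omega>\<in>space P. Z \<omega> < ?m - r} * (1 / 2) \<le>
      prob {\<omega>\<in>space P. min (Z \<omega>) ?m \<le> ?m - r} * prob {\<omega>\<in>space P. (?m - r) + r \<le> min (Z \<omega>) ?m}"
  proof (rule mult_mono)
    have "1 / 2 \<le> prob {\<omega>\<in>space P. ?m \<le> Z \<omega>}" using Z_nonneg by (intro prob_ge_median) auto
    also have "\<dots> \<le> prob {\<omega>\<in>space P. (?m - r) + r \<le> min (Z \<omega>) ?m}" by (intro finite_measure_mono) auto
    finally show "1 / 2 \<le> prob {\<omega>\<in>space P. (?m - r) + r \<le> min (Z \<omega>) ?m}" .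
    show "prob {\<omega>\<in>space P. Z \<omega> < ?m - r} \<le> prob {\<omega>\<in>space P. min (Z \<omega>) ?m \<le> ?m - r}"
      by (intro finite_measure_mono) auto
  qed auto
  also have "\<dots> \<le> exp (- (r\<^sup>2 / (4 * proxy ?m)))" using assms by (intro prob_truncated_le) auto
  finally show ?thesis by simp
qed

text \<open>The median bound presupposes no moments. For \<open>t\<close> beyond \<open>t0\<close>
  it gives a tail of at most \<open>2 * exp (- (\<delta> * t powr (1 / real k)))\<close>, so the
  \<open>k\<close>-th root of \<open>Z\<close> has an exponential tail, and powers of
  \<open>Z\<close> are powers of that root.\<close>

lemma integrable_power_Z: "integrable P (\<lambda>\<omega>. Z \<omega> ^ n)"
proof -
  let ?m = "smallest_median P Z"
  have m: "0 \<le> ?m" using Z_nonneg by (intro median_nonneg) auto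
  define K where "K = (real k)\<^sup>2 * c_d"
  have K: "0 < K" using k_pos c_d_pos by (simp add: K_def)
  \<comment> \<open>With \<open>r \<ge> t / 2\<close> the exponent is at least
    \<open>(t / 2)\<^sup>2 / (4 * (K * t powr (2 - 1 / real k)))\<close>, which equals
    \<open>t powr (1 / real k) / (16 * K)\<close>.\<close>
  define \<delta> where "\<delta> = 1 / (16 * K)"
  have \<delta>: "0 < \<delta>" using K by (simp add: \<delta>_def)
  define Y where "Y = (\<lambda>\<omega>. Z \<omega> powr (1 / real k))"
  have kinv: "0 < 1 / real k" using k_pos by simp
  define t0 where "t0 = max 1 (2 * ?m)"
  have tail: "prob {\<omega>\<in>space P. t < Z \<omega>} \<le> 2 * exp (- (\<delta> * t powr (1 / real k)))" if t: "t0 \<le> t" for t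
  proof -
    have t1: "1 \<le> t" "2 * ?m \<le> t" using t by (auto simp: t0_def)
    define r where "r = t - ?m"
    have r: "t / 2 \<le> r" "0 \<le> r" "?m + r = t" using t1 by (auto simp: r_def)
    have "prob {\<omega>\<in>space P. ?m + r < Z \<omega>} \<le> 2 * exp (- (r\<^sup>2 / (4 * proxy (?m + r))))"
      using r t1 by (intro upper_tail_median) auto
    then have "prob {\<omega>\<in>space P. t < Z \<omega>} \<le> 2 * exp (- (r\<^sup>2 / (4 * proxy t)))" by (simp only: r(3))
    also have "\<dots> \<le> 2 * exp (- (\<delta> * t powr (1 / real k)))"
    proof -
      have "t powr (1 / real k) * t powr (2 - 1 / real k) = t\<^sup>2" using t1 by (simp flip: powr_add)
      then have "\<delta> * t powr (1 / real k) = (t / 2)\<^sup>2 / (4 * (K * t powr (2 - 1 / real k)))"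
        using t1 K by (simp add: \<delta>_def field_simps power2_eq_square)
      also have "\<dots> \<le> r\<^sup>2 / (4 * (K * t powr (2 - 1 / real k)))"
        using r t1 K by (intro divide_right_mono power_mono) auto
      finally show ?thesis by (simp add: proxy_def K_def)
    qed
    finally show ?thesis .
  qed
  \<comment> \<open>Below \<open>t0\<close> only the trivial bound 1 is used, which the second entry
    of the maximum accommodates.\<close>
  define C where "C = max 2 (exp (\<delta> * t0))"
  have "integrable P (\<lambda>\<omega>. Y \<omega> ^ (k * n))"
  proof (rule integrable_power_of_exponential_tail[OF _ _ \<delta>])
    show "Y \<in> borel_measurable P" unfolding Y_def by measurable
    show "0 \<le> Y \<omega>" for \<omega> by (simp add: Y_def)
    fix j :: nat
    show "prob {\<omega>\<in>space P. real j < Y \<omega>} \<le> C * exp (- (\<delta> * real j))"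
    proof (cases "t0 \<le> real j")
      case True
      then have j1: "1 \<le> real j" by (simp add: t0_def)
      have jk: "(real j ^ k) powr (1 / real k) = real j" using k_pos j1 by (simp add: powr_powr flip: powr_realpow)
      have "real j \<le> real j ^ k" using j1 k_pos by (intro self_le_power) auto
      with True have "t0 \<le> real j ^ k" by (rule order_trans)
      have "real j ^ k < Z \<omega>" if "real j < Y \<omega>" for \<omega>
      proof (rule ccontr)
        assume "\<not> real j ^ k < Z \<omega>"
        then have "Y \<omega> \<le> (real j ^ k) powr (1 / real k)" unfolding Y_def using Z_nonneg by (intro powr_mono2) auto
        then show False using that jk by simp
      qed
      then have "prob {\<omega>\<in>space P. real j < Y \<omega>} \<le> prob {\<omega>\<in>space P. real j ^ k < Z \<omega>}"
        by (intro finite_measure_mono) auto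
      also have "\<dots> \<le> 2 * exp (- (\<delta> * real j))" using tail[OF \<open>t0 \<le> real j ^ k\<close>] by (simp add: jk)
      also have "\<dots> \<le> C * exp (- (\<delta> * real j))" by (intro mult_right_mono) (auto simp: C_def)
      finally show ?thesis .
    next
      case False
      have "prob {\<omega>\<in>space P. real j < Y \<omega>} \<le> 1" by simp
      also have "1 \<le> exp (\<delta> * t0) * exp (- (\<delta> * real j))" using False \<delta> by (simp flip: exp_add)
      also have "\<dots> \<le> C * exp (- (\<delta> * real j))" by (intro mult_right_mono) (auto simp: C_def)
      finally show ?thesis .
    qed
  qed
  moreover have "Y \<omega> ^ (k * n) = Z \<omega> ^ n" for \<omega>
  proof -
    have "Y \<omega> ^ k = Z \<omega>"
    proof (cases "Z \<omega> = 0")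
      case False
      then have "0 < Z \<omega>" using Z_nonneg[of \<omega>] by simp
      then show ?thesis using k_pos by (simp add: Y_def powr_powr flip: powr_realpow)
    qed (use k_pos in \<open>simp add: Y_def\<close>)
    then show ?thesis by (simp add: power_mult)
  qed
  ultimately show ?thesis by simp
qed

lemma integrable_Z: "integrable P Z"
  using integrable_power_Z[of 1] by simp

lemma X_le_Z: "AE \<omega> in P. X n \<omega> \<le> Z \<omega>"
  using X_tendsto by eventually_elim simp

text \<open>The windows grow to the whole space. With the moments of \<open>Z\<close> known to be
  finite, \<open>Z\<close> and its square serve as dominating functions, so means and variances
  converge as well.\<close>

lemma lower_exp_moment:
  assumes l: "0 < l"
  shows "(\<integral>\<omega>. exp (- (l * Z \<omega>)) \<partial>P) \<le> exp (- (l * expectation Z) + l\<^sup>2 / 2 * (real k * variance Z))"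
proof -
  have X1: "(\<lambda>n. expectation (X n)) \<longlonglongrightarrow> expectation Z"
    using X_le_Z X_nonneg by (intro expectation_limit[where \<phi>="\<lambda>x. x" and w=Z] integrable_Z continuous_intros) auto
  have X2: "(\<lambda>n. \<integral>\<omega>. (X n \<omega>)\<^sup>2 \<partial>P) \<longlonglongrightarrow> (\<integral>\<omega>. (Z \<omega>)\<^sup>2 \<partial>P)"
  proof (intro expectation_limit[where \<phi>="\<lambda>x. x\<^sup>2" and w="\<lambda>\<omega>. (Z \<omega>)\<^sup>2"] integrable_power_Z continuous_intros)
    show "AE \<omega> in P. \<bar>(X n \<omega>)\<^sup>2\<bar> \<le> (Z \<omega>)\<^sup>2" for n
      using X_le_Z[of n] by eventually_elim (simp add: power_mono X_nonneg)
  qed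
  have intX: "integrable P (X n)" "integrable P (\<lambda>\<omega>. (X n \<omega>)\<^sup>2)" for n
    unfolding X_def using integrable_window[OF bborel_cball tame_F] integrable_window[OF bborel_cball tame_power2[OF tame_F]] .
  have varX: "variance (X n) = (\<integral>\<omega>. (X n \<omega>)\<^sup>2 \<partial>P) - (expectation (X n))\<^sup>2" for n
    by (rule variance_eq[OF intX])
  have varZ: "variance Z = (\<integral>\<omega>. (Z \<omega>)\<^sup>2 \<partial>P) - (expectation Z)\<^sup>2"
    by (rule variance_eq[OF integrable_Z integrable_power_Z])
  have V: "(\<lambda>n. variance (X n)) \<longlonglongrightarrow> variance Z"
    unfolding varX varZ by (intro tendsto_diff tendsto_power X1 X2)
  have E: "(\<lambda>n. \<integral>\<omega>. exp (- (l * X n \<omega>)) \<partial>P) \<longlonglongrightarrow> (\<integral>\<omega>. exp (- (l * Z \<omega>)) \<partial>P)"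
    using l X_nonneg
    by (intro expectation_limit[where w="\<lambda>_. 1" and \<phi>="\<lambda>x. exp (- (l * x))"] continuous_intros) auto
  have R: "(\<lambda>n. exp (- (l * expectation (X n)) + l\<^sup>2 / 2 * (real k * variance (X n))))
     \<longlonglongrightarrow> exp (- (l * expectation Z) + l\<^sup>2 / 2 * (real k * variance Z))"
    by (intro tendsto_intros X1 V)
  have le: "(\<integral>\<omega>. exp (- (l * X n \<omega>)) \<partial>P) \<le> exp (- (l * expectation (X n)) + l\<^sup>2 / 2 * (real k * variance (X n)))" for n
    unfolding X_def[abs_def] by (rule window_lower[OF bborel_cball l])
  show ?thesis by (rule LIMSEQ_le[OF E R]) (use le in blast)
qed

lemma lower_tail_mean:
  assumes r: "0 \<le> r" and V: "0 < variance Z"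
  shows "prob {\<omega>\<in>space P. Z \<omega> \<le> expectation Z - r} \<le> exp (- (r\<^sup>2 / (2 * real k * variance Z)))"
proof -
  have v: "0 < real k * variance Z" using V k_pos by simp
  have "prob {\<omega>\<in>space P. - expectation Z + r \<le> - Z \<omega>} \<le> exp (- (r\<^sup>2 / (2 * (real k * variance Z))))"
  proof (rule subgaussian_tail[OF _ v r])
    show "integrable P (\<lambda>\<omega>. exp (l * - Z \<omega>))" if "0 < l" for l
      by (rule integrable_const_bound[of _ 1]) (use that Z_nonneg in auto)
    show "expectation (\<lambda>\<omega>. exp (l * - Z \<omega>)) \<le> exp (l * - expectation Z + l\<^sup>2 * (real k * variance Z) / 2)"
      if "0 < l" for l using lower_exp_moment[OF that] by simp
  qed simp
  also have "{\<omega>\<in>space P. - expectation Z + r \<le> - Z \<omega>} = {\<omega>\<in>space P. Z \<omega> \<le> expectation Z - r}" by auto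
  finally show ?thesis by (simp add: mult.assoc)
qed

text \<open>The truncated mean \<open>e\<close> is at most \<open>expectation Z\<close>, so a
  distance of at least \<open>r\<close> separates it from \<open>b\<close>, and the sub-Gaussian
  exponent is at least \<open>r\<^sup>2 / (2 * proxy b)\<close>. The expression with the difference
  of roots is a lower estimate of this exponent.\<close>

lemma upper_tail_mean:
  assumes r: "0 \<le> r"
  shows "prob {\<omega>\<in>space P. expectation Z + r \<le> Z \<omega>} \<le>
    exp (- (((expectation Z + r) powr (1 / (2 * real k)) - expectation Z powr (1 / (2 * real k)))\<^sup>2 / (2 * (real k)\<^sup>2 * c_d)))"
proof (cases "r = 0")
  case True
  then show ?thesis by simp
next
  case False
  define a where "a = expectation Z"
  define b where "b = a + r"
  define \<beta> where "\<beta> = 1 / (2 * real k)"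
  have a: "0 \<le> a" unfolding a_def using Z_nonneg by (intro Bochner_Integration.integral_nonneg) auto
  have b: "0 < b" using a r False by (simp add: b_def)
  have \<beta>: "0 < \<beta>" "\<beta> \<le> 1" using k_pos by (auto simp: \<beta>_def)
  define K where "K = (real k)\<^sup>2 * c_d"
  have K: "0 < K" using k_pos c_d_pos by (simp add: K_def)
  define e where "e = (\<integral>\<omega>. min (Z \<omega>) b \<partial>P)"
  have e: "e \<le> a" unfolding e_def a_def
  proof (rule integral_mono)
    show "integrable P (\<lambda>\<omega>. min (Z \<omega>) b)" by (rule integrable_const_bound[of _ b]) (use b Z_nonneg in auto)
  qed (auto intro: integrable_Z)
  have "prob {\<omega>\<in>space P. b \<le> Z \<omega>} \<le> prob {\<omega>\<in>space P. e + (b - e) \<le> min (Z \<omega>) b}"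
    by (intro finite_measure_mono) auto
  also have "\<dots> \<le> exp (- ((b - e)\<^sup>2 / (2 * proxy b)))"
    unfolding e_def[symmetric] using prob_truncated_mean[OF b, of "b - e"] e r by (simp add: e_def b_def)
  also have "\<dots> \<le> exp (- ((b powr \<beta> - a powr \<beta>)\<^sup>2 / (2 * K)))"
  proof -
    \<comment> \<open>Since \<open>b powr \<beta> = b * b powr (\<beta> - 1)\<close>, the claim
      reduces to \<open>a * b powr (\<beta> - 1) \<le> a powr \<beta>\<close>, true because the
      exponent \<open>\<beta> - 1\<close> is not positive and \<open>a \<le> b\<close>.\<close>
    have "(b powr \<beta> - a powr \<beta>) \<le> r * b powr (\<beta> - 1)"
    proof -
      have "a * b powr (\<beta> - 1) \<le> a powr \<beta>"
      proof (cases "a = 0")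
        case False
        then have a0: "0 < a" using a by simp
        have "b powr (\<beta> - 1) \<le> a powr (\<beta> - 1)" using a0 \<beta> r by (intro powr_mono2') (auto simp: b_def)
        then have "a * b powr (\<beta> - 1) \<le> a * a powr (\<beta> - 1)" using a by (intro mult_left_mono) auto
        also have "\<dots> = a powr \<beta>" using a0 by (simp add: powr_diff)
        finally show ?thesis .
      qed simp
      moreover have "b powr \<beta> = b * b powr (\<beta> - 1)" using b by (simp add: powr_diff)
      ultimately show ?thesis by (simp add: b_def algebra_simps)
    qed
    moreover have "0 \<le> b powr \<beta> - a powr \<beta>" using a r \<beta> by (simp add: b_def powr_mono2)
    ultimately have "(b powr \<beta> - a powr \<beta>)\<^sup>2 \<le> (r * b powr (\<beta> - 1))\<^sup>2" by (intro power_mono) auto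
    also have "\<dots> = r\<^sup>2 * b powr (2 * \<beta> - 2)"
    proof -
      have "(b powr (\<beta> - 1))\<^sup>2 = b powr (2 * \<beta> - 2)" using b by (simp add: power2_eq_square algebra_simps flip: powr_add)
      then show ?thesis by (simp add: power_mult_distrib)
    qed
    finally have "(b powr \<beta> - a powr \<beta>)\<^sup>2 / (2 * K) \<le> r\<^sup>2 * b powr (2 * \<beta> - 2) / (2 * K)"
      using K by (intro divide_right_mono) auto
    also have "\<dots> = r\<^sup>2 / (2 * proxy b)"
    proof -
      have "2 * \<beta> - 2 = - (2 - 1 / real k)" by (simp add: \<beta>_def)
      then have "b powr (2 * \<beta> - 2) = 1 / b powr (2 - 1 / real k)" using b by (simp only: powr_minus_divide)
      then show ?thesis by (simp add: proxy_def K_def)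
    qed
    also have "\<dots> \<le> (b - e)\<^sup>2 / (2 * proxy b)"
      using r e proxy_pos[OF b] by (intro divide_right_mono power_mono) (auto simp: b_def)
    finally show ?thesis by simp
  qed
  finally show ?thesis by (simp add: b_def a_def \<beta>_def K_def mult.assoc)
qed

text \<open>For zero variance the quotient in the theorem is infinite and the bound 0, so the
  probability itself must vanish; Chebyshev's inequality shows this.\<close>

lemma prob_le_mean_degenerate:
  assumes r: "0 < r" and V: "variance Z = 0"
  shows "prob {\<omega>\<in>space P. Z \<omega> \<le> expectation Z - r} = 0"
proof -
  have "prob {\<omega>\<in>space P. Z \<omega> \<le> expectation Z - r} \<le> prob {\<omega>\<in>space P. r \<le> \<bar>Z \<omega> - expectation Z\<bar>}"
    using r by (intro finite_measure_mono) auto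
  also have "\<dots> \<le> variance Z / r\<^sup>2"
    using r by (intro Chebyshev_inequality integrable_power_Z) auto
  finally show ?thesis using V by (simp add: antisym)
qed

end

end

lemma exp_ereal_quotient: "0 < y \<Longrightarrow> exp_ereal (- (ereal x / ereal y)) = ereal (exp (- (x / y)))"
  by (simp add: exp_ereal_def)

text \<open>The case \<open>y = 0\<close> is included through the convention for
  \<open>0 / 0\<close>, which settles \<open>r = 0\<close> in the degenerate bounds.\<close>

lemma exp_ereal_zero: "exp_ereal (- (ereal 0 / y)) = 1"
proof -
  have "- (ereal 0 / y) = ereal 0" by (simp flip: zero_ereal_def)
  then show ?thesis by (simp add: exp_ereal_def)
qed

lemma exp_ereal_pos_div_zero: "0 < x \<Longrightarrow> exp_ereal (- (ereal x / ereal 0)) = 0"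
  by (simp add: exp_ereal_def)

theorem corollary3p4:
  fixes P :: "'w measure"
    and \<mu> :: "(real ^ 'd) measure"
    and \<eta> :: "'w \<Rightarrow> (real ^ 'd) set"
    and k :: nat
    and f :: "(nat \<Rightarrow> real ^ 'd) \<Rightarrow> real"
    and \<rho> \<Theta> M m :: real
  defines "F \<equiv> \<lambda>\<omega>. enn2real (u_statistic k f (\<eta> \<omega>))"
  defines "EF \<equiv> prob_space.expectation P F"
  defines "VF \<equiv> prob_space.variance P F"
  defines "MF \<equiv> smallest_median P F"
  defines "c \<equiv> c_const CARD('d) k \<Theta> M m"
  assumes "sets \<mu> = sets borel"
    and "locally_finite_measure \<mu>" and "non_atomic \<mu>" and "emeasure \<mu> (space \<mu>) \<noteq> 0"
    and "poisson_process P \<mu> \<eta>"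
    and "k \<ge> 1"
    and "f \<in> borel_measurable (PiM {..<k} (\<lambda>_. borel))"
    and "symmetric_kernel k f"
    and "\<And>x. x \<in> {..<k} \<rightarrow>\<^sub>E UNIV \<Longrightarrow> f x \<ge> 0"
    and "AE \<omega> in P. u_statistic k f (\<eta> \<omega>) < \<infinity>"
    and "\<rho> > 0" and "\<Theta> \<ge> 1" and "M \<ge> m" and "m > 0"
    and K1: "\<And>x. x \<in> {..<k} \<rightarrow>\<^sub>E UNIV \<Longrightarrow> tuple_diam k x \<le> \<rho> \<Longrightarrow> f x > 0"
    and K2: "\<And>x. x \<in> {..<k} \<rightarrow>\<^sub>E UNIV \<Longrightarrow> tuple_diam k x > \<Theta> * \<rho> \<Longrightarrow> f x = 0"
    and K3: "\<And>x. x \<in> {..<k} \<rightarrow>\<^sub>E UNIV \<Longrightarrow> f x > 0 \<Longrightarrow> M \<ge> f x \<and> f x \<ge> m"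
  shows "(\<forall>n::nat. integrable P (\<lambda>\<omega>. F \<omega> ^ n)) \<and>
    (\<forall>r\<ge>0.
      ereal (\<P>(\<omega> in P. F \<omega> \<ge> EF + r))
        \<le> exp_ereal (- (ereal (((EF + r) powr (1 / (2 * real k)) - EF powr (1 / (2 * real k)))\<^sup>2)
                        / ereal (2 * (real k)\<^sup>2 * c))) \<and>
      ereal (\<P>(\<omega> in P. F \<omega> \<le> EF - r))
        \<le> exp_ereal (- (ereal (r\<^sup>2) / ereal (2 * real k * VF))) \<and>
      ereal (\<P>(\<omega> in P. F \<omega> > MF + r))
        \<le> 2 * exp_ereal (- (ereal (r\<^sup>2)
                        / ereal (4 * (real k)\<^sup>2 * c * (r + MF) powr (2 - 1 / real k)))) \<and>
      ereal (\<P>(\<omega> in P. F \<omega> < MF - r))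
        \<le> 2 * exp_ereal (- (ereal (r\<^sup>2)
                        / ereal (4 * (real k)\<^sup>2 * c * MF powr (2 - 1 / real k)))))"
proof -
  have "prob_space P" using \<open>poisson_process P \<mu> \<eta>\<close> by (simp add: poisson_process_def)
  then interpret prob_space P .
  interpret poisson_ustat P \<mu> \<eta> k f M \<rho> \<Theta> m
  proof unfold_locales
    fix x :: "nat \<Rightarrow> real ^ 'd" assume x: "x \<in> {..<k} \<rightarrow>\<^sub>E UNIV"
    \<comment> \<open>(K3) bounds only positive values; elsewhere
      \<open>f x \<le> 0 < M\<close>.\<close>
    show "f x \<le> M" using K3[OF x] \<open>M \<ge> m\<close> \<open>m > 0\<close> by (cases "f x > 0") auto
    show "0 < f x \<Longrightarrow> m \<le> f x" using K3[OF x] by simp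
  qed (use assms in auto)
  note fin = \<open>AE \<omega> in P. u_statistic k f (\<eta> \<omega>) < \<infinity>\<close>
  have F: "F = Z" by (simp add: F_def Z_def fun_eq_iff)
  have c: "c = c_d" by (simp add: c_def c_d_def)
  have vc: "4 * (real k)\<^sup>2 * c * b powr (2 - 1 / real k) = 4 * proxy b" for b by (simp add: proxy_def c)
  have MF_nonneg: "0 \<le> MF" unfolding MF_def F using Z_nonneg by (intro median_nonneg) auto
  have VF_nonneg: "0 \<le> VF" by (simp add: VF_def)
  have VF: "VF = variance Z" and EF: "EF = expectation Z" by (simp_all add: VF_def EF_def F)
  show ?thesis
  proof (intro conjI allI impI)
    show "integrable P (\<lambda>\<omega>. F \<omega> ^ n)" for n unfolding F by (rule integrable_power_Z[OF fin])
  next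
    fix r :: real assume r: "0 \<le> r"
    show "ereal (\<P>(\<omega> in P. F \<omega> \<ge> EF + r))
        \<le> exp_ereal (- (ereal (((EF + r) powr (1 / (2 * real k)) - EF powr (1 / (2 * real k)))\<^sup>2)
                        / ereal (2 * (real k)\<^sup>2 * c)))"
      using upper_tail_mean[OF fin r] c_d_pos k_pos
      by (subst exp_ereal_quotient) (auto simp: F EF c)
    show "ereal (\<P>(\<omega> in P. F \<omega> \<le> EF - r)) \<le> exp_ereal (- (ereal (r\<^sup>2) / ereal (2 * real k * VF)))"
    proof (cases "VF = 0")
      case False
      then have "0 < VF" using VF_nonneg by simp
      then show ?thesis using lower_tail_mean[OF fin r] k_pos
        by (subst exp_ereal_quotient) (auto simp: F EF VF)
    next
      \<comment> \<open>By the conventions the right-hand side is 1 for \<open>r = 0\<close> and 0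
        for \<open>r > 0\<close>.\<close>
      case V: True
      show ?thesis
      proof (cases "r = 0")
        case True
        then show ?thesis using exp_ereal_zero[of "ereal 0"] V prob_le_1 by (simp add: one_ereal_def)
      next
        case False
        then have "\<P>(\<omega> in P. F \<omega> \<le> EF - r) = 0"
          unfolding F EF using r V VF by (intro prob_le_mean_degenerate[OF fin]) auto
        then show ?thesis using exp_ereal_pos_div_zero[of "r\<^sup>2"] False V by simp
      qed
    qed
    show "ereal (\<P>(\<omega> in P. F \<omega> > MF + r))
        \<le> 2 * exp_ereal (- (ereal (r\<^sup>2) / ereal (4 * (real k)\<^sup>2 * c * (r + MF) powr (2 - 1 / real k))))"
    proof (cases "MF + r = 0")
      case False
      then have "0 < MF + r" using MF_nonneg r by simp
      then show ?thesis
        unfolding vc using upper_tail_median[OF fin r] proxy_pos[of "MF + r"]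
        by (subst exp_ereal_quotient) (auto simp: F MF_def add.commute)
    next
      \<comment> \<open>Since the median is nonnegative, both summands vanish, and the right-hand
        side is 2.\<close>
      case True
      then have "r = 0" using MF_nonneg r by simp
      then have "exp_ereal (- (ereal (r\<^sup>2) / y)) = 1" for y by (simp only: zero_power2 exp_ereal_zero)
      moreover have "\<P>(\<omega> in P. F \<omega> > MF + r) \<le> 2" by (rule order_trans[OF prob_le_1]) simp
      ultimately show ?thesis by (simp only: mult_1_right) simp
    qed
    show "ereal (\<P>(\<omega> in P. F \<omega> < MF - r))
        \<le> 2 * exp_ereal (- (ereal (r\<^sup>2) / ereal (4 * (real k)\<^sup>2 * c * MF powr (2 - 1 / real k))))"
    proof (cases "MF = 0")
      case False
      then have "0 < MF" using MF_nonneg by simp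
      then show ?thesis
        unfolding vc using lower_tail_median[OF fin r] proxy_pos[of MF]
        by (subst exp_ereal_quotient) (auto simp: F MF_def)
    next
      \<comment> \<open>The event is empty, because a nonnegative variable is never below
        \<open>- r\<close>; it remains to see that the right-hand side is nonnegative.\<close>
      case True
      have "\<not> F \<omega> < MF - r" for \<omega> using True r Z_nonneg[of \<omega>] by (simp add: F)
      then have "{\<omega>\<in>space P. F \<omega> < MF - r} = {}" by blast
      then have "\<P>(\<omega> in P. F \<omega> < MF - r) = 0" by (simp only: measure_empty)
      moreover have "0 \<le> exp_ereal x" for x by (cases x) (auto simp: exp_ereal_def)
      then have "0 \<le> 2 * exp_ereal x" for x by simp
      ultimately show ?thesis by (simp only: zero_ereal_def[symmetric])
    qed
  qed
qed

end
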